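(* Let $\mathcal S=\{S_i\}_{i\in I}$ be a family of nested sets as described in the context, with $u\ge 2$ and $l\le n-|S_m|$. Then $\operatorname{conv}(X^{l,u})$ is the set of all $(z,\delta)\in\mathbb R^n\times\mathbb R^m$ satisfying (i) the inequalities $l\le\sum_{j\in J}z_j\le u$; $z_j+\delta_i\le 1$ for all $i\in I$, $j\in S_i$; $1-\delta_1-\sum_{j\in S_1}z_j\le 0$; $\delta_{i+1}-\delta_i\le 0$ for $i=1,\dots,m-1$; $\delta_i-\delta_{i+1}-\sum_{j\in S_{i+1}\setminus S_i}z_j\le 0$ for $i=1,\dots,m-1$; $-\delta_m\le 0$; $-z_j\le 0$ for all $j\in J$; $z_j\le 1$ for all $j\in J\setminus S_m$; (ii) for all $p\in I$ and all $S'\subseteq J$ with $|S'\setminus S_p|\le u-1$, $$\sum_{j\in S'}z_j+\bigl(u-|S'\setminus S_p|\bigr)\delta_p+\sum_{i=p+1}^m\bigl(|S'\setminus S_{i-1}|-|S'\setminus S_i|\bigr)\delta_i\le u;$$ (iii) for all $p\in I$ and all $S'\subsetneq J$ with $|S'\cup S_{p-1}|\le n-l<|S'\cup S_p|$, $$\sum_{j\in S'}z_j\ \ge\ \bigl(|S'\cup S_p|-n+l\bigr)\delta_p+\sum_{i=p+1}^m\bigl(|S'\cup S_i|-|S'\cup S_{i-1}|\bigr)\delta_i.$$ Moreover, given a point $(z,\delta)\notin\operatorname{conv}(X^{l,u})$, a (most) violated inequality among those in (i)–(iii) can be found in polynomial time.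
   Context: Let $n,m$ be positive integers, $J=\{1,\dots,n\}$, $I=\{1,\dots,m\}$, and let $l,u$ be integers with $0\le l<u$ and $u\ge2$. The sets are nested: $S_1\subsetneq S_2\subsetneq\dots\subsetneq S_m\subsetneq J$, with $|S_1|\ge 2$ and $l\le n-|S_m|$. Put $S_0=\emptyset$. Define $$X^{l,u}=\Bigl\{(z,\delta)\in\{0,1\}^n\times\{0,1\}^m:\ \delta_i=\prod_{j\in S_i}(1-z_j)\ (i\in I),\ l\le\sum_{j\in J}z_j\le u\Bigr\}.$$ Polynomial time is with respect to the encoding size of the input (the sets $S_i$, the integers $l,u$, and the rational point $(z,\delta)$). A most violated inequality is one with maximum violation at the given point. *)

theory Defs
  imports "HOL-Analysis.Analysis" "HOL-Library.Function_Algebras" "HOL-Library.Log_Nat"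
begin

section \<open>Vectors of variable dimension\<close>

text \<open>
  The dimensions \<open>n\<close> and \<open>m\<close> are part of the input of the separation algorithm, so they cannot be
  types. The space \<open>R^n\<close> is rendered as the subspace \<open>vecs n\<close> of functions on \<open>nat\<close> vanishing outside
  \<open>{1..n}\<close>. The pointwise vector space structure on functions makes the library's
  \<^const>\<open>convex\<close> and \<open>convex hull\<close> applicable.
\<close>

instantiation "fun" :: (type, real_vector) real_vector
begin

definition scaleR_fun :: "real \<Rightarrow> ('a \<Rightarrow> 'b) \<Rightarrow> 'a \<Rightarrow> 'b" where
  "scaleR_fun r f = (\<lambda>x. r *\<^sub>R f x)"

instance
  by standard (auto simp: scaleR_fun_def fun_eq_iff scaleR_add_right scaleR_add_left)

end

definition vecs :: "nat \<Rightarrow> (nat \<Rightarrow> 'a::zero) set" where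
  "vecs n = {x. \<forall>j. j \<notin> {1..n} \<longrightarrow> x j = 0}"


section \<open>The multilinear set and the inequalities\<close>

definition nested_family :: "nat \<Rightarrow> nat \<Rightarrow> nat \<Rightarrow> nat \<Rightarrow> (nat \<Rightarrow> nat set) \<Rightarrow> bool" where
  "nested_family n m l u S \<longleftrightarrow>
     1 \<le> n \<and> 1 \<le> m \<and> l < u \<and> 2 \<le> u \<and>
     S 0 = {} \<and> (\<forall>i. 1 \<le> i \<and> i < m \<longrightarrow> S i \<subset> S (i + 1)) \<and> S m \<subset> {1..n} \<and>
     2 \<le> card (S 1) \<and> l \<le> n - card (S m)"

definition X :: "nat \<Rightarrow> nat \<Rightarrow> nat \<Rightarrow> nat \<Rightarrow> (nat \<Rightarrow> nat set) \<Rightarrow> ((nat \<Rightarrow> real) \<times> (nat \<Rightarrow> real)) set" where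
  "X n m l u S =
     {(z, d). z \<in> vecs n \<and> d \<in> vecs m \<and>
        (\<forall>j\<in>{1..n}. z j \<in> {0, 1}) \<and> (\<forall>i\<in>{1..m}. d i \<in> {0, 1}) \<and>
        (\<forall>i\<in>{1..m}. d i = (\<Prod>j\<in>S i. 1 - z j)) \<and>
        real l \<le> (\<Sum>j\<in>{1..n}. z j) \<and> (\<Sum>j\<in>{1..n}. z j) \<le> real u}"

text \<open>
  Names for the inequalities; \<open>violation\<close> below gives their meaning. The two numbers in \<open>Pair_le\<close> are
  \<open>i\<close> and \<open>j\<close>; the arguments of \<open>Upper_lift\<close> and \<open>Lower_lift\<close> are \<open>p\<close> and \<open>S'\<close>.
\<close>

datatype ineq =
    Card_ge
  | Card_le
  | Pair_le nat nat
  | Cover_first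
  | Mono nat
  | Cover_step nat
  | Last_nonneg
  | Nonneg nat
  | Le_one nat
  | Upper_lift nat "nat set"
  | Lower_lift nat "nat set"

definition ineqs :: "nat \<Rightarrow> nat \<Rightarrow> nat \<Rightarrow> nat \<Rightarrow> (nat \<Rightarrow> nat set) \<Rightarrow> ineq set" where
  "ineqs n m l u S =
     {Card_ge, Card_le, Cover_first, Last_nonneg}
     \<union> {Pair_le i j | i j. i \<in> {1..m} \<and> j \<in> S i}
     \<union> {Mono i | i. i \<in> {1..m - 1}}
     \<union> {Cover_step i | i. i \<in> {1..m - 1}}
     \<union> {Nonneg j | j. j \<in> {1..n}}
     \<union> {Le_one j | j. j \<in> {1..n} - S m}
     \<union> {Upper_lift p S' | p S'. p \<in> {1..m} \<and> S' \<subseteq> {1..n} \<and> card (S' - S p) \<le> u - 1}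
     \<union> {Lower_lift p S' | p S'. p \<in> {1..m} \<and> S' \<subset> {1..n} \<and>
          card (S' \<union> S (p - 1)) \<le> n - l \<and> n - l < card (S' \<union> S p)}"

text \<open>
  The amount by which \<open>(z, d)\<close> violates an inequality: left minus right side of a \<open>\<le>\<close>-inequality,
  right minus left side of a \<open>\<ge>\<close>-inequality, scaled exactly as in the system. The inequality holds
  iff this is at most \<open>0\<close>.
\<close>

fun violation :: "nat \<Rightarrow> nat \<Rightarrow> nat \<Rightarrow> nat \<Rightarrow> (nat \<Rightarrow> nat set) \<Rightarrow>
    (nat \<Rightarrow> real) \<times> (nat \<Rightarrow> real) \<Rightarrow> ineq \<Rightarrow> real" where
  "violation n m l u S (z, d) Card_ge = real l - (\<Sum>j\<in>{1..n}. z j)"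
| "violation n m l u S (z, d) Card_le = (\<Sum>j\<in>{1..n}. z j) - real u"
| "violation n m l u S (z, d) (Pair_le i j) = (z j + d i) - 1"
| "violation n m l u S (z, d) Cover_first = (1 - d 1 - (\<Sum>j\<in>S 1. z j)) - 0"
| "violation n m l u S (z, d) (Mono i) = (d (i + 1) - d i) - 0"
| "violation n m l u S (z, d) (Cover_step i) =
     (d i - d (i + 1) - (\<Sum>j\<in>S (i + 1) - S i. z j)) - 0"
| "violation n m l u S (z, d) Last_nonneg = - d m - 0"
| "violation n m l u S (z, d) (Nonneg j) = - z j - 0"
| "violation n m l u S (z, d) (Le_one j) = z j - 1"
| "violation n m l u S (z, d) (Upper_lift p S') =
     ((\<Sum>j\<in>S'. z j) + (real u - real (card (S' - S p))) * d p
       + (\<Sum>i\<in>{p + 1..m}. (real (card (S' - S (i - 1))) - real (card (S' - S i))) * d i))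
     - real u"
| "violation n m l u S (z, d) (Lower_lift p S') =
     ((real (card (S' \<union> S p)) - real n + real l) * d p
       + (\<Sum>i\<in>{p + 1..m}. (real (card (S' \<union> S i)) - real (card (S' \<union> S (i - 1)))) * d i))
     - (\<Sum>j\<in>S'. z j)"

definition most_violated :: "nat \<Rightarrow> nat \<Rightarrow> nat \<Rightarrow> nat \<Rightarrow> (nat \<Rightarrow> nat set) \<Rightarrow>
    (nat \<Rightarrow> real) \<times> (nat \<Rightarrow> real) \<Rightarrow> ineq \<Rightarrow> bool" where
  "most_violated n m l u S x c \<longleftrightarrow>
     c \<in> ineqs n m l u S \<and> violation n m l u S x c > 0 \<and>
     (\<forall>c'\<in>ineqs n m l u S. violation n m l u S x c' \<le> violation n m l u S x c)"


section \<open>Polynomial time\<close>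

text \<open>
  The machine model is the random access machine under the logarithmic cost criterion, with
  structured control flow. Memory cells are indexed by integers and hold integers; addresses are
  computed, so that indirect addressing is available. Every evaluation of a subexpression, address
  expressions included, is charged the bit length of its value.
  Since a value costs at least its length, multiplication gives no more than a polynomial advantage
  over Turing machines.
\<close>

datatype aexp =
    Const int
  | Load aexp
  | Add aexp aexp
  | Sub aexp aexp
  | Mul aexp aexp

datatype com =
    Skip
  | Store aexp aexp  \<comment> \<open>address, value\<close>
  | Seq com com
  | If_pos aexp com com
  | While_pos aexp com

type_synonym memory = "int \<Rightarrow> int"

text \<open>The extra bit accounts for the sign, and makes every value have positive length.\<close>

definition bit_length :: "int \<Rightarrow> nat" where
  "bit_length k = floorlog 2 (nat \<bar>k\<bar>) + 1"

fun aval :: "aexp \<Rightarrow> memory \<Rightarrow> int" where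
  "aval (Const k) s = k"
| "aval (Load a) s = s (aval a s)"
| "aval (Add a b) s = aval a s + aval b s"
| "aval (Sub a b) s = aval a s - aval b s"
| "aval (Mul a b) s = aval a s * aval b s"

fun cost :: "aexp \<Rightarrow> memory \<Rightarrow> nat" where
  "cost (Const k) s = bit_length k"
| "cost (Load a) s = cost a s + bit_length (aval (Load a) s)"
| "cost (Add a b) s = cost a s + cost b s + bit_length (aval (Add a b) s)"
| "cost (Sub a b) s = cost a s + cost b s + bit_length (aval (Sub a b) s)"
| "cost (Mul a b) s = cost a s + cost b s + bit_length (aval (Mul a b) s)"

text \<open>\<open>exec c s t s'\<close>: started in memory \<open>s\<close>, program \<open>c\<close> halts in memory \<open>s'\<close> after time \<open>t\<close>.\<close>

inductive exec :: "com \<Rightarrow> memory \<Rightarrow> nat \<Rightarrow> memory \<Rightarrow> bool" where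
  Skip: "exec Skip s 1 s"
| Store: "exec (Store a e) s (cost a s + cost e s) (s(aval a s := aval e s))"
| Seq: "exec c1 s t1 s' \<Longrightarrow> exec c2 s' t2 s'' \<Longrightarrow> exec (Seq c1 c2) s (t1 + t2) s''"
| If_true: "aval e s > 0 \<Longrightarrow> exec c1 s t s' \<Longrightarrow> exec (If_pos e c1 c2) s (cost e s + t) s'"
| If_false: "\<not> aval e s > 0 \<Longrightarrow> exec c2 s t s' \<Longrightarrow> exec (If_pos e c1 c2) s (cost e s + t) s'"
| While_true: "aval e s > 0 \<Longrightarrow> exec c s t s' \<Longrightarrow> exec (While_pos e c) s' t' s'' \<Longrightarrow>
    exec (While_pos e c) s (cost e s + t + t') s''"
| While_false: "\<not> aval e s > 0 \<Longrightarrow> exec (While_pos e c) s (cost e s) s"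

text \<open>
  Lists are passed to and from a program in the cells \<open>0, 1, ..., k\<close>, the length \<open>k\<close> coming first.
  All other cells are \<open>0\<close> initially, and arbitrary at the end.
\<close>

definition initial_memory :: "int list \<Rightarrow> memory" where
  "initial_memory xs = (\<lambda>a. if a = 0 then int (length xs)
     else if 1 \<le> a \<and> a \<le> int (length xs) then xs ! nat (a - 1) else 0)"

definition holds_list :: "memory \<Rightarrow> int list \<Rightarrow> bool" where
  "holds_list s ys \<longleftrightarrow> s 0 = int (length ys) \<and> (\<forall>i < length ys. s (int i + 1) = ys ! i)"

definition encoding_size :: "int list \<Rightarrow> nat" where
  "encoding_size xs = (\<Sum>x\<leftarrow>xs. bit_length x)"

text \<open>
  A search problem on the inputs \<open>D\<close>: a single program finds, for every input \<open>x\<close> in \<open>D\<close>, some \<open>y\<close>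
  with \<open>R x y\<close>, within time polynomial in the encoding size of \<open>x\<close>. The length of the output is
  charged as well, as output cells need not have been written.
\<close>

definition poly_time_search ::
  "('a \<Rightarrow> int list) \<Rightarrow> ('b \<Rightarrow> int list) \<Rightarrow> 'a set \<Rightarrow> ('a \<Rightarrow> 'b \<Rightarrow> bool) \<Rightarrow> bool" where
  "poly_time_search encode_in encode_out D R \<longleftrightarrow>
     (\<exists>prog a k. \<forall>x\<in>D. \<exists>t s y.
        exec prog (initial_memory (encode_in x)) t s \<and> holds_list s (encode_out y) \<and> R x y \<and>
        t + encoding_size (encode_out y) \<le> a * encoding_size (encode_in x) ^ k + a)"


section \<open>The separation problem\<close>

type_synonym separation_input =
  "nat \<times> nat \<times> nat \<times> nat \<times> (nat \<Rightarrow> nat set) \<times> (nat \<Rightarrow> rat) \<times> (nat \<Rightarrow> rat)"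

definition encode_rat :: "rat \<Rightarrow> int list" where
  "encode_rat q = [fst (quotient_of q), snd (quotient_of q)]"

text \<open>The sets are given by their incidence vectors.\<close>

fun encode_input :: "separation_input \<Rightarrow> int list" where
  "encode_input (n, m, l, u, S, z, d) =
     [int n, int m, int l, int u]
     @ concat (map (\<lambda>i. map (\<lambda>j. if j \<in> S i then 1 else 0) [1..<n + 1]) [1..<m + 1])
     @ concat (map (\<lambda>j. encode_rat (z j)) [1..<n + 1])
     @ concat (map (\<lambda>i. encode_rat (d i)) [1..<m + 1])"

fun encode_ineq :: "ineq \<Rightarrow> int list" where
  "encode_ineq Card_ge = [0]"
| "encode_ineq Card_le = [1]"
| "encode_ineq (Pair_le i j) = [2, int i, int j]"
| "encode_ineq Cover_first = [3]"
| "encode_ineq (Mono i) = [4, int i]"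
| "encode_ineq (Cover_step i) = [5, int i]"
| "encode_ineq Last_nonneg = [6]"
| "encode_ineq (Nonneg j) = [7, int j]"
| "encode_ineq (Le_one j) = [8, int j]"
| "encode_ineq (Upper_lift p S') = [9, int p] @ map int (sorted_list_of_set S')"
| "encode_ineq (Lower_lift p S') = [10, int p] @ map int (sorted_list_of_set S')"

definition real_point :: "(nat \<Rightarrow> rat) \<Rightarrow> (nat \<Rightarrow> rat) \<Rightarrow> (nat \<Rightarrow> real) \<times> (nat \<Rightarrow> real)" where
  "real_point z d = (\<lambda>j. of_rat (z j), \<lambda>i. of_rat (d i))"

definition separation_inputs :: "separation_input set" where
  "separation_inputs =
     {(n, m, l, u, S, z, d). nested_family n m l u S \<and> z \<in> vecs n \<and> d \<in> vecs m \<and>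
        real_point z d \<notin> convex hull (X n m l u S)}"

fun separates :: "separation_input \<Rightarrow> ineq \<Rightarrow> bool" where
  "separates (n, m, l, u, S, z, d) c \<longleftrightarrow> most_violated n m l u S (real_point z d) c"

end

theory Submission
  imports Defs
begin

text \<open>
  A point of the multilinear set is an integral vector \<open>z\<close> together with the index of the first set
  of the family that \<open>z\<close> hits: if that index is \<open>k\<close>, then \<open>\<delta>\<^sub>i = 1\<close> for \<open>i < k\<close> and \<open>\<delta>\<^sub>i = 0\<close>
  otherwise, where \<open>k = m + 1\<close> means that no set is hit. Thus \<open>X\<close> is a union of \<open>m + 1\<close> pieces, and in
  a convex combination equal to \<open>(z, \<delta>)\<close> the piece \<open>k\<close> must receive the weight
  \<open>\<lambda>\<^sub>k = \<delta>\<^sub>k\<^sub>-\<^sub>1 - \<delta>\<^sub>k\<close> (with \<open>\<delta>\<^sub>0 = 1\<close>, \<open>\<delta>\<^sub>m\<^sub>+\<^sub>1 = 0\<close>).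

  Within one piece, \<open>z\<close> is constrained by a laminar family of cardinality bounds, and such a piece is
  governed by a greedy principle: for every functional \<open>c\<close>, one and the same integral point maximises
  \<open>z(A)\<close> for all level sets \<open>A = {c \<ge> t}\<close> with \<open>t > 0\<close> and minimises it for all \<open>A = {c \<le> t}\<close> with
  \<open>t < 0\<close> (\<open>greedy_level\<close>). Call these extreme values \<open>b\<^sub>k(A)\<close> and \<open>p\<^sub>k(A)\<close>. If all inequalities
  \<open>\<Sum> \<lambda>\<^sub>k p\<^sub>k(A) \<le> z(A) \<le> \<Sum> \<lambda>\<^sub>k b\<^sub>k(A)\<close> hold, then no linear functional separates \<open>(z, \<delta>)\<close> from \<open>X\<close>:
  by a layer-cake decomposition of the functional into its level sets, the \<open>\<lambda>\<close>-combination of the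
  greedy points has at least the same value (\<open>satisfies_in_hull\<close>).

  It remains to derive these inequalities from the system. Both ranks are explicit, and up to the
  cover term they are truncations of \<open>|A - S\<^sub>k\<^sub>-\<^sub>1|\<close> and \<open>|A \<union> S\<^sub>k\<^sub>-\<^sub>1| - n + l\<close>, which are monotone in \<open>k\<close>.
  At the index \<open>p\<close> where the truncation switches, Abel summation turns the right-hand side into the one
  of the lifted inequality for \<open>p\<close>; the levels \<open>k \<le> p\<close> missed by (or contained in) \<open>A\<close> are absorbed by
  adding them to (or removing them from) \<open>A\<close> at the price of the cover inequalities
  (\<open>upper_rank_inequality\<close>, \<open>lower_rank_inequality\<close>).

  For the separation problem, fix \<open>p\<close> in one of the two exponential families. The violation is then a
  constant plus a sum of independent gains over the elements of \<open>S'\<close>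
  (\<open>scaled_Upper_lift\<close>, \<open>scaled_Lower_lift\<close>), and the side conditions depend only on how many
  elements \<open>S'\<close> takes from \<open>S\<^sub>p\<^sub>-\<^sub>1\<close>, from \<open>S\<^sub>p - S\<^sub>p\<^sub>-\<^sub>1\<close> and from the rest. For fixed numbers it is best
  to take the elements of largest gain, so polynomially many candidates suffice
  (\<open>candidates_complete\<close>). All comparisons are done on integers, after scaling by the product \<open>Q\<close> of
  the denominators.

  The program is obtained by compilation. The algorithm is an expression of a small functional language
  whose only loop runs over the indices below the length of the input and whose only multiplication
  has an input cell as second factor. Running times are then polynomial for syntactic reasons: the
  number of steps is bounded through the nesting depth of the loops, and each step lengthens the
  longest number by an amount linear in the input size. A compiler to the random access machine is
  proved correct once and for all with these bounds (\<open>compile_correct\<close>,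
  \<open>poly_time_search_by_expression\<close>), so that for the algorithm itself only its value has to be
  computed.
\<close>

section \<open>Separation from the hull of finitely many points\<close>

text \<open>
  The ambient function space carries no norm, so compactness is obtained from the product topology:
  a hull of finitely many points is built by repeatedly joining one more point, and a join is a
  continuous image of \<open>[0,1]\<close> times the previous hull.
\<close>

lemma compact_convex_hull_finite_fun:
  fixes F :: "('i \<Rightarrow> real) set"
  assumes "finite F"
  shows "compact (convex hull F)"
  using assms
proof (induction F rule: finite_induct)
  case empty
  then show ?case by simp
next
  case (insert a F)
  show ?case
  proof (cases "F = {}")
    case True
    then show ?thesis by simp
  next
    case False
    define g :: "real \<times> ('i \<Rightarrow> real) \<Rightarrow> 'i \<Rightarrow> real" where
      "g = (\<lambda>(t, y). (1 - t) *\<^sub>R a + t *\<^sub>R y)"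
    have cont: "continuous_on ({0..1} \<times> (convex hull F)) g"
    proof (rule continuous_on_coordinatewise_then_product)
      fix i
      have eq: "(\<lambda>x. g x i) = (\<lambda>x. (1 - fst x) * a i + fst x * snd x i)"
        by (auto simp: g_def scaleR_fun_def fun_eq_iff)
      have snd: "continuous_on ({0..1} \<times> (convex hull F)) (\<lambda>x. snd x i)"
        by (rule continuous_on_compose2[OF continuous_on_product_coordinates
              continuous_on_snd[OF continuous_on_id]]) simp
      show "continuous_on ({0..1} \<times> (convex hull F)) (\<lambda>x. g x i)"
        unfolding eq by (intro continuous_intros snd)
    qed
    have "convex hull (insert a F) = g ` ({0..1} \<times> (convex hull F))"
    proof (rule set_eqI)
      fix x
      have "x \<in> convex hull (insert a F) \<longleftrightarrow>
        (\<exists>u v b. 0 \<le> u \<and> 0 \<le> v \<and> u + v = 1 \<and> b \<in> convex hull F \<and> x = u *\<^sub>R a + v *\<^sub>R b)"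
        unfolding convex_hull_insert[OF False] by blast
      also have "\<dots> \<longleftrightarrow> x \<in> g ` ({0..1} \<times> (convex hull F))"
      proof
        assume "\<exists>u v b. 0 \<le> u \<and> 0 \<le> v \<and> u + v = 1 \<and> b \<in> convex hull F \<and> x = u *\<^sub>R a + v *\<^sub>R b"
        then obtain u v b where uv: "0 \<le> u" "0 \<le> v" "u + v = 1" "b \<in> convex hull F"
            "x = u *\<^sub>R a + v *\<^sub>R b" by blast
        then have "u = 1 - v" by simp
        then have "x = g (v, b)" using uv by (simp add: g_def)
        moreover have "(v, b) \<in> {0..1} \<times> (convex hull F)" using uv by auto
        ultimately show "x \<in> g ` ({0..1} \<times> (convex hull F))" by blast
      next
        assume "x \<in> g ` ({0..1} \<times> (convex hull F))"
        then obtain t b where "t \<in> {0..1}" "b \<in> convex hull F" "x = g (t, b)" by auto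
        then show "\<exists>u v b. 0 \<le> u \<and> 0 \<le> v \<and> u + v = 1 \<and> b \<in> convex hull F \<and> x = u *\<^sub>R a + v *\<^sub>R b"
          by (intro exI[of _ "1 - t"] exI[of _ t] exI[of _ b]) (auto simp: g_def)
      qed
      finally show "x \<in> convex hull (insert a F) \<longleftrightarrow> x \<in> g ` ({0..1} \<times> (convex hull F))" .
    qed
    then show ?thesis
      using compact_continuous_image[OF cont] insert.IH by (simp add: compact_Times)
  qed
qed

text \<open>
  As for closed convex sets in Euclidean space, the normal of the separating hyperplane is the
  difference between \<open>w\<close> and its nearest point \<open>y\<close> in the hull. Only the coordinates in \<open>I\<close> matter,
  so the distance is a finite sum of squares.
\<close>
lemma separation_finite_support:
  fixes F :: "('i \<Rightarrow> real) set"
  assumes "finite F" "finite I" "\<And>x i. x \<in> F \<Longrightarrow> i \<notin> I \<Longrightarrow> x i = 0" "\<And>i. i \<notin> I \<Longrightarrow> w i = 0"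
    and "w \<notin> convex hull F"
  shows "\<exists>c. \<forall>x\<in>F. (\<Sum>i\<in>I. c i * x i) < (\<Sum>i\<in>I. c i * w i)"
proof (cases "F = {}")
  case True
  then show ?thesis by simp
next
  case False
  let ?H = "convex hull F"
  define q where "q = (\<lambda>x. \<Sum>i\<in>I. (w i - x i)\<^sup>2)"
  have "continuous_on ?H q"
    unfolding q_def
    by (intro continuous_intros continuous_on_subset[OF continuous_on_product_coordinates]) auto
  then obtain y where y: "y \<in> ?H" "\<And>x. x \<in> ?H \<Longrightarrow> q y \<le> q x"
    using continuous_attains_inf[OF compact_convex_hull_finite_fun[OF assms(1)], of q] False
    by auto
  have sub: "subspace {x :: 'i \<Rightarrow> real. \<forall>i. i \<notin> I \<longrightarrow> x i = 0}"
    by (auto simp: subspace_def scaleR_fun_def)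
  have "?H \<subseteq> {x. \<forall>i. i \<notin> I \<longrightarrow> x i = 0}"
    by (rule hull_minimal) (use assms(3) subspace_imp_convex[OF sub] in auto)
  then have y0: "y i = 0" if "i \<notin> I" for i using y that by auto
  have "w \<noteq> y" using y assms(5) by blast
  then obtain i where i: "w i \<noteq> y i" by (auto simp: fun_eq_iff)
  then have "i \<in> I" using y0 assms(4) by metis
  then have qpos: "q y > 0"
    unfolding q_def using i assms(2) by (intro sum_pos2[of _ i]) auto
  define c where "c = (\<lambda>i. w i - y i)"
  have "(\<Sum>i\<in>I. c i * x i) < (\<Sum>i\<in>I. c i * w i)" if x: "x \<in> F" for x
  proof -
    define b where "b = (\<Sum>i\<in>I. c i * (x i - y i))"
    define a where "a = (\<Sum>i\<in>I. (x i - y i)\<^sup>2)"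
    \<comment> \<open>The point at parameter \<open>t\<close> on the segment from \<open>y\<close> to \<open>x\<close> is not closer to \<open>w\<close> than \<open>y\<close>.\<close>
    have key: "2 * b \<le> t * a" if t: "0 < t" "t \<le> 1" for t
    proof -
      have "x \<in> ?H" using x by (simp add: hull_inc)
      then have "(1 - t) *\<^sub>R y + t *\<^sub>R x \<in> ?H"
        using y(1) t by (intro convexD[OF convex_convex_hull]) auto
      then have "q y \<le> q ((1 - t) *\<^sub>R y + t *\<^sub>R x)" by (rule y(2))
      also have "\<dots> = (\<Sum>i\<in>I. (w i - y i)\<^sup>2 - 2 * t * (c i * (x i - y i)) + t\<^sup>2 * (x i - y i)\<^sup>2)"
        unfolding q_def by (intro sum.cong refl)
          (simp add: scaleR_fun_def c_def power2_eq_square algebra_simps)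
      also have "\<dots> = q y - 2 * t * b + t\<^sup>2 * a"
        by (simp add: q_def a_def b_def sum.distrib sum_subtractf sum_distrib_left)
      finally have "t * (2 * b) \<le> t * (t * a)" by (simp add: power2_eq_square)
      then show ?thesis using t by simp
    qed
    \<comment> \<open>Letting \<open>t\<close> tend to \<open>0\<close> would do; the value \<open>b / a\<close> already gives a contradiction.\<close>
    have "b \<le> 0"
    proof (rule ccontr)
      assume "\<not> b \<le> 0"
      then have b: "b > 0" by simp
      with key[of 1] have a: "a > 0" by simp
      show False
      proof (cases "b \<le> a")
        case True
        then have "2 * b \<le> b / a * a" using a b by (intro key) auto
        then show False using a b by simp
      next
        case False
        then show False using key[of 1] b by simp
      qed
    qed
    moreover have "(\<Sum>i\<in>I. c i * w i) - (\<Sum>i\<in>I. c i * x i) = q y - b"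
      unfolding q_def b_def c_def sum_subtractf[symmetric]
      by (intro sum.cong refl) (simp add: power2_eq_square algebra_simps)
    ultimately show ?thesis using qpos by linarith
  qed
  then show ?thesis by blast
qed

lemma separation_pairs:
  fixes F :: "((nat \<Rightarrow> real) \<times> (nat \<Rightarrow> real)) set"
  assumes fin: "finite F" and F: "F \<subseteq> vecs n \<times> vecs m" and zd: "z \<in> vecs n" "d \<in> vecs m"
    and out: "(z, d) \<notin> convex hull F"
  shows "\<exists>c e. \<forall>(x, y)\<in>F. (\<Sum>j\<in>{1..n}. c j * x j) + (\<Sum>i\<in>{1..m}. e i * y i)
      < (\<Sum>j\<in>{1..n}. c j * z j) + (\<Sum>i\<in>{1..m}. e i * d i)"
proof -
  define \<phi> :: "(nat \<Rightarrow> real) \<times> (nat \<Rightarrow> real) \<Rightarrow> nat + nat \<Rightarrow> real" where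
    "\<phi> = (\<lambda>(x, y). case_sum x y)"
  have lin: "linear \<phi>"
    by (rule linearI) (auto simp: \<phi>_def fun_eq_iff scaleR_fun_def split: sum.splits)
  have inj: "inj \<phi>"
  proof (rule inj_on_inverseI)
    fix p
    show "(\<lambda>f. (\<lambda>j. f (Inl j), \<lambda>i. f (Inr i))) (\<phi> p) = p" by (cases p) (simp add: \<phi>_def)
  qed
  let ?I = "Inl ` {1..n} \<union> Inr ` {1..m} :: (nat + nat) set"
  have "\<phi> (z, d) \<notin> convex hull (\<phi> ` F)"
    using out inj by (simp add: convex_hull_linear_image[OF lin, symmetric] inj_image_mem_iff)
  moreover have "x i = 0" if x: "x \<in> \<phi> ` F" and i: "i \<notin> ?I" for x i
  proof -
    obtain a b where "(a, b) \<in> F" and xab: "x = \<phi> (a, b)" using x by auto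
    then have "a \<in> vecs n" "b \<in> vecs m" using F by auto
    then show ?thesis using i by (cases i) (auto simp: xab \<phi>_def vecs_def image_iff)
  qed
  moreover have "\<phi> (z, d) i = 0" if i: "i \<notin> ?I" for i
    using zd i by (cases i) (auto simp: \<phi>_def vecs_def image_iff)
  ultimately obtain c where c: "\<forall>x\<in>\<phi> ` F. (\<Sum>i\<in>?I. c i * x i) < (\<Sum>i\<in>?I. c i * \<phi> (z, d) i)"
    using separation_finite_support[of "\<phi> ` F" ?I "\<phi> (z, d)"] fin by blast
  have eq: "(\<Sum>i\<in>?I. c i * \<phi> (x, y) i)
      = (\<Sum>j\<in>{1..n}. c (Inl j) * x j) + (\<Sum>i\<in>{1..m}. c (Inr i) * y i)" for x y
    by (subst sum.union_disjoint) (auto simp: sum.reindex \<phi>_def)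
  show ?thesis
  proof (intro exI ballI, clarify)
    fix x y assume "(x, y) \<in> F"
    then have "\<phi> (x, y) \<in> \<phi> ` F" by blast
    with c have "(\<Sum>i\<in>?I. c i * \<phi> (x, y) i) < (\<Sum>i\<in>?I. c i * \<phi> (z, d) i)" by blast
    then show "(\<Sum>j\<in>{1..n}. c (Inl j) * x j) + (\<Sum>i\<in>{1..m}. c (Inr i) * y i)
      < (\<Sum>j\<in>{1..n}. c (Inl j) * z j) + (\<Sum>i\<in>{1..m}. c (Inr i) * d i)"
      by (simp only: eq)
  qed
qed

section \<open>Level sets and greedy subsets\<close>

text \<open>
  A nonnegative \<open>c\<close> is a nonnegative combination of the indicators of its upper level sets. The
  induction peels off the smallest positive value \<open>t\<close>, whose level set is the whole support.
\<close>
lemma layer_cake_nonneg: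
  fixes c w :: "'a \<Rightarrow> real"
  assumes "finite J" "\<And>j. j \<in> J \<Longrightarrow> 0 \<le> c j"
    and "\<And>t. t > 0 \<Longrightarrow> (\<Sum>j\<in>{j \<in> J. t \<le> c j}. w j) \<le> 0"
  shows "(\<Sum>j\<in>J. c j * w j) \<le> 0"
  using assms(2,3)
proof (induction "card {j \<in> J. c j \<noteq> 0}" arbitrary: c rule: less_induct)
  case less
  let ?P = "{j \<in> J. c j \<noteq> 0}"
  show ?case
  proof (cases "?P = {}")
    case True
    then have "(\<Sum>j\<in>J. c j * w j) = 0" by (intro sum.neutral) auto
    then show ?thesis by simp
  next
    case False
    have finP: "finite ?P" using assms(1) by simp
    define t where "t = Min (c ` ?P)"
    have t_le: "t \<le> c j" if "j \<in> ?P" for j using that finP by (auto simp: t_def)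
    have "t \<in> c ` ?P" unfolding t_def using finP False by (intro Min_in) auto
    then obtain j0 where j0: "j0 \<in> ?P" "t = c j0" by auto
    then have t0: "t > 0" using less.prems(1)[of j0] by auto
    define c' where "c' = (\<lambda>j. if c j \<noteq> 0 then c j - t else 0)"
    have c'0: "0 \<le> c' j" if "j \<in> J" for j using t_le[of j] that by (auto simp: c'_def)
    have sub: "{j \<in> J. c' j \<noteq> 0} \<subseteq> ?P - {j0}" using j0 by (auto simp: c'_def)
    then have "card {j \<in> J. c' j \<noteq> 0} \<le> card (?P - {j0})" using finP by (intro card_mono) auto
    also have "\<dots> < card ?P" using j0(1) finP by (intro card_Diff1_less) auto
    finally have lt: "card {j \<in> J. c' j \<noteq> 0} < card ?P" .
    have "(\<Sum>j\<in>J. c' j * w j) \<le> 0"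
    proof (rule less.hyps[OF lt c'0])
      fix s :: real assume s: "s > 0"
      have "{j \<in> J. s \<le> c' j} = {j \<in> J. s + t \<le> c j}"
        using s t0 by (auto simp: c'_def)
      then show "(\<Sum>j\<in>{j \<in> J. s \<le> c' j}. w j) \<le> 0" using less.prems(2)[of "s + t"] s t0 by simp
    qed
    moreover have "(\<Sum>j\<in>?P. w j) \<le> 0"
    proof -
      have "{j \<in> J. t \<le> c j} = ?P" using t_le t0 by auto
      then show ?thesis using less.prems(2)[OF t0] by simp
    qed
    moreover have "(\<Sum>j\<in>J. c j * w j) = (\<Sum>j\<in>J. c' j * w j) + t * (\<Sum>j\<in>?P. w j)"
    proof -
      have "(\<Sum>j\<in>J. c j * w j) = (\<Sum>j\<in>J. c' j * w j + t * (if c j \<noteq> 0 then w j else 0))"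
        by (intro sum.cong refl) (auto simp: c'_def algebra_simps)
      then show ?thesis
        by (simp only: sum.distrib sum_distrib_left[of t] sum.inter_filter[OF assms(1)])
    qed
    ultimately show ?thesis using t0 mult_nonneg_nonpos[of t "\<Sum>j\<in>?P. w j"] by linarith
  qed
qed

lemma layer_cake:
  fixes c w :: "'a \<Rightarrow> real"
  assumes fin: "finite J"
    and up: "\<And>t. t > 0 \<Longrightarrow> (\<Sum>j\<in>{j \<in> J. t \<le> c j}. w j) \<le> 0"
    and low: "\<And>t. t < 0 \<Longrightarrow> 0 \<le> (\<Sum>j\<in>{j \<in> J. c j \<le> t}. w j)"
  shows "(\<Sum>j\<in>J. c j * w j) \<le> 0"
proof -
  have "(\<Sum>j\<in>J. max 0 (c j) * w j) \<le> 0"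
  proof (rule layer_cake_nonneg[OF fin])
    fix t :: real assume "t > 0"
    moreover from this have "{j \<in> J. t \<le> max 0 (c j)} = {j \<in> J. t \<le> c j}" by auto
    ultimately show "(\<Sum>j\<in>{j \<in> J. t \<le> max 0 (c j)}. w j) \<le> 0" using up by simp
  qed simp
  moreover have "(\<Sum>j\<in>J. max 0 (- c j) * - w j) \<le> 0"
  proof (rule layer_cake_nonneg[OF fin])
    fix t :: real assume "t > 0"
    moreover from this have "{j \<in> J. t \<le> max 0 (- c j)} = {j \<in> J. c j \<le> - t}" by auto
    ultimately show "(\<Sum>j\<in>{j \<in> J. t \<le> max 0 (- c j)}. - w j) \<le> 0"
      using low[of "- t"] by (simp add: sum_negf)
  qed simp
  moreover have "(\<Sum>j\<in>J. c j * w j) = (\<Sum>j\<in>J. max 0 (c j) * w j) + (\<Sum>j\<in>J. max 0 (- c j) * - w j)"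
    unfolding sum.distrib[symmetric] by (intro sum.cong refl) (auto simp: max_def)
  ultimately show ?thesis by linarith
qed

text \<open>
  Elements are ranked by decreasing value, ties being broken by the index, so that the ranks of a
  finite set are exactly \<open>0, ..., card G - 1\<close>.
\<close>
definition rank_in :: "nat set \<Rightarrow> (nat \<Rightarrow> 'a::linorder) \<Rightarrow> nat \<Rightarrow> nat" where
  "rank_in G c j = card {i \<in> G. c j < c i \<or> c i = c j \<and> i < j}"

definition top_set :: "nat set \<Rightarrow> (nat \<Rightarrow> 'a::linorder) \<Rightarrow> nat \<Rightarrow> nat set" where
  "top_set G c q = {j \<in> G. rank_in G c j < q}"

lemma rank_in_less:
  assumes "finite G" "i \<in> G" "c j < c i \<or> c i = c j \<and> i < j"
  shows "rank_in G c i < rank_in G c j"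
  unfolding rank_in_def
  by (rule psubset_card_mono) (use assms in \<open>auto simp: psubset_eq\<close>)

lemma inj_on_rank_in:
  assumes "finite G"
  shows "inj_on (rank_in G c) G"
proof (rule inj_onI)
  fix i j assume ij: "i \<in> G" "j \<in> G" "rank_in G c i = rank_in G c j"
  consider "c j < c i" | "c i < c j" | "c i = c j" "i < j" | "c i = c j" "j < i" | "i = j"
    by (meson linorder_less_linear)
  then show "i = j"
    by cases (use rank_in_less[of G i c j] rank_in_less[of G j c i] ij assms in auto)
qed

lemma rank_in_image:
  assumes "finite G"
  shows "rank_in G c ` G = {..<card G}"
proof (rule card_subset_eq)
  show "rank_in G c ` G \<subseteq> {..<card G}"
  proof safe
    fix j assume "j \<in> G"
    then show "rank_in G c j < card G"
      unfolding rank_in_def by (intro psubset_card_mono) (use assms in auto)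
  qed
qed (simp_all add: card_image inj_on_rank_in[OF assms])

lemma card_top_set:
  assumes "finite G"
  shows "card (top_set G c q) = min q (card G)"
proof -
  have "rank_in G c ` top_set G c q = {..<min q (card G)}"
  proof -
    have "rank_in G c ` top_set G c q = {..<q} \<inter> rank_in G c ` G" by (auto simp: top_set_def)
    then show ?thesis by (auto simp: rank_in_image[OF assms])
  qed
  moreover have "inj_on (rank_in G c) (top_set G c q)"
    using inj_on_rank_in[OF assms] by (rule inj_on_subset) (auto simp: top_set_def)
  ultimately show ?thesis by (metis card_image card_lessThan)
qed

lemma top_set_subset: "top_set G c q \<subseteq> G"
  by (auto simp: top_set_def)

lemma top_set_ge:
  assumes "finite G" "i \<in> top_set G c q" "j \<in> G - top_set G c q"
  shows "c j \<le> c i"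
proof (rule ccontr)
  assume "\<not> c j \<le> c i"
  then have "rank_in G c j < rank_in G c i" using assms by (intro rank_in_less) auto
  then show False using assms by (auto simp: top_set_def)
qed

text \<open>
  The greedy set consists of the best elements of \<open>G\<close>: as many as have positive value, corrected to a
  number between \<open>l\<close> and \<open>u\<close>. Being an initial segment, it is comparable with every level set, and
  this makes it optimal for all of them at once.
\<close>
lemma greedy_set:
  fixes c :: "nat \<Rightarrow> real"
  assumes fin: "finite G" and l: "l \<le> card G" "l \<le> u"
  shows "\<exists>U\<subseteq>G. l \<le> card U \<and> card U \<le> u
    \<and> (\<forall>t>0. card {j \<in> U. t \<le> c j} = min u (card {j \<in> G. t \<le> c j}))
    \<and> (\<forall>t<0. card {j \<in> U. c j \<le> t} = l - card {j \<in> G. t < c j})"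
proof -
  define r where "r = card {j \<in> G. 0 < c j}"
  define q where "q = max l (min u r)"
  define U where "U = top_set G c q"
  have r_le: "r \<le> card G" unfolding r_def using fin by (intro card_mono) auto
  have cardU: "card U = q" unfolding U_def card_top_set[OF fin] using l r_le by (auto simp: q_def)
  have UG: "U \<subseteq> G" unfolding U_def by (rule top_set_subset)
  have finU: "finite U" using UG fin by (rule finite_subset)
  have up: "c j \<le> c i" if "i \<in> U" "j \<in> G - U" for i j
    using top_set_ge[OF fin] that unfolding U_def by blast
  have split: "U \<subseteq> P \<and> q < card P \<or> P \<subseteq> U \<and> card P \<le> q"
    if P: "P \<subseteq> G" "\<And>i j. i \<in> P \<Longrightarrow> j \<in> G \<Longrightarrow> c i \<le> c j \<Longrightarrow> j \<in> P" for P
  proof (cases "P \<subseteq> U")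
    case True
    then show ?thesis using card_mono[OF finU True] cardU by simp
  next
    case False
    then obtain i where i: "i \<in> P" "i \<notin> U" by auto
    then have "U \<subseteq> P" using up[of _ i] P UG by blast
    then have "U \<subset> P" using i by blast
    then show ?thesis using cardU psubset_card_mono[of P U] finite_subset[OF P(1) fin] by auto
  qed
  have "card {j \<in> U. t \<le> c j} = min u (card {j \<in> G. t \<le> c j})" if t: "t > 0" for t
  proof -
    let ?P = "{j \<in> G. t \<le> c j}"
    have Pr: "card ?P \<le> r" unfolding r_def using t fin by (intro card_mono) auto
    from split[of ?P] consider "U \<subseteq> ?P" "q < card ?P" | "?P \<subseteq> U" "card ?P \<le> q" by force
    then show ?thesis
    proof cases
      case 1
      then have "{j \<in> U. t \<le> c j} = U" by auto
      then show ?thesis using 1 Pr cardU l by (auto simp: q_def)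
    next
      case 2
      then have "{j \<in> U. t \<le> c j} = ?P" using UG by auto
      then show ?thesis using 2 l by (auto simp: q_def)
    qed
  qed
  moreover have "card {j \<in> U. c j \<le> t} = l - card {j \<in> G. t < c j}" if t: "t < 0" for t
  proof -
    let ?P = "{j \<in> G. t < c j}"
    have Pr: "r \<le> card ?P" unfolding r_def using t fin by (intro card_mono) auto
    from split[of ?P] consider "U \<subseteq> ?P" "q < card ?P" | "?P \<subseteq> U" "card ?P \<le> q" by force
    then show ?thesis
    proof cases
      case 1
      then have "{j \<in> U. c j \<le> t} = {}" by force
      then have "card {j \<in> U. c j \<le> t} = 0" by (simp only: card.empty)
      then show ?thesis using 1 by (auto simp: q_def)
    next
      case 2
      have "{j \<in> U. c j \<le> t} = U - ?P" using UG by force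
      then have "card {j \<in> U. c j \<le> t} = q - card ?P"
        using 2 fin cardU by (simp add: card_Diff_subset)
      then show ?thesis using 2 Pr by (auto simp: q_def)
    qed
  qed
  ultimately show ?thesis using UG cardU l by (intro exI[of _ U]) (auto simp: q_def)
qed

section \<open>Levels of a nested family\<close>

locale nested_system =
  fixes n m l u :: nat and S :: "nat \<Rightarrow> nat set"
  assumes family: "nested_family n m l u S"
begin

abbreviation J :: "nat set" where "J \<equiv> {1..n}"

text \<open>
  The level of an element is the index of the first set containing it, and \<open>m + 1\<close> outside all sets;
  counting the sets that miss the element gives the same number and avoids a case distinction.
\<close>
definition lev :: "nat \<Rightarrow> nat" where
  "lev j = Suc (card {i \<in> {1..m}. j \<notin> S i})"

lemma m_pos: "1 \<le> m" and lu: "l < u" and u2: "2 \<le> u" and S0: "S 0 = {}"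
  and SmJ: "S m \<subset> J" and l_le: "l \<le> n - card (S m)" and cardS1: "2 \<le> card (S 1)"
  using family by (auto simp: nested_family_def)

lemma S_step: "1 \<le> i \<Longrightarrow> i < m \<Longrightarrow> S i \<subset> S (i + 1)"
  using family unfolding nested_family_def by blast

lemma S_mono: "i \<le> k \<Longrightarrow> k \<le> m \<Longrightarrow> S i \<subseteq> S k"
proof (induction k rule: dec_induct)
  case base
  then show ?case by simp
next
  case (step k)
  have "S k \<subseteq> S (Suc k)"
  proof (cases "k = 0")
    case True
    then show ?thesis by (simp add: S0)
  next
    case False
    then show ?thesis using S_step[of k] step.prems by auto
  qed
  then show ?case using step by auto
qed

lemma S_subset: "i \<le> m \<Longrightarrow> S i \<subseteq> J"
  using S_mono[of i m] SmJ by auto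

lemma finite_S: "i \<le> m \<Longrightarrow> finite (S i)"
  using S_subset finite_subset by blast

lemma lev_le_iff:
  assumes "i \<le> m"
  shows "lev j \<le> i \<longleftrightarrow> j \<in> S i"
proof
  assume j: "j \<in> S i"
  then have i: "i \<noteq> 0" using S0 by (cases "i = 0") auto
  have "{k \<in> {1..m}. j \<notin> S k} \<subseteq> {1..<i}"
  proof safe
    fix k assume "k \<in> {1..m}" "j \<notin> S k"
    then show "k \<in> {1..<i}" using j S_mono[of i k] by (cases "i \<le> k") auto
  qed
  then have "card {k \<in> {1..m}. j \<notin> S k} \<le> i - 1"
    by (metis card_atLeastLessThan card_mono finite_atLeastLessThan)
  then show "lev j \<le> i" using i by (simp add: lev_def)
next
  assume le: "lev j \<le> i"
  show "j \<in> S i"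
  proof (rule ccontr)
    assume j: "j \<notin> S i"
    have "{1..i} \<subseteq> {k \<in> {1..m}. j \<notin> S k}"
    proof
      fix k assume "k \<in> {1..i}"
      then show "k \<in> {k \<in> {1..m}. j \<notin> S k}" using j S_mono[of k i] assms by auto
    qed
    then have "card {1..i} \<le> card {k \<in> {1..m}. j \<notin> S k}"
      by (intro card_mono) auto
    then show False using le by (simp add: lev_def)
  qed
qed

lemma mem_S_iff: "i \<le> m \<Longrightarrow> j \<in> S i \<longleftrightarrow> lev j \<le> i"
  using lev_le_iff by blast

lemma lev_pos: "1 \<le> lev j"
  by (simp add: lev_def)

lemma lev_le: "lev j \<le> m + 1"
proof -
  have "card {i \<in> {1..m}. j \<notin> S i} \<le> card {1..m}" by (intro card_mono) auto
  then show ?thesis by (simp add: lev_def)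
qed

text \<open>
  The coefficients of \<open>\<delta>\<^sub>i\<close> in the lifted inequalities count elements of level \<open>i\<close>. Distributing
  them over these elements, each \<open>j\<close> contributes \<open>\<delta>\<close> at its own level. Elements outside all sets
  are harmless since \<open>\<delta>\<close> vanishes at \<open>m + 1\<close>.
\<close>
lemma level_sum:
  fixes d :: "nat \<Rightarrow> real"
  assumes "finite A" "d (m + 1) = 0" "p \<le> m"
  shows "(\<Sum>i\<in>{p + 1..m}. real (card {j \<in> A. lev j = i}) * d i) = (\<Sum>j\<in>{j \<in> A. p < lev j}. d (lev j))"
proof -
  have "(\<Sum>j\<in>{j \<in> A. p < lev j}. d (lev j))
      = (\<Sum>i\<in>{p + 1..m + 1}. \<Sum>j\<in>{j \<in> {j \<in> A. p < lev j}. lev j = i}. d (lev j))"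
    using assms(1) lev_le by (intro sum.group[symmetric]) auto
  also have "\<dots> = (\<Sum>i\<in>{p + 1..m + 1}. real (card {j \<in> A. lev j = i}) * d i)"
  proof (rule sum.cong[OF refl])
    fix i assume "i \<in> {p + 1..m + 1}"
    then have "{j \<in> {j \<in> A. p < lev j}. lev j = i} = {j \<in> A. lev j = i}" by auto
    then show "(\<Sum>j\<in>{j \<in> {j \<in> A. p < lev j}. lev j = i}. d (lev j)) = real (card {j \<in> A. lev j = i}) * d i"
      by simp
  qed
  also have "\<dots> = (\<Sum>i\<in>{p + 1..m}. real (card {j \<in> A. lev j = i}) * d i)"
    using assms by simp
  finally show ?thesis by simp
qed

lemma card_Diff_S:
  assumes "finite A" "i \<le> m"
  shows "card (A - S i) = card {j \<in> A. i < lev j}"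
  by (intro arg_cong[of _ _ card]) (auto simp: mem_S_iff[OF assms(2)])

lemma card_above_split:
  assumes "finite A" "1 \<le> i"
  shows "card {j \<in> A. i - 1 < lev j} = card {j \<in> A. lev j = i} + card {j \<in> A. i < lev j}"
proof -
  have "{j \<in> A. i - 1 < lev j} = {j \<in> A. lev j = i} \<union> {j \<in> A. i < lev j}" using assms(2) by auto
  then show ?thesis using assms(1) by (simp add: card_Un_disjoint disjoint_iff)
qed

text \<open>
  In this form the violation is visibly a constant plus a sum over elements. It serves both the
  description of the hull and the search for a most violated inequality.
\<close>
lemma violation_Upper_lift:
  fixes d :: "nat \<Rightarrow> real"
  assumes p: "p \<in> {1..m}" and A: "A \<subseteq> J" and d: "d (m + 1) = 0"
  shows "violation n m l u S (z, d) (Upper_lift p A)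
    = real u * (d p - 1) + (\<Sum>j\<in>A. z j) + (\<Sum>j\<in>{j \<in> A. p < lev j}. d (lev j) - d p)"
proof -
  have fin: "finite A" using A finite_subset by blast
  have "(\<Sum>i\<in>{p + 1..m}. (real (card (A - S (i - 1))) - real (card (A - S i))) * d i)
      = (\<Sum>i\<in>{p + 1..m}. real (card {j \<in> A. lev j = i}) * d i)"
  proof (rule sum.cong[OF refl])
    fix i assume i: "i \<in> {p + 1..m}"
    then have "i - 1 \<le> m" "i \<le> m" "1 \<le> i" by auto
    then have "card (A - S (i - 1)) = card {j \<in> A. lev j = i} + card (A - S i)"
      using i card_above_split[OF fin, of i] card_Diff_S[OF fin, of i] card_Diff_S[OF fin, of "i - 1"]
      by simp
    then show "(real (card (A - S (i - 1))) - real (card (A - S i))) * d i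
        = real (card {j \<in> A. lev j = i}) * d i" by simp
  qed
  then show ?thesis
    using level_sum[where A = A and d = d and p = p] fin d p card_Diff_S[OF fin, of p]
    by (simp add: sum_subtractf algebra_simps)
qed

lemma card_Un_S:
  assumes A: "A \<subseteq> J" and i: "i \<le> m"
  shows "card (A \<union> S i) + card {j \<in> J - A. i < lev j} = n"
proof -
  have "(A \<union> S i) \<union> {j \<in> J - A. i < lev j} = J" "(A \<union> S i) \<inter> {j \<in> J - A. i < lev j} = {}"
    using A S_subset[OF i] by (auto simp: mem_S_iff[OF i])
  moreover have "finite (A \<union> S i)" "finite {j \<in> J - A. i < lev j}"
    using A finite_S[OF i] finite_subset by auto
  ultimately have "card J = card (A \<union> S i) + card {j \<in> J - A. i < lev j}"
    by (metis card_Un_disjoint)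
  then show ?thesis by simp
qed

lemma violation_Lower_lift:
  fixes d :: "nat \<Rightarrow> real"
  assumes p: "p \<in> {1..m}" and A: "A \<subseteq> J" and d: "d (m + 1) = 0"
  shows "violation n m l u S (z, d) (Lower_lift p A)
    = real l * d p + (\<Sum>j\<in>{j \<in> J - A. p < lev j}. d (lev j) - d p) - (\<Sum>j\<in>A. z j)"
proof -
  have fin: "finite (J - A)" by simp
  have c: "real (card (A \<union> S i)) = real n - real (card {j \<in> J - A. i < lev j})" if "i \<le> m" for i
    using card_Un_S[OF A that] by linarith
  have "(\<Sum>i\<in>{p + 1..m}. (real (card (A \<union> S i)) - real (card (A \<union> S (i - 1)))) * d i)
      = (\<Sum>i\<in>{p + 1..m}. real (card {j \<in> J - A. lev j = i}) * d i)"
  proof (rule sum.cong[OF refl])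
    fix i assume i: "i \<in> {p + 1..m}"
    then have "i - 1 \<le> m" "i \<le> m" "1 \<le> i" by auto
    then show "(real (card (A \<union> S i)) - real (card (A \<union> S (i - 1)))) * d i
        = real (card {j \<in> J - A. lev j = i}) * d i"
      by (simp only: c card_above_split[OF fin]) simp
  qed
  then show ?thesis
    using level_sum[where A = "J - A" and d = d and p = p] d p by (simp add: c sum_subtractf algebra_simps)
qed

text \<open>
  With \<open>\<delta>\<^sub>0 = 1\<close>, the difference \<open>wt d k\<close> is the weight that every representation of \<open>(z, d)\<close> as a
  convex combination of points of \<open>X\<close> gives to the points whose first hit set is the \<open>k\<close>-th.
\<close>
definition ext :: "(nat \<Rightarrow> real) \<Rightarrow> nat \<Rightarrow> real" where
  "ext d i = (if i = 0 then 1 else d i)"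

definition wt :: "(nat \<Rightarrow> real) \<Rightarrow> nat \<Rightarrow> real" where
  "wt d k = ext d (k - 1) - ext d k"

lemma sum_wt: "p \<le> q \<Longrightarrow> (\<Sum>k\<in>{p + 1..q}. wt d k) = ext d p - ext d q"
  by (induction q rule: dec_induct) (auto simp: wt_def)

text \<open>
  Abel summation: an element of level \<open>i\<close> is counted for the indices \<open>k \<le> i\<close>, whose weights telescope.
\<close>
lemma sum_wt_card:
  assumes "finite A" "p \<le> m + 1"
  shows "(\<Sum>k\<in>{p + 1..m + 1}. wt d k * real (card {j \<in> A. k \<le> lev j}))
    = (\<Sum>j\<in>{j \<in> A. p < lev j}. ext d p - ext d (lev j))"
proof -
  have "(\<Sum>k\<in>{p + 1..m + 1}. wt d k * real (card {j \<in> A. k \<le> lev j}))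
      = (\<Sum>k\<in>{p + 1..m + 1}. \<Sum>j\<in>A. if k \<le> lev j then wt d k else 0)"
    using assms(1) by (intro sum.cong refl) (simp flip: sum.inter_filter)
  also have "\<dots> = (\<Sum>j\<in>A. \<Sum>k\<in>{p + 1..m + 1}. if k \<le> lev j then wt d k else 0)"
    by (rule sum.swap)
  also have "\<dots> = (\<Sum>j\<in>A. if p < lev j then ext d p - ext d (lev j) else 0)"
  proof (rule sum.cong[OF refl])
    fix j
    have "(\<Sum>k\<in>{p + 1..m + 1}. if k \<le> lev j then wt d k else 0)
        = (\<Sum>k\<in>{k \<in> {p + 1..m + 1}. k \<le> lev j}. wt d k)"
      by (rule sum.inter_filter[symmetric]) simp
    also have "{k \<in> {p + 1..m + 1}. k \<le> lev j} = {p + 1..lev j}" using lev_le[of j] by auto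
    finally show "(\<Sum>k\<in>{p + 1..m + 1}. if k \<le> lev j then wt d k else 0)
        = (if p < lev j then ext d p - ext d (lev j) else 0)"
      using sum_wt[of p "lev j"] by simp
  qed
  also have "\<dots> = (\<Sum>j\<in>{j \<in> A. p < lev j}. ext d p - ext d (lev j))"
    by (rule sum.inter_filter[symmetric]) (rule assms)
  finally show ?thesis .
qed

section \<open>Extreme values on the points of a given first hit\<close>

text \<open>
  The maximum and minimum of \<open>z(A)\<close> over the points of \<open>X\<close> that vanish below level \<open>k\<close> and, if
  \<open>k \<le> m\<close>, are nonzero somewhere on level \<open>k\<close>. If \<open>A\<close> misses that level, then one of the \<open>u\<close> units is
  spent outside \<open>A\<close>; if \<open>A\<close> contains it, then \<open>A\<close> receives at least one unit.
\<close>
definition upper_rank :: "nat set \<Rightarrow> nat \<Rightarrow> nat" where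
  "upper_rank A k = min (if k \<le> m \<and> {j \<in> A. lev j = k} = {} then u - 1 else u) (card {j \<in> A. k \<le> lev j})"

definition lower_rank :: "nat set \<Rightarrow> nat \<Rightarrow> nat" where
  "lower_rank A k = max (l - card {j \<in> J - A. k \<le> lev j})
     (if k \<le> m \<and> {j \<in> J. lev j = k} \<subseteq> A then 1 else 0)"

lemma finite_J_level: "finite {j \<in> J. P j}"
  by simp

lemma card_J_above: assumes "k \<le> m + 1" shows "l \<le> card {j \<in> J. k \<le> lev j}"
proof -
  have "card (J - S m) = n - card (S m)"
    using SmJ finite_S[of m] by (simp add: card_Diff_subset)
  moreover have "J - S m \<subseteq> {j \<in> J. k \<le> lev j}" using assms by (auto simp: mem_S_iff)
  ultimately show ?thesis using l_le card_mono[of "{j \<in> J. k \<le> lev j}" "J - S m"] by auto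
qed

lemma level_nonempty:
  assumes "1 \<le> k" "k \<le> m"
  shows "{j \<in> J. lev j = k} \<noteq> {}"
proof -
  have "S (k - 1) \<subset> S k"
  proof (cases "k = 1")
    case True
    then show ?thesis using cardS1 S0 by auto
  next
    case False
    then have "1 \<le> k - 1" "k - 1 < m" "k - 1 + 1 = k" using assms by auto
    then show ?thesis using S_step[of "k - 1"] by metis
  qed
  then obtain j where "j \<in> S k" "j \<notin> S (k - 1)" by auto
  then have "lev j \<le> k" "\<not> lev j \<le> k - 1" "j \<in> J"
    using mem_S_iff[of k j] mem_S_iff[of "k - 1" j] assms S_subset[of k] by auto
  then have "lev j = k" "j \<in> J" by auto
  then show ?thesis by auto
qed

text \<open>
  The compulsory element on level \<open>k\<close> may be taken to be one of largest value on that level, by an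
  exchange argument. Forcing it leaves a problem with plain cardinality bounds \<open>l - 1\<close> and \<open>u - 1\<close>.
\<close>
lemma greedy_level:
  fixes c :: "nat \<Rightarrow> real"
  assumes k: "k \<in> {1..m + 1}"
  shows "\<exists>U\<subseteq>{j \<in> J. k \<le> lev j}. (k \<le> m \<longrightarrow> (\<exists>j\<in>U. lev j = k)) \<and> l \<le> card U \<and> card U \<le> u
    \<and> (\<forall>t>0. card {j \<in> U. t \<le> c j} = upper_rank {j \<in> J. t \<le> c j} k)
    \<and> (\<forall>t<0. card {j \<in> U. c j \<le> t} = lower_rank {j \<in> J. c j \<le> t} k)"
proof (cases "k \<le> m")
  case False
  then have nk: "\<not> k \<le> m" .
  let ?G = "{j \<in> J. k \<le> lev j}"
  have "l \<le> card ?G" using k by (intro card_J_above) auto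
  from greedy_set[OF finite_J_level this less_imp_le[OF lu], of c]
  obtain U where U: "U \<subseteq> ?G" "l \<le> card U" "card U \<le> u"
      "\<And>t. t > 0 \<Longrightarrow> card {j \<in> U. t \<le> c j} = min u (card {j \<in> ?G. t \<le> c j})"
      "\<And>t. t < 0 \<Longrightarrow> card {j \<in> U. c j \<le> t} = l - card {j \<in> ?G. t < c j}"
    by blast
  have "upper_rank {j \<in> J. t \<le> c j} k = min u (card {j \<in> ?G. t \<le> c j})" for t
  proof -
    have "{j \<in> {j \<in> J. t \<le> c j}. k \<le> lev j} = {j \<in> ?G. t \<le> c j}" by blast
    then show ?thesis by (simp add: upper_rank_def nk)
  qed
  moreover have "lower_rank {j \<in> J. c j \<le> t} k = l - card {j \<in> ?G. t < c j}" for t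
  proof -
    have "{j \<in> J - {j \<in> J. c j \<le> t}. k \<le> lev j} = {j \<in> ?G. t < c j}" by auto
    then show ?thesis by (simp add: lower_rank_def nk)
  qed
  ultimately show ?thesis using U nk by (intro exI[of _ U]) auto
next
  case True
  let ?D = "{j \<in> J. lev j = k}"
  have D: "?D \<noteq> {}" "finite ?D" using level_nonempty[of k] k True by auto
  define a where "a = arg_max_on c ?D"
  have aD: "a \<in> ?D" and amax: "\<And>j. j \<in> ?D \<Longrightarrow> c j \<le> c a"
  proof -
    have "Max (c ` ?D) \<in> c ` ?D" using D by (intro Max_in finite_imageI) auto
    then obtain b where "b \<in> ?D" "c b = Max (c ` ?D)" by auto
    then have "is_arg_max c (\<lambda>j. j \<in> ?D) b"
      using D by (auto simp: is_arg_max_linorder)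
    then have "is_arg_max c (\<lambda>j. j \<in> ?D) a"
      unfolding a_def arg_max_on_def arg_max_def by (rule someI)
    then show "a \<in> ?D" "\<And>j. j \<in> ?D \<Longrightarrow> c j \<le> c a" by (auto simp: is_arg_max_linorder)
  qed
  let ?G = "{j \<in> J. k \<le> lev j} - {a}"
  have cG: "card {j \<in> J. k \<le> lev j} = Suc (card ?G)"
    using aD by (intro card.remove) auto
  then have lG: "l - 1 \<le> card ?G" using card_J_above[of k] True by simp
  from greedy_set[of ?G, OF _ lG, of "u - 1" c] lu
  obtain U where U: "U \<subseteq> ?G" "l - 1 \<le> card U" "card U \<le> u - 1"
      "\<And>t. t > 0 \<Longrightarrow> card {j \<in> U. t \<le> c j} = min (u - 1) (card {j \<in> ?G. t \<le> c j})"
      "\<And>t. t < 0 \<Longrightarrow> card {j \<in> U. c j \<le> t} = (l - 1) - card {j \<in> ?G. t < c j}"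
    by (auto simp: less_imp_le diff_le_mono)
  have finU: "finite U" and aU: "a \<notin> U" using U(1) finite_subset[OF U(1)] by auto
  have "card {j \<in> insert a U. t \<le> c j} = upper_rank {j \<in> J. t \<le> c j} k" if t: "t > 0" for t
  proof (cases "t \<le> c a")
    case ta: True
    have "{j \<in> insert a U. t \<le> c j} = insert a {j \<in> U. t \<le> c j}" using ta by auto
    then have 1: "card {j \<in> insert a U. t \<le> c j} = Suc (min (u - 1) (card {j \<in> ?G. t \<le> c j}))"
      using finU aU U(4)[OF t] by simp
    have "{j \<in> {j \<in> J. t \<le> c j}. k \<le> lev j} = insert a {j \<in> ?G. t \<le> c j}" using ta aD by auto
    then have "card {j \<in> {j \<in> J. t \<le> c j}. k \<le> lev j} = Suc (card {j \<in> ?G. t \<le> c j})" by simp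
    moreover have "{j \<in> {j \<in> J. t \<le> c j}. lev j = k} \<noteq> {}" using ta aD by auto
    ultimately have "upper_rank {j \<in> J. t \<le> c j} k = min u (Suc (card {j \<in> ?G. t \<le> c j}))"
      unfolding upper_rank_def by (simp only: simp_thms if_False)
    then show ?thesis using 1 u2 by (auto simp: min_def)
  next
    case ta: False
    have "{j \<in> insert a U. t \<le> c j} = {j \<in> U. t \<le> c j}" using ta by auto
    moreover have "{j \<in> {j \<in> J. t \<le> c j}. k \<le> lev j} = {j \<in> ?G. t \<le> c j}" using ta by auto
    moreover have "{j \<in> {j \<in> J. t \<le> c j}. lev j = k} = {}" using ta amax by force
    ultimately show ?thesis using U(4)[OF t] True unfolding upper_rank_def by simp
  qed
  moreover have "card {j \<in> insert a U. c j \<le> t} = lower_rank {j \<in> J. c j \<le> t} k" if t: "t < 0" for t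
  proof (cases "c a \<le> t")
    case ta: True
    have "{j \<in> insert a U. c j \<le> t} = insert a {j \<in> U. c j \<le> t}" using ta by auto
    then have 1: "card {j \<in> insert a U. c j \<le> t} = Suc ((l - 1) - card {j \<in> ?G. t < c j})"
      using finU aU U(5)[OF t] by simp
    have "{j \<in> J - {j \<in> J. c j \<le> t}. k \<le> lev j} = {j \<in> ?G. t < c j}" using ta aD by auto
    moreover have "?D \<subseteq> {j \<in> J. c j \<le> t}" using ta amax by force
    ultimately have "lower_rank {j \<in> J. c j \<le> t} k = max (l - card {j \<in> ?G. t < c j}) 1"
      unfolding lower_rank_def using True by simp
    then show ?thesis using 1 by linarith
  next
    case ta: False
    have e: "{j \<in> insert a U. c j \<le> t} = {j \<in> U. c j \<le> t}" using ta by auto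
    have "{j \<in> J - {j \<in> J. c j \<le> t}. k \<le> lev j} = insert a {j \<in> ?G. t < c j}" using ta aD by auto
    then have "card {j \<in> J - {j \<in> J. c j \<le> t}. k \<le> lev j} = Suc (card {j \<in> ?G. t < c j})" by simp
    moreover have "\<not> ?D \<subseteq> {j \<in> J. c j \<le> t}" using ta aD by auto
    ultimately have "lower_rank {j \<in> J. c j \<le> t} k = l - Suc (card {j \<in> ?G. t < c j})"
      unfolding lower_rank_def by (simp only: if_False simp_thms max_0R)
    then show ?thesis using U(5)[OF t] unfolding e by simp
  qed
  moreover have "insert a U \<subseteq> {j \<in> J. k \<le> lev j}" using U(1) aD by auto
  moreover have "card (insert a U) = Suc (card U)" using finU aU by simp
  ultimately show ?thesis using U(2,3) aD u2 lu
    by (intro exI[of _ "insert a U"]) auto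
qed


section \<open>The rank inequalities follow from the system\<close>

definition satisfies :: "(nat \<Rightarrow> real) \<Rightarrow> (nat \<Rightarrow> real) \<Rightarrow> bool" where
  "satisfies z d \<longleftrightarrow> z \<in> vecs n \<and> d \<in> vecs m \<and>
     (\<forall>c\<in>ineqs n m l u S. violation n m l u S (z, d) c \<le> 0)"

lemma S_Diff_level:
  assumes "1 \<le> i" "i \<le> m"
  shows "S i - S (i - 1) = {j \<in> J. lev j = i}"
  using assms S_subset[of i] mem_S_iff[of i] mem_S_iff[of "i - 1"] by (auto 4 4)

lemma satisfies_basic:
  assumes "satisfies z d"
  shows "real l \<le> (\<Sum>j\<in>J. z j)" "(\<Sum>j\<in>J. z j) \<le> real u"
    and "\<And>j. j \<in> J \<Longrightarrow> 0 \<le> z j"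
    and "\<And>j. j \<in> J \<Longrightarrow> z j \<le> 1 - ext d (lev j)"
    and "\<And>k. k \<in> {1..m + 1} \<Longrightarrow> 0 \<le> wt d k"
    and "\<And>k. k \<in> {1..m} \<Longrightarrow> wt d k \<le> (\<Sum>j\<in>{j \<in> J. lev j = k}. z j)"
    and "d (m + 1) = 0"
proof -
  have viol: "violation n m l u S (z, d) c \<le> 0" if "c \<in> ineqs n m l u S" for c
    using assms that by (auto simp: satisfies_def)
  show d0: "d (m + 1) = 0" using assms by (auto simp: satisfies_def vecs_def)
  show "real l \<le> (\<Sum>j\<in>J. z j)" using viol[of Card_ge] by (simp add: ineqs_def)
  show "(\<Sum>j\<in>J. z j) \<le> real u" using viol[of Card_le] by (simp add: ineqs_def)
  show z0: "0 \<le> z j" if "j \<in> J" for j using viol[of "Nonneg j"] that by (simp add: ineqs_def)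
  have pair: "z j + d i \<le> 1" if "i \<in> {1..m}" "j \<in> S i" for i j
    using viol[of "Pair_le i j"] that by (simp add: ineqs_def)
  show "z j \<le> 1 - ext d (lev j)" if j: "j \<in> J" for j
  proof (cases "lev j \<le> m")
    case True
    then show ?thesis
      using pair[of "lev j" j] lev_pos[of j] mem_S_iff[of "lev j" j] by (auto simp: ext_def)
  next
    case False
    then have lv: "lev j = m + 1" using lev_le[of j] by simp
    then have "j \<in> J - S m" using j mem_S_iff[of m j] by auto
    then have "z j \<le> 1" using viol[of "Le_one j"] by (auto simp: ineqs_def)
    then show ?thesis using lv d0 by (simp add: ext_def)
  qed
  have step: "wt d k \<le> (\<Sum>j\<in>S k - S (k - 1). z j)" if k: "k \<in> {1..m}" for k
  proof (cases "k = 1")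
    case True
    then show ?thesis using viol[of Cover_first] by (simp add: ineqs_def wt_def ext_def S0)
  next
    case False
    with k have "Cover_step (k - 1) \<in> ineqs n m l u S" by (auto simp: ineqs_def)
    then show ?thesis using viol[of "Cover_step (k - 1)"] k False by (simp add: wt_def ext_def)
  qed
  show "wt d k \<le> (\<Sum>j\<in>{j \<in> J. lev j = k}. z j)" if k: "k \<in> {1..m}" for k
    using step[OF k] S_Diff_level[of k] k by simp
  show "0 \<le> wt d k" if k: "k \<in> {1..m + 1}" for k
  proof -
    consider "k = 1" | "k = m + 1" | "2 \<le> k" "k \<le> m" using k by force
    then show ?thesis
    proof cases
      case 1
      obtain j where j: "j \<in> S 1" using cardS1 by fastforce
      then have "j \<in> J" using S_subset[of 1] m_pos by auto
      then show ?thesis using pair[of 1 j] j z0[of j] m_pos 1 by (simp add: wt_def ext_def)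
    next
      case 2
      then show ?thesis using viol[of Last_nonneg] d0 m_pos by (simp add: ineqs_def wt_def ext_def)
    next
      case 3
      then have "Mono (k - 1) \<in> ineqs n m l u S" by (auto simp: ineqs_def)
      then show ?thesis using viol[of "Mono (k - 1)"] 3 by (simp add: wt_def ext_def)
    qed
  qed
qed

lemma sum_levels:
  assumes "finite K"
  shows "(\<Sum>j\<in>{j \<in> J. lev j \<in> K}. z j) = (\<Sum>k\<in>K. \<Sum>j\<in>{j \<in> J. lev j = k}. z j)"
proof -
  have "(\<Sum>k\<in>K. \<Sum>j\<in>{j \<in> {j \<in> J. lev j \<in> K}. lev j = k}. z j) = (\<Sum>j\<in>{j \<in> J. lev j \<in> K}. z j)"
    using assms by (intro sum.group) auto
  moreover have "{j \<in> {j \<in> J. lev j \<in> K}. lev j = k} = {j \<in> J. lev j = k}" if "k \<in> K" for k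
    using that by auto
  ultimately show ?thesis by simp
qed

text \<open>
  The index at which a nonincreasing sequence drops below a threshold; the value \<open>m + 1\<close> stands for
  a sequence that stays above it on \<open>{0..m}\<close>.
\<close>
lemma crossing_index:
  fixes F :: "nat \<Rightarrow> nat"
  assumes "\<And>i k. i \<le> k \<Longrightarrow> F k \<le> F i" "b \<le> F 0"
  obtains p where "1 \<le> p" "p \<le> m + 1" "\<And>k. k < p \<Longrightarrow> b \<le> F k" "\<And>k. p \<le> k \<Longrightarrow> k \<le> m \<Longrightarrow> F k < b"
proof -
  define p where "p = (LEAST i. i = m + 1 \<or> F i < b)"
  have p: "p = m + 1 \<or> F p < b" unfolding p_def by (rule LeastI[of _ "m + 1"]) simp
  have least: "k \<noteq> m + 1 \<and> b \<le> F k" if "k < p" for k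
    using not_less_Least[of k "\<lambda>i. i = m + 1 \<or> F i < b"] that unfolding p_def by auto
  have "p \<noteq> 0" using p assms(2) by (cases "p = 0") auto
  moreover have "p \<le> m + 1" unfolding p_def by (rule Least_le) simp
  moreover have "F k < b" if "p \<le> k" "k \<le> m" for k
    using p that assms(1)[of p k] by auto
  ultimately show ?thesis using least by (intro that) auto
qed

lemma card_above_antimono:
  assumes "finite A" "i \<le> k"
  shows "card {j \<in> A. k < lev j} \<le> card {j \<in> A. i < lev j}"
  using assms by (intro card_mono) auto

lemma split_range:
  fixes f :: "nat \<Rightarrow> real"
  assumes "1 \<le> p" "p \<le> m + 1"
  shows "(\<Sum>k\<in>{1..m + 1}. f k) = (\<Sum>k\<in>{1..p}. f k) + (\<Sum>k\<in>{p + 1..m + 1}. f k)"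
proof -
  have "{1..m + 1} = {1..p} \<union> {p + 1..m + 1}" using assms by auto
  then show ?thesis by (simp add: sum.union_disjoint del: atLeastAtMost_iff)
qed

text \<open>
  If \<open>A\<close> has fewer than \<open>u\<close> elements, then no truncation takes place and the bounds
  \<open>z\<^sub>j \<le> 1 - \<delta>\<close> at the level of \<open>j\<close> add up to the claim. Otherwise let \<open>p\<close> be the index from which on
  fewer than \<open>u\<close> elements of \<open>A\<close> lie above. The lifted inequality is applied not to \<open>A\<close> but
  to \<open>A'\<close>, which contains in addition the levels up to \<open>p\<close> missed by \<open>A\<close>: the added elements lie
  below \<open>p\<close> and leave the right-hand side unchanged, while the cover inequalities bound \<open>z\<close> on each
  added level from below by its weight. For \<open>p = m + 1\<close> the cardinality bound takes the role of the
  lifted inequality.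
\<close>
lemma upper_rank_inequality:
  assumes sat: "satisfies z d" and A: "A \<subseteq> J"
  shows "(\<Sum>j\<in>A. z j) \<le> (\<Sum>k\<in>{1..m + 1}. wt d k * real (upper_rank A k))"
proof -
  note basic = satisfies_basic[OF sat]
  have fin: "finite A" using A finite_subset by blast
  define F where "F i = card {j \<in> A. i < lev j}" for i
  have F0: "F 0 = card A" by (auto simp: F_def lev_def intro!: arg_cong[of _ _ card])
  have Fk: "card {j \<in> A. k \<le> lev j} = F (k - 1)" if "1 \<le> k" for k
    using that by (auto simp: F_def intro!: arg_cong[of _ _ card])
  have Fmono: "F k \<le> F i" if "i \<le> k" for i k
    unfolding F_def by (rule card_above_antimono[OF fin that])
  have tail: "(\<Sum>k\<in>{p + 1..m + 1}. wt d k * real (F (k - 1)))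
      = (\<Sum>j\<in>{j \<in> A. p < lev j}. ext d p - ext d (lev j))" if "p \<le> m + 1" for p
    unfolding sum_wt_card[OF fin that, symmetric]
  proof (rule sum.cong[OF refl])
    fix k assume "k \<in> {p + 1..m + 1}"
    then have "1 \<le> k" by simp
    then show "wt d k * real (F (k - 1)) = wt d k * real (card {j \<in> A. k \<le> lev j})"
      by (simp only: Fk)
  qed
  show ?thesis
  proof (cases "u \<le> F 0")
    case False
    have "upper_rank A k = F (k - 1)" if "k \<in> {1..m + 1}" for k
      using that Fk[of k] Fmono[of 0 "k - 1"] False by (simp add: upper_rank_def)
    then have "(\<Sum>k\<in>{1..m + 1}. wt d k * real (upper_rank A k)) = (\<Sum>k\<in>{0 + 1..m + 1}. wt d k * real (F (k - 1)))"
      by simp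
    also have "\<dots> = (\<Sum>j\<in>{j \<in> A. 0 < lev j}. ext d 0 - ext d (lev j))" by (rule tail) simp
    also have "{j \<in> A. 0 < lev j} = A" by (auto simp: lev_def)
    finally show ?thesis
      using A basic(4) by (auto simp: ext_def intro!: sum_mono)
  next
    case True
    obtain p where p: "1 \<le> p" "p \<le> m + 1" "\<And>k. k < p \<Longrightarrow> u \<le> F k"
        "\<And>k. p \<le> k \<Longrightarrow> k \<le> m \<Longrightarrow> F k < u"
      using crossing_index[of F u] Fmono True by metis
    define K where "K = {k \<in> {1..p}. k \<le> m \<and> {j \<in> A. lev j = k} = {}}"
    have K: "finite K" "K \<subseteq> {1..m}" by (auto simp: K_def)
    define A' where "A' = A \<union> {j \<in> J. lev j \<in> K}"
    have A'J: "A' \<subseteq> J" using A by (auto simp: A'_def)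
    have zA': "(\<Sum>j\<in>A'. z j) = (\<Sum>j\<in>A. z j) + (\<Sum>k\<in>K. \<Sum>j\<in>{j \<in> J. lev j = k}. z j)"
      unfolding A'_def sum_levels[OF K(1), symmetric]
      by (rule sum.union_disjoint) (use fin in \<open>auto simp: K_def\<close>)
    have above: "{j \<in> A'. p < lev j} = {j \<in> A. p < lev j}" by (auto simp: A'_def K_def)
    have head: "(\<Sum>k\<in>{1..p}. wt d k * real (upper_rank A k))
        = (\<Sum>k\<in>{1..p}. wt d k) * real u - (\<Sum>k\<in>K. wt d k)"
    proof -
      have "(\<Sum>k\<in>{1..p}. wt d k * real (upper_rank A k))
          = (\<Sum>k\<in>{1..p}. wt d k * real u - (if k \<le> m \<and> {j \<in> A. lev j = k} = {} then wt d k else 0))"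
      proof (rule sum.cong[OF refl])
        fix k assume k: "k \<in> {1..p}"
        then have "u \<le> F (k - 1)" by (intro p(3)) auto
        then have "upper_rank A k = (if k \<le> m \<and> {j \<in> A. lev j = k} = {} then u - 1 else u)"
          using Fk[of k] k by (simp add: upper_rank_def)
        then show "wt d k * real (upper_rank A k)
            = wt d k * real u - (if k \<le> m \<and> {j \<in> A. lev j = k} = {} then wt d k else 0)"
          using u2 by (auto simp: of_nat_diff algebra_simps)
      qed
      also have "\<dots> = (\<Sum>k\<in>{1..p}. wt d k) * real u - (\<Sum>k\<in>K. wt d k)"
        unfolding K_def by (simp only: sum_subtractf sum_distrib_right sum.inter_filter[OF finite_atLeastAtMost])
      finally show ?thesis .
    qed
    have "(\<Sum>k\<in>{p + 1..m + 1}. wt d k * real (upper_rank A k)) = (\<Sum>k\<in>{p + 1..m + 1}. wt d k * real (F (k - 1)))"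
    proof (rule sum.cong[OF refl])
      fix k assume k: "k \<in> {p + 1..m + 1}"
      then have "F (k - 1) < u" by (intro p(4)) auto
      then show "wt d k * real (upper_rank A k) = wt d k * real (F (k - 1))"
        using Fk[of k] k by (auto simp: upper_rank_def)
    qed
    with tail[OF p(2)] have tail': "(\<Sum>k\<in>{p + 1..m + 1}. wt d k * real (upper_rank A k))
        = (\<Sum>j\<in>{j \<in> A. p < lev j}. ext d p - ext d (lev j))" by simp
    have main: "(\<Sum>j\<in>A'. z j) \<le> (1 - ext d p) * real u + (\<Sum>j\<in>{j \<in> A. p < lev j}. ext d p - ext d (lev j))"
    proof (cases "p = m + 1")
      case True
      have "{j \<in> A. p < lev j} = {}" using lev_le True by (auto simp: not_less)
      moreover have "(\<Sum>j\<in>A'. z j) \<le> (\<Sum>j\<in>J. z j)"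
        using A'J basic(3) by (intro sum_mono2) auto
      moreover have "(\<Sum>j\<in>{j \<in> A. p < lev j}. ext d p - ext d (lev j)) = 0"
        by (simp only: \<open>{j \<in> A. p < lev j} = {}\<close> sum.empty)
      ultimately show ?thesis using basic(2,7) True by (simp add: ext_def)
    next
      case False
      then have pm: "p \<in> {1..m}" using p by auto
      have "card (A' - S p) = F p"
        using card_Diff_S[of A' p] above A'J finite_subset[OF A'J] pm by (simp add: F_def)
      then have "Upper_lift p A' \<in> ineqs n m l u S"
        using p(4)[of p] pm A'J by (auto simp: ineqs_def)
      then have "violation n m l u S (z, d) (Upper_lift p A') \<le> 0"
        using sat by (auto simp: satisfies_def)
      then have "real u * (d p - 1) + (\<Sum>j\<in>A'. z j) + (\<Sum>j\<in>{j \<in> A. p < lev j}. d (lev j) - d p) \<le> 0"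
        unfolding violation_Upper_lift[where d = d, OF pm A'J basic(7)] above .
      moreover have "(\<Sum>j\<in>{j \<in> A. p < lev j}. ext d p - ext d (lev j)) = - (\<Sum>j\<in>{j \<in> A. p < lev j}. d (lev j) - d p)"
        using pm by (simp add: ext_def sum_negf[symmetric])
      ultimately show ?thesis using pm by (simp add: ext_def algebra_simps)
    qed
    have "(\<Sum>k\<in>K. wt d k) \<le> (\<Sum>k\<in>K. \<Sum>j\<in>{j \<in> J. lev j = k}. z j)"
      using K by (intro sum_mono basic(6)) auto
    moreover have "(\<Sum>k\<in>{1..p}. wt d k) = 1 - ext d p"
      using sum_wt[of 0 p d] by (simp add: ext_def)
    with head have "(\<Sum>k\<in>{1..p}. wt d k * real (upper_rank A k)) = (1 - ext d p) * real u - (\<Sum>k\<in>K. wt d k)"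
      by simp
    ultimately show ?thesis
      unfolding split_range[OF p(1,2)] using main zA' tail' by linarith
  qed
qed

text \<open>
  The mirror image: the levels up to \<open>p\<close> that are contained in \<open>A\<close> are removed and paid for by the
  cover inequalities, and the lifted inequality is applied to the remaining set \<open>A'\<close>. If the lower
  bound \<open>l\<close> is already active at level \<open>0\<close>, the claim follows by complementation from \<open>l \<le> z(J)\<close>.
\<close>
lemma lower_rank_inequality:
  assumes sat: "satisfies z d" and A: "A \<subseteq> J"
  shows "(\<Sum>k\<in>{1..m + 1}. wt d k * real (lower_rank A k)) \<le> (\<Sum>j\<in>A. z j)"
proof -
  note basic = satisfies_basic[OF sat]
  have fin: "finite (J - A)" "finite A" using A finite_subset by auto
  define F where "F i = card {j \<in> J - A. i < lev j}" for i
  have F0: "F 0 = card (J - A)" by (auto simp: F_def lev_def intro!: arg_cong[of _ _ card])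
  have Fk: "card {j \<in> J - A. k \<le> lev j} = F (k - 1)" if "1 \<le> k" for k
    using that by (auto simp: F_def intro!: arg_cong[of _ _ card])
  have Fmono: "F k \<le> F i" if "i \<le> k" for i k
    unfolding F_def by (rule card_above_antimono[OF fin(1) that])
  have tail: "(\<Sum>k\<in>{p + 1..m + 1}. wt d k * real (F (k - 1)))
      = (\<Sum>j\<in>{j \<in> J - A. p < lev j}. ext d p - ext d (lev j))" if "p \<le> m + 1" for p
    unfolding sum_wt_card[OF fin(1) that, symmetric]
  proof (rule sum.cong[OF refl])
    fix k assume "k \<in> {p + 1..m + 1}"
    then have "1 \<le> k" by simp
    then show "wt d k * real (F (k - 1)) = wt d k * real (card {j \<in> J - A. k \<le> lev j})"
      by (simp only: Fk)
  qed
  have low: "real (lower_rank A k) = real l - real (F (k - 1))" if "1 \<le> k" "F (k - 1) < l" for k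
    using that Fk[of k] by (auto simp: lower_rank_def of_nat_diff)
  have sumz: "(\<Sum>j\<in>J. z j) = (\<Sum>j\<in>A. z j) + (\<Sum>j\<in>J - A. z j)"
    using A by (metis add.commute finite_atLeastAtMost sum.subset_diff)
  show ?thesis
  proof (cases "l \<le> F 0")
    case False
    have le0: "0 \<le> m + 1" by simp
    have "F (k - 1) < l" for k
      using Fmono[of 0 "k - 1"] False by simp
    then have "(\<Sum>k\<in>{1..m + 1}. wt d k * real (lower_rank A k))
        = (\<Sum>k\<in>{0 + 1..m + 1}. wt d k * real l - wt d k * real (F (k - 1)))"
      using low by (intro sum.cong) (auto simp: right_diff_distrib)
    also have "\<dots> = (\<Sum>k\<in>{0 + 1..m + 1}. wt d k) * real l - (\<Sum>j\<in>{j \<in> J - A. 0 < lev j}. ext d 0 - ext d (lev j))"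
      unfolding sum_subtractf sum_distrib_right tail[OF le0] ..
    also have "{j \<in> J - A. 0 < lev j} = J - A" by (auto simp: lev_def)
    also have "(\<Sum>k\<in>{0 + 1..m + 1}. wt d k) = 1"
      using sum_wt[of 0 "m + 1" d] basic(7) by (simp add: ext_def)
    finally have "(\<Sum>k\<in>{1..m + 1}. wt d k * real (lower_rank A k))
        = real l - (\<Sum>j\<in>J - A. ext d 0 - ext d (lev j))" by simp
    moreover have "(\<Sum>j\<in>J - A. z j) \<le> (\<Sum>j\<in>J - A. ext d 0 - ext d (lev j))"
      using basic(4) by (intro sum_mono) (auto simp: ext_def)
    ultimately show ?thesis using basic(1) sumz by linarith
  next
    case True
    obtain p where p: "1 \<le> p" "p \<le> m + 1" "\<And>k. k < p \<Longrightarrow> l \<le> F k"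
        "\<And>k. p \<le> k \<Longrightarrow> k \<le> m \<Longrightarrow> F k < l"
      using crossing_index[of F l] Fmono True by metis
    define K where "K = {k \<in> {1..p}. k \<le> m \<and> {j \<in> J. lev j = k} \<subseteq> A}"
    have K: "finite K" "K \<subseteq> {1..m}" by (auto simp: K_def)
    define A' where "A' = A - {j \<in> J. lev j \<in> K}"
    have A'J: "A' \<subseteq> J" using A by (auto simp: A'_def)
    have sub: "{j \<in> J. lev j \<in> K} \<subseteq> A" by (auto simp: K_def)
    have zA: "(\<Sum>j\<in>A. z j) = (\<Sum>j\<in>A'. z j) + (\<Sum>k\<in>K. \<Sum>j\<in>{j \<in> J. lev j = k}. z j)"
      unfolding A'_def sum_levels[OF K(1), symmetric] by (rule sum.subset_diff[OF sub fin(2)])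
    have above: "{j \<in> J - A'. p < lev j} = {j \<in> J - A. p < lev j}" by (auto simp: A'_def K_def)
    have head: "(\<Sum>k\<in>{1..p}. wt d k * real (lower_rank A k)) = (\<Sum>k\<in>K. wt d k)"
    proof -
      have "(\<Sum>k\<in>{1..p}. wt d k * real (lower_rank A k))
          = (\<Sum>k\<in>{1..p}. if k \<le> m \<and> {j \<in> J. lev j = k} \<subseteq> A then wt d k else 0)"
      proof (rule sum.cong[OF refl])
        fix k assume k: "k \<in> {1..p}"
        then have "l \<le> F (k - 1)" by (intro p(3)) auto
        then have "lower_rank A k = (if k \<le> m \<and> {j \<in> J. lev j = k} \<subseteq> A then 1 else 0)"
          using Fk[of k] k by (simp only: lower_rank_def) auto
        then show "wt d k * real (lower_rank A k)
            = (if k \<le> m \<and> {j \<in> J. lev j = k} \<subseteq> A then wt d k else 0)"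
          by simp
      qed
      then show ?thesis unfolding K_def by (simp only: sum.inter_filter[OF finite_atLeastAtMost])
    qed
    have tail': "(\<Sum>k\<in>{p + 1..m + 1}. wt d k * real (lower_rank A k))
        = ext d p * real l - (\<Sum>j\<in>{j \<in> J - A. p < lev j}. ext d p - ext d (lev j))"
    proof -
      have "(\<Sum>k\<in>{p + 1..m + 1}. wt d k * real (lower_rank A k))
          = (\<Sum>k\<in>{p + 1..m + 1}. wt d k * real l - wt d k * real (F (k - 1)))"
      proof (rule sum.cong[OF refl])
        fix k assume k: "k \<in> {p + 1..m + 1}"
        then have "F (k - 1) < l" by (intro p(4)) auto
        then show "wt d k * real (lower_rank A k) = wt d k * real l - wt d k * real (F (k - 1))"
          using k by (simp add: low right_diff_distrib)
      qed
      also have "\<dots> = (\<Sum>k\<in>{p + 1..m + 1}. wt d k) * real l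
          - (\<Sum>j\<in>{j \<in> J - A. p < lev j}. ext d p - ext d (lev j))"
        unfolding sum_subtractf sum_distrib_right tail[OF p(2)] ..
      also have "(\<Sum>k\<in>{p + 1..m + 1}. wt d k) = ext d p"
        using sum_wt[OF p(2), of d] basic(7) by (simp add: ext_def)
      finally show ?thesis .
    qed
    have main: "ext d p * real l - (\<Sum>j\<in>{j \<in> J - A. p < lev j}. ext d p - ext d (lev j)) \<le> (\<Sum>j\<in>A'. z j)"
    proof (cases "p = m + 1")
      case True
      have "{j \<in> J - A. p < lev j} = {}" using lev_le True by (auto simp: not_less)
      then have "(\<Sum>j\<in>{j \<in> J - A. p < lev j}. ext d p - ext d (lev j)) = 0" by (simp only: sum.empty)
      moreover have "0 \<le> (\<Sum>j\<in>A'. z j)"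
        using A'J basic(3) by (intro sum_nonneg) auto
      ultimately show ?thesis using basic(7) True by (simp add: ext_def)
    next
      case False
      then have pm: "p \<in> {1..m}" using p by auto
      have c1: "card (A' \<union> S p) + F p = n"
        using card_Un_S[OF A'J, of p] above pm by (simp add: F_def)
      have c2: "card (A' \<union> S (p - 1)) + card {j \<in> J - A'. p - 1 < lev j} = n"
        using card_Un_S[OF A'J, of "p - 1"] pm by auto
      have "F (p - 1) \<le> card {j \<in> J - A'. p - 1 < lev j}"
        unfolding F_def by (intro card_mono) (auto simp: A'_def)
      then have le: "card (A' \<union> S (p - 1)) \<le> n - l" using c2 p(3)[of "p - 1"] p(1) by simp
      have lt: "n - l < card (A' \<union> S p)" using c1 p(4)[of p] pm l_le by simp
      have "A' \<noteq> J"
      proof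
        assume "A' = J"
        then have "n \<le> card (A' \<union> S (p - 1))"
          using card_mono[of "A' \<union> S (p - 1)" J] finite_S[of "p - 1"] pm by auto
        then show False using le lt c1 by linarith
      qed
      then have "Lower_lift p A' \<in> ineqs n m l u S"
        using le lt pm A'J by (auto simp: ineqs_def)
      then have "violation n m l u S (z, d) (Lower_lift p A') \<le> 0"
        using sat by (auto simp: satisfies_def)
      then have "real l * d p + (\<Sum>j\<in>{j \<in> J - A. p < lev j}. d (lev j) - d p) - (\<Sum>j\<in>A'. z j) \<le> 0"
        unfolding violation_Lower_lift[where d = d, OF pm A'J basic(7)] above .
      moreover have "(\<Sum>j\<in>{j \<in> J - A. p < lev j}. ext d p - ext d (lev j)) = - (\<Sum>j\<in>{j \<in> J - A. p < lev j}. d (lev j) - d p)"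
        using pm by (simp add: ext_def sum_negf[symmetric])
      ultimately show ?thesis using pm by (simp add: ext_def algebra_simps)
    qed
    have "(\<Sum>k\<in>K. wt d k) \<le> (\<Sum>k\<in>K. \<Sum>j\<in>{j \<in> J. lev j = k}. z j)"
      using K by (intro sum_mono basic(6)) auto
    then show ?thesis
      unfolding split_range[OF p(1,2)] using main zA head tail' by linarith
  qed
qed

section \<open>The convex hull\<close>

definition point :: "nat \<Rightarrow> nat set \<Rightarrow> (nat \<Rightarrow> real) \<times> (nat \<Rightarrow> real)" where
  "point k U = (\<lambda>j. if j \<in> U then 1 else 0, \<lambda>i. if 1 \<le> i \<and> i < k then 1 else 0)"

lemma point_in_X:
  assumes k: "k \<in> {1..m + 1}" and U: "U \<subseteq> {j \<in> J. k \<le> lev j}"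
    and hit: "k \<le> m \<Longrightarrow> \<exists>j\<in>U. lev j = k" and card: "l \<le> card U" "card U \<le> u"
  shows "point k U \<in> X n m l u S"
proof -
  have UJ: "U \<subseteq> J" using U by auto
  have sum: "(\<Sum>j\<in>J. if j \<in> U then 1 else 0 :: real) = real (card U)"
    using UJ by (simp add: sum.If_cases Int_absorb1)
  have prod: "(if 1 \<le> i \<and> i < k then 1 else 0) = (\<Prod>j\<in>S i. 1 - (if j \<in> U then 1 else 0 :: real))"
    if i: "i \<in> {1..m}" for i
  proof (cases "i < k")
    case True
    have "j \<notin> U" if "j \<in> S i" for j
      using that True U mem_S_iff[of i j] i by auto
    then show ?thesis using True i by simp
  next
    case False
    then have "k \<le> m" using i by auto
    then obtain j where j: "j \<in> U" "lev j = k" using hit by auto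
    then have "j \<in> S i" using mem_S_iff[of i j] i False by auto
    then have "(\<Prod>j\<in>S i. 1 - (if j \<in> U then 1 else 0 :: real)) = 0"
      using j finite_S[of i] i by (intro prod_zero) auto
    then show ?thesis using False by simp
  qed
  show ?thesis
    unfolding X_def point_def
  proof (intro CollectI case_prodI conjI ballI)
    fix i assume "i \<in> {1..m}"
    from prod[OF this] show "(if 1 \<le> i \<and> i < k then 1 else 0) = (\<Prod>j\<in>S i. 1 - (if j \<in> U then 1 else 0 :: real))" .
  qed (use UJ k card sum in \<open>auto simp: vecs_def\<close>)
qed

lemma X_subset_vecs: "X n m l u S \<subseteq> vecs n \<times> vecs m"
  by (auto simp: X_def)

lemma finite_X: "finite (X n m l u S)"
proof -
  have fin: "finite {x :: nat \<Rightarrow> real. \<forall>j. (j \<in> {1..N} \<longrightarrow> x j \<in> {0, 1}) \<and> (j \<notin> {1..N} \<longrightarrow> x j = 0)}" for N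
    by (rule finite_set_of_finite_funs) auto
  have "X n m l u S \<subseteq> {x. \<forall>j. (j \<in> {1..n} \<longrightarrow> x j \<in> {0, 1}) \<and> (j \<notin> {1..n} \<longrightarrow> x j = 0)}
      \<times> {x. \<forall>j. (j \<in> {1..m} \<longrightarrow> x j \<in> {0, 1}) \<and> (j \<notin> {1..m} \<longrightarrow> x j = 0)}"
    by (auto simp: X_def vecs_def)
  then show ?thesis by (rule finite_subset) (intro finite_cartesian_product fin)
qed

text \<open>
  A separating functional \<open>(c, e)\<close> would be strictly smaller on every point of \<open>X\<close>, hence also on the
  combination with weights \<open>wt d k\<close> of the points that are greedy for \<open>c\<close>. The \<open>\<delta>\<close>-part of this
  combination is \<open>d\<close> itself, and on its \<open>z\<close>-part \<open>w\<close> the rank inequalities and the layer-cake lemma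
  show that \<open>c\<close> is at least as large as on \<open>z\<close>.
\<close>
lemma satisfies_in_hull:
  assumes sat: "satisfies z d"
  shows "(z, d) \<in> convex hull (X n m l u S)"
proof (rule ccontr)
  assume out: "(z, d) \<notin> convex hull (X n m l u S)"
  note basic = satisfies_basic[OF sat]
  have "z \<in> vecs n" "d \<in> vecs m" using sat by (auto simp: satisfies_def)
  from separation_pairs[OF finite_X X_subset_vecs this out]
  obtain c e where sep: "\<And>x y. (x, y) \<in> X n m l u S \<Longrightarrow>
      (\<Sum>j\<in>J. c j * x j) + (\<Sum>i\<in>{1..m}. e i * y i) < (\<Sum>j\<in>J. c j * z j) + (\<Sum>i\<in>{1..m}. e i * d i)"
    by blast
  let ?good = "\<lambda>k U. U \<subseteq> {j \<in> J. k \<le> lev j} \<and> (k \<le> m \<longrightarrow> (\<exists>j\<in>U. lev j = k)) \<and> l \<le> card U \<and> card U \<le> u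
    \<and> (\<forall>t>0. card {j \<in> U. t \<le> c j} = upper_rank {j \<in> J. t \<le> c j} k)
    \<and> (\<forall>t<0. card {j \<in> U. c j \<le> t} = lower_rank {j \<in> J. c j \<le> t} k)"
  have "\<forall>k\<in>{1..m + 1}. \<exists>U. ?good k U" by (intro ballI greedy_level)
  from bchoice[OF this] obtain U where U': "\<forall>k\<in>{1..m + 1}. ?good k (U k)"
    by (elim exE)
  then have U: "?good k (U k)" if "k \<in> {1..m + 1}" for k
    using that by (rule bspec)
  define w where "w j = (\<Sum>k\<in>{1..m + 1}. wt d k * (if j \<in> U k then 1 else 0))" for j
  have sum_w: "(\<Sum>j\<in>{j \<in> J. P j}. w j) = (\<Sum>k\<in>{1..m + 1}. wt d k * real (card {j \<in> U k. P j}))" for P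
  proof -
    have "(\<Sum>j\<in>{j \<in> J. P j}. w j) = (\<Sum>k\<in>{1..m + 1}. wt d k * (\<Sum>j\<in>{j \<in> J. P j}. if j \<in> U k then 1 else 0))"
      unfolding w_def sum_distrib_left by (rule sum.swap)
    also have "\<dots> = (\<Sum>k\<in>{1..m + 1}. wt d k * real (card {j \<in> U k. P j}))"
    proof (rule sum.cong[OF refl])
      fix k assume k: "k \<in> {1..m + 1}"
      then have "{j \<in> {j \<in> J. P j}. j \<in> U k} = {j \<in> U k. P j}" using U[OF k] by auto
      moreover have "(\<Sum>j\<in>{j \<in> J. P j}. if j \<in> U k then 1 else 0 :: real) = real (card {j \<in> {j \<in> J. P j}. j \<in> U k})"
        by (simp flip: sum.inter_filter)
      ultimately show "wt d k * (\<Sum>j\<in>{j \<in> J. P j}. if j \<in> U k then 1 else 0) = wt d k * real (card {j \<in> U k. P j})"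
        by simp
    qed
    finally show ?thesis .
  qed
  have "(\<Sum>j\<in>J. c j * (z j - w j)) \<le> 0"
  proof (rule layer_cake)
    fix t :: real assume t: "t > 0"
    have "(\<Sum>j\<in>{j \<in> J. t \<le> c j}. z j) \<le> (\<Sum>k\<in>{1..m + 1}. wt d k * real (upper_rank {j \<in> J. t \<le> c j} k))"
      by (rule upper_rank_inequality[OF sat]) auto
    also have "\<dots> = (\<Sum>j\<in>{j \<in> J. t \<le> c j}. w j)"
      unfolding sum_w using U t by (intro sum.cong) auto
    finally show "(\<Sum>j\<in>{j \<in> J. t \<le> c j}. z j - w j) \<le> 0" by (simp add: sum_subtractf)
  next
    fix t :: real assume t: "t < 0"
    have "(\<Sum>j\<in>{j \<in> J. c j \<le> t}. w j) = (\<Sum>k\<in>{1..m + 1}. wt d k * real (lower_rank {j \<in> J. c j \<le> t} k))"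
      unfolding sum_w using U t by (intro sum.cong) auto
    also have "\<dots> \<le> (\<Sum>j\<in>{j \<in> J. c j \<le> t}. z j)"
      by (rule lower_rank_inequality[OF sat]) auto
    finally show "0 \<le> (\<Sum>j\<in>{j \<in> J. c j \<le> t}. z j - w j)" by (simp add: sum_subtractf)
  qed simp
  then have cz: "(\<Sum>j\<in>J. c j * z j) \<le> (\<Sum>j\<in>J. c j * w j)"
    by (simp add: right_diff_distrib sum_subtractf)
  let ?x = "\<lambda>k. fst (point k (U k))" and ?y = "\<lambda>k. snd (point k (U k))"
  have cw: "(\<Sum>j\<in>J. c j * w j) = (\<Sum>k\<in>{1..m + 1}. wt d k * (\<Sum>j\<in>J. c j * ?x k j))"
  proof -
    have "(\<Sum>j\<in>J. c j * w j) = (\<Sum>j\<in>J. \<Sum>k\<in>{1..m + 1}. wt d k * (c j * ?x k j))"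
      unfolding w_def sum_distrib_left by (intro sum.cong refl) (simp add: point_def)
    also have "\<dots> = (\<Sum>k\<in>{1..m + 1}. wt d k * (\<Sum>j\<in>J. c j * ?x k j))"
      unfolding sum_distrib_left by (rule sum.swap)
    finally show ?thesis .
  qed
  have de: "(\<Sum>i\<in>{1..m}. e i * d i) = (\<Sum>k\<in>{1..m + 1}. wt d k * (\<Sum>i\<in>{1..m}. e i * ?y k i))"
  proof -
    have "(\<Sum>i\<in>{1..m}. e i * d i) = (\<Sum>i\<in>{1..m}. \<Sum>k\<in>{1..m + 1}. wt d k * (e i * ?y k i))"
    proof (rule sum.cong[OF refl])
      fix i assume i: "i \<in> {1..m}"
      have "(\<Sum>k\<in>{1..m + 1}. wt d k * (e i * ?y k i)) = (\<Sum>k\<in>{1..m + 1}. if i < k then e i * wt d k else 0)"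
        using i by (intro sum.cong refl) (auto simp: point_def)
      also have "\<dots> = (\<Sum>k\<in>{k \<in> {1..m + 1}. i < k}. e i * wt d k)"
        by (rule sum.inter_filter[symmetric]) simp
      also have "{k \<in> {1..m + 1}. i < k} = {i + 1..m + 1}" by auto
      also have "(\<Sum>k\<in>{i + 1..m + 1}. e i * wt d k) = e i * (ext d i - ext d (m + 1))"
        using i by (subst sum_distrib_left[symmetric], subst sum_wt) auto
      also have "\<dots> = e i * d i" using i basic(7) by (simp add: ext_def)
      finally show "e i * d i = (\<Sum>k\<in>{1..m + 1}. wt d k * (e i * ?y k i))" ..
    qed
    also have "\<dots> = (\<Sum>k\<in>{1..m + 1}. wt d k * (\<Sum>i\<in>{1..m}. e i * ?y k i))"
      unfolding sum_distrib_left by (rule sum.swap)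
    finally show ?thesis .
  qed
  have one: "(\<Sum>k\<in>{1..m + 1}. wt d k) = 1"
    using sum_wt[of 0 "m + 1" d] basic(7) by (simp add: ext_def)
  let ?v = "(\<Sum>j\<in>J. c j * z j) + (\<Sum>i\<in>{1..m}. e i * d i)"
  have pt: "(\<Sum>j\<in>J. c j * ?x k j) + (\<Sum>i\<in>{1..m}. e i * ?y k i) < ?v" if k: "k \<in> {1..m + 1}" for k
  proof (rule sep)
    show "(?x k, ?y k) \<in> X n m l u S" using U[OF k] point_in_X[OF k, of "U k"] by simp
  qed
  \<comment> \<open>Strictness survives the combination because the weights add up to \<open>1\<close>.\<close>
  have "\<exists>k\<in>{1..m + 1}. wt d k > 0"
  proof (rule ccontr)
    assume "\<not> ?thesis"
    then have "(\<Sum>k\<in>{1..m + 1}. wt d k) \<le> 0" by (intro sum_nonpos) (auto simp: not_less)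
    then show False using one by simp
  qed
  then obtain k0 where k0: "k0 \<in> {1..m + 1}" "wt d k0 > 0" by blast
  have "(\<Sum>k\<in>{1..m + 1}. wt d k * ((\<Sum>j\<in>J. c j * ?x k j) + (\<Sum>i\<in>{1..m}. e i * ?y k i)))
      < (\<Sum>k\<in>{1..m + 1}. wt d k * ?v)"
  proof (rule sum_strict_mono_ex1)
    show "\<forall>k\<in>{1..m + 1}. wt d k * ((\<Sum>j\<in>J. c j * ?x k j) + (\<Sum>i\<in>{1..m}. e i * ?y k i)) \<le> wt d k * ?v"
      using pt basic(5) by (intro ballI mult_left_mono) (auto intro: less_imp_le)
    show "\<exists>k\<in>{1..m + 1}. wt d k * ((\<Sum>j\<in>J. c j * ?x k j) + (\<Sum>i\<in>{1..m}. e i * ?y k i)) < wt d k * ?v"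
      using pt[OF k0(1)] k0 by (intro bexI[of _ k0] mult_strict_left_mono)
  qed simp
  also have "(\<Sum>k\<in>{1..m + 1}. wt d k * ?v) = ?v"
    by (simp only: sum_distrib_right[symmetric] one mult_1)
  finally have "(\<Sum>j\<in>J. c j * w j) + (\<Sum>i\<in>{1..m}. e i * d i) < ?v"
    unfolding cw de by (simp only: distrib_left sum.distrib)
  then show False using cz by linarith
qed

lemma violation_affine:
  assumes "a + b = (1 :: real)"
  shows "violation n m l u S (a *\<^sub>R (z, d) + b *\<^sub>R (z', d')) c
    = a * violation n m l u S (z, d) c + b * violation n m l u S (z', d') c"
proof -
  have b: "b = 1 - a" using assms by simp
  show ?thesis
    unfolding b
    by (cases c) (simp_all add: scaleR_fun_def sum.distrib sum_subtractf sum_distrib_left algebra_simps)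
qed

lemma convex_satisfies: "convex {(z, d). satisfies z d}"
proof (rule convexI)
  fix x y :: "(nat \<Rightarrow> real) \<times> (nat \<Rightarrow> real)" and a b :: real
  assume x: "x \<in> {(z, d). satisfies z d}" and y: "y \<in> {(z, d). satisfies z d}"
    and ab: "0 \<le> a" "0 \<le> b" "a + b = 1"
  obtain z d z' d' where [simp]: "x = (z, d)" "y = (z', d')" by (cases x, cases y)
  have "violation n m l u S (a *\<^sub>R x + b *\<^sub>R y) c \<le> 0" if c: "c \<in> ineqs n m l u S" for c
  proof -
    have "violation n m l u S (z, d) c \<le> 0" "violation n m l u S (z', d') c \<le> 0"
      using x y c by (auto simp: satisfies_def)
    then show ?thesis using ab violation_affine[OF ab(3), of z d z' d' c]
      by (simp add: mult_nonneg_nonpos add_nonpos_nonpos)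
  qed
  moreover have "a *\<^sub>R z + b *\<^sub>R z' \<in> vecs n" "a *\<^sub>R d + b *\<^sub>R d' \<in> vecs m"
    using x y by (auto simp: satisfies_def vecs_def scaleR_fun_def)
  ultimately show "a *\<^sub>R x + b *\<^sub>R y \<in> {(z, d). satisfies z d}"
    by (simp add: satisfies_def)
qed

text \<open>
  For the lifted inequalities, distinguish whether \<open>\<delta>\<^sub>p\<close> is \<open>0\<close> or \<open>1\<close>. In the first case \<open>\<delta>\<close> vanishes
  on all levels above \<open>p\<close>; in the second, \<open>z\<close> vanishes on \<open>S\<^sub>p\<close>, and \<open>z\<^sub>j + \<delta> \<le> 1\<close> at the level of
  each further element.
\<close>
lemma X_satisfies:
  assumes zd: "(z, d) \<in> X n m l u S"
  shows "satisfies z d"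
proof -
  have vec: "z \<in> vecs n" "d \<in> vecs m" and z01: "\<And>j. j \<in> J \<Longrightarrow> z j = 0 \<or> z j = 1"
    and prod: "\<And>i. i \<in> {1..m} \<Longrightarrow> d i = (\<Prod>j\<in>S i. 1 - z j)"
    and card: "real l \<le> (\<Sum>j\<in>J. z j)" "(\<Sum>j\<in>J. z j) \<le> real u"
    using zd by (auto simp: X_def)
  have d0: "d (m + 1) = 0" using vec by (auto simp: vecs_def)
  have z0: "0 \<le> z j" if "j \<in> J" for j using z01[OF that] by auto
  have d: "d i = (if \<forall>j\<in>S i. z j = 0 then 1 else 0)" if i: "i \<in> {1..m}" for i
  proof (cases "\<forall>j\<in>S i. z j = 0")
    case False
    then obtain j where j: "j \<in> S i" "z j \<noteq> 0" by auto
    then have "z j = 1" using z01[of j] S_subset[of i] i by auto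
    then have "(\<Prod>j\<in>S i. 1 - z j) = 0" using j finite_S[of i] i by (intro prod_zero) auto
    then show ?thesis using False prod[OF i] by simp
  qed (simp add: prod[OF i])
  have lev1: "z j + d (lev j) \<le> 1" "0 \<le> d (lev j)" if j: "j \<in> J" for j
  proof -
    have "z j + d (lev j) \<le> 1 \<and> 0 \<le> d (lev j)"
    proof (cases "lev j \<le> m")
      case True
      then show ?thesis
        using d[of "lev j"] lev_pos[of j] mem_S_iff[of "lev j" j] z01[OF j] by auto
    next
      case False
      then have "lev j = m + 1" using lev_le[of j] by simp
      then show ?thesis using d0 z01[OF j] by auto
    qed
    then show "z j + d (lev j) \<le> 1" "0 \<le> d (lev j)" by auto
  qed
  have vanish: "d (lev j) = 0" if p: "p \<in> {1..m}" "d p = 0" "p < lev j" for p j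
  proof (cases "lev j \<le> m")
    case True
    then have "S p \<subseteq> S (lev j)" using p by (intro S_mono) auto
    moreover have "\<not> (\<forall>i\<in>S p. z i = 0)" using d[OF p(1)] p(2) by (auto split: if_splits)
    ultimately show ?thesis using d[of "lev j"] True p by auto
  next
    case False
    then have "lev j = m + 1" using lev_le[of j] by simp
    then show ?thesis using d0 by simp
  qed
  have "violation n m l u S (z, d) c \<le> 0" if c: "c \<in> ineqs n m l u S" for c
  proof (cases c)
    case Card_ge
    then show ?thesis using card by simp
  next
    case Card_le
    then show ?thesis using card by simp
  next
    case (Pair_le i j)
    then have ij: "i \<in> {1..m}" "j \<in> S i" using c by (auto simp: ineqs_def)
    then have "j \<in> J" using S_subset[of i] by auto
    then show ?thesis using Pair_le d[OF ij(1)] z01[of j] ij by auto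
  next
    case Cover_first
    have S1: "1 \<in> {1..m}" "S 1 \<subseteq> J" using m_pos S_subset[of 1] by auto
    show ?thesis
    proof (cases "\<forall>j\<in>S 1. z j = 0")
      case True
      then show ?thesis using Cover_first d[OF S1(1)] by simp
    next
      case False
      then obtain j where j: "j \<in> S 1" "z j = 1" using z01 S1 by blast
      have "z j \<le> (\<Sum>j\<in>S 1. z j)"
        by (rule member_le_sum) (use j z0 S1 finite_S[of 1] m_pos in auto)
      then show ?thesis using Cover_first d[OF S1(1)] j by auto
    qed
  next
    case (Mono i)
    then have i: "i \<in> {1..m}" "i + 1 \<in> {1..m}" using c by (auto simp: ineqs_def)
    have "S i \<subseteq> S (i + 1)" using i by (intro S_mono) auto
    then show ?thesis using Mono d[OF i(1)] d[OF i(2)] by auto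
  next
    case (Cover_step i)
    then have i: "i \<in> {1..m}" "i + 1 \<in> {1..m}" using c by (auto simp: ineqs_def)
    have SJ: "S (i + 1) \<subseteq> J" using i by (intro S_subset) auto
    have nn: "0 \<le> (\<Sum>j\<in>S (i + 1) - S i. z j)" using z0 SJ by (intro sum_nonneg) auto
    show ?thesis
    proof (cases "\<forall>j\<in>S (i + 1) - S i. z j = 0")
      case True
      then show ?thesis using Cover_step d[OF i(1)] d[OF i(2)] by auto
    next
      case False
      then obtain j where j: "j \<in> S (i + 1) - S i" "z j = 1" using z01 SJ by blast
      have "z j \<le> (\<Sum>j\<in>S (i + 1) - S i. z j)"
        by (rule member_le_sum) (use j z0 SJ finite_S[of "i + 1"] i in auto)
      then show ?thesis using Cover_step d[OF i(1)] d[OF i(2)] j by auto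
    qed
  next
    case Last_nonneg
    then show ?thesis using d[of m] m_pos by auto
  next
    case (Nonneg j)
    then show ?thesis using c z0[of j] by (auto simp: ineqs_def)
  next
    case (Le_one j)
    then show ?thesis using c z01[of j] by (auto simp: ineqs_def)
  next
    case (Upper_lift p A)
    then have pA: "p \<in> {1..m}" "A \<subseteq> J" using c by (auto simp: ineqs_def)
    have fin: "finite A" using pA finite_subset by blast
    show ?thesis
    proof (cases "d p = 0")
      case True
      then have "(\<Sum>j\<in>{j \<in> A. p < lev j}. d (lev j) - d p) = 0"
        using vanish[OF pA(1)] by (intro sum.neutral) auto
      moreover have "(\<Sum>j\<in>A. z j) \<le> (\<Sum>j\<in>J. z j)" using pA z0 by (intro sum_mono2) auto
      ultimately show ?thesis
        unfolding Upper_lift violation_Upper_lift[where d = d, OF pA d0] using True card by simp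
    next
      case False
      then have d1: "d p = 1" and zS: "\<forall>j\<in>S p. z j = 0" using d[OF pA(1)] by (auto split: if_splits)
      have "(\<Sum>j\<in>A. z j) = (\<Sum>j\<in>{j \<in> A. p < lev j}. z j)"
        using zS fin mem_S_iff[of p] pA(1)
        by (intro sum.mono_neutral_right) (auto simp: not_less)
      moreover have "(\<Sum>j\<in>{j \<in> A. p < lev j}. z j) + (\<Sum>j\<in>{j \<in> A. p < lev j}. d (lev j) - d p) \<le> 0"
        unfolding sum.distrib[symmetric] d1 by (rule sum_nonpos) (use lev1 pA in force)
      ultimately show ?thesis
        unfolding Upper_lift violation_Upper_lift[where d = d, OF pA d0] by (simp add: d1)
    qed
  next
    case (Lower_lift p A)
    then have pA: "p \<in> {1..m}" "A \<subseteq> J" using c by (auto simp: ineqs_def)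
    have fin: "finite A" using pA finite_subset by blast
    have zA: "0 \<le> (\<Sum>j\<in>A. z j)" using pA z0 by (intro sum_nonneg) auto
    show ?thesis
    proof (cases "d p = 0")
      case True
      then have "(\<Sum>j\<in>{j \<in> J - A. p < lev j}. d (lev j) - d p) = 0"
        using vanish[OF pA(1)] by (intro sum.neutral) auto
      then show ?thesis
        unfolding Lower_lift violation_Lower_lift[where d = d, OF pA d0] using True zA by simp
    next
      case False
      then have d1: "d p = 1" and zS: "\<forall>j\<in>S p. z j = 0" using d[OF pA(1)] by (auto split: if_splits)
      have "(\<Sum>j\<in>J - A. z j) = (\<Sum>j\<in>{j \<in> J - A. p < lev j}. z j)"
        using zS fin mem_S_iff[of p] pA(1)
        by (intro sum.mono_neutral_right) (auto simp: not_less)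
      moreover have "(\<Sum>j\<in>{j \<in> J - A. p < lev j}. z j) + (\<Sum>j\<in>{j \<in> J - A. p < lev j}. d (lev j) - d p) \<le> 0"
        unfolding sum.distrib[symmetric] d1 by (rule sum_nonpos) (use lev1 in force)
      moreover have "(\<Sum>j\<in>J. z j) = (\<Sum>j\<in>A. z j) + (\<Sum>j\<in>J - A. z j)"
        using pA(2) by (metis add.commute finite_atLeastAtMost sum.subset_diff)
      ultimately show ?thesis
        unfolding Lower_lift violation_Lower_lift[where d = d, OF pA d0] using card by (simp add: d1)
    qed
  qed
  then show ?thesis using vec by (simp add: satisfies_def)
qed

theorem convex_hull_X: "convex hull (X n m l u S) = {(z, d). satisfies z d}"
proof
  show "convex hull (X n m l u S) \<subseteq> {(z, d). satisfies z d}"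
    by (rule hull_minimal) (use X_satisfies convex_satisfies in auto)
  show "{(z, d). satisfies z d} \<subseteq> convex hull (X n m l u S)"
    using satisfies_in_hull by auto
qed

end

section \<open>A loop language with polynomial running time\<close>

text \<open>
  \<open>Inp e\<close> reads the input cell with address \<open>e\<close>. \<open>Scale a e\<close> multiplies \<open>a\<close> by such a cell; there is no
  general product, as repeated squaring in a loop would produce numbers of exponential length.
  \<open>Fold i a z f\<close> starts with the accumulator \<open>a = z\<close> and replaces it by \<open>f\<close> for every index \<open>i\<close> below
  the number stored in input cell \<open>0\<close>, which is the length of the input.
\<close>
datatype 'v ex =
    Num int
  | Var 'v
  | Inp "'v ex"
  | Plus "'v ex" "'v ex"
  | Minus "'v ex" "'v ex"
  | Scale "'v ex" "'v ex"
  | Cond "'v ex" "'v ex" "'v ex"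
  | Bind 'v "'v ex" "'v ex"
  | Fold 'v 'v "'v ex" "'v ex"

primrec iterate :: "(nat \<Rightarrow> int \<Rightarrow> int) \<Rightarrow> int \<Rightarrow> nat \<Rightarrow> int" where
  "iterate f z 0 = z"
| "iterate f z (Suc k) = f k (iterate f z k)"

text \<open>
  Negative addresses belong to the registers of compiled programs; reading them as \<open>0\<close> makes the
  value of an expression independent of the compilation.
\<close>
definition input_at :: "memory \<Rightarrow> int \<Rightarrow> int" where
  "input_at inp a = (if 0 \<le> a then inp a else 0)"

primrec eval_ex :: "memory \<Rightarrow> 'v ex \<Rightarrow> ('v \<Rightarrow> int) \<Rightarrow> int" where
  "eval_ex inp (Num c) env = c"
| "eval_ex inp (Var v) env = env v"
| "eval_ex inp (Inp e) env = input_at inp (eval_ex inp e env)"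
| "eval_ex inp (Plus a b) env = eval_ex inp a env + eval_ex inp b env"
| "eval_ex inp (Minus a b) env = eval_ex inp a env - eval_ex inp b env"
| "eval_ex inp (Scale a b) env = eval_ex inp a env * input_at inp (eval_ex inp b env)"
| "eval_ex inp (Cond c a b) env =
     (if eval_ex inp c env > 0 then eval_ex inp a env else eval_ex inp b env)"
| "eval_ex inp (Bind v a b) env = eval_ex inp b (env(v := eval_ex inp a env))"
| "eval_ex inp (Fold i a z f) env =
     iterate (\<lambda>k acc. eval_ex inp f (env(i := int k, a := acc))) (eval_ex inp z env) (nat (inp 0))"

text \<open>
  Registers occupy the odd negative addresses. The even negative ones will hold a buffer for the
  output, and the nonnegative ones the input.
\<close>
definition reg_addr :: "nat \<Rightarrow> int" where
  "reg_addr r = - (2 * int r + 1)"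

abbreviation reg :: "nat \<Rightarrow> aexp" where "reg r \<equiv> Const (reg_addr r)"
abbreviation get :: "nat \<Rightarrow> aexp" where "get r \<equiv> Load (reg r)"

text \<open>
  The machine counterpart of \<open>input_at\<close>: without the test, a negative address in register \<open>i\<close> would
  lead to the contents of a register.
\<close>
abbreviation store_if_nonneg :: "nat \<Rightarrow> nat \<Rightarrow> aexp \<Rightarrow> com" where
  "store_if_nonneg r i x \<equiv>
     If_pos (Add (get i) (Const 1)) (Store (reg r) x) (Store (reg r) (Const 0))"

text \<open>
  The environment \<open>\<rho>\<close> tells which register holds a variable. The value of the expression is put into
  register \<open>r\<close>; registers below \<open>r\<close> are kept, and those above serve as scratch space.
\<close>
primrec compile :: "'v ex \<Rightarrow> ('v \<Rightarrow> nat) \<Rightarrow> nat \<Rightarrow> com" where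
  "compile (Num c) \<rho> r = Store (reg r) (Const c)"
| "compile (Var v) \<rho> r = Store (reg r) (get (\<rho> v))"
| "compile (Inp e) \<rho> r = Seq (compile e \<rho> r) (store_if_nonneg r r (Load (get r)))"
| "compile (Plus a b) \<rho> r = Seq (compile a \<rho> r) (Seq (compile b \<rho> (Suc r))
     (Store (reg r) (Add (get r) (get (Suc r)))))"
| "compile (Minus a b) \<rho> r = Seq (compile a \<rho> r) (Seq (compile b \<rho> (Suc r))
     (Store (reg r) (Sub (get r) (get (Suc r)))))"
| "compile (Scale a b) \<rho> r = Seq (compile a \<rho> r) (Seq (compile b \<rho> (Suc r))
     (store_if_nonneg r (Suc r) (Mul (get r) (Load (get (Suc r))))))"
| "compile (Cond c a b) \<rho> r = Seq (compile c \<rho> r)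
     (If_pos (get r) (compile a \<rho> r) (compile b \<rho> r))"
| "compile (Bind v a b) \<rho> r = Seq (compile a \<rho> r)
     (Seq (compile b (\<rho>(v := r)) (Suc r)) (Store (reg r) (get (Suc r))))"
| "compile (Fold i a z f) \<rho> r = Seq (compile z \<rho> r) (Seq (Store (reg (Suc r)) (Const 0))
     (While_pos (Sub (Load (Const 0)) (get (Suc r)))
       (Seq (compile f (\<rho>(i := Suc r, a := r)) (Suc (Suc r)))
         (Seq (Store (reg r) (get (Suc (Suc r))))
           (Store (reg (Suc r)) (Add (get (Suc r)) (Const 1)))))))"

section \<open>Counting steps and bits\<close>

definition bounded_memory :: "nat \<Rightarrow> memory \<Rightarrow> bool" where
  "bounded_memory B s \<longleftrightarrow> (\<forall>a. \<bar>s a\<bar> \<le> 2 ^ B)"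

text \<open>
  A run of \<open>k\<close> steps may lengthen the numbers in memory by \<open>k (N + 1)\<close> bits, and each step costs at
  most as much as the longest number that can occur. Both bounds add up under sequential composition,
  so that the logarithmic cost follows from the mere number of steps.
\<close>
definition runs :: "nat \<Rightarrow> nat \<Rightarrow> com \<Rightarrow> memory \<Rightarrow> memory \<Rightarrow> bool" where
  "runs N k c s s' \<longleftrightarrow> (\<forall>B. bounded_memory B s \<longrightarrow>
     (\<exists>t. exec c s t s' \<and> t \<le> k * (B + k * (N + 1)) \<and> bounded_memory (B + k * (N + 1)) s'))"

text \<open>
  Bounds both the number of subexpressions, each of which is charged, and, in units of \<open>N + 1\<close> bits,
  the excess of the value over the numbers in memory.
\<close>
primrec asize :: "aexp \<Rightarrow> nat" where
  "asize (Const c) = bit_length c"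
| "asize (Load a) = Suc (asize a)"
| "asize (Add a b) = Suc (asize a + asize b)"
| "asize (Sub a b) = Suc (asize a + asize b)"
| "asize (Mul a b) = Suc (asize a + asize b)"

primrec small_factors :: "nat \<Rightarrow> aexp \<Rightarrow> memory \<Rightarrow> bool" where
  "small_factors N (Const c) s = True"
| "small_factors N (Load a) s = small_factors N a s"
| "small_factors N (Add a b) s = (small_factors N a s \<and> small_factors N b s)"
| "small_factors N (Sub a b) s = (small_factors N a s \<and> small_factors N b s)"
| "small_factors N (Mul a b) s = (small_factors N a s \<and> small_factors N b s \<and> \<bar>aval b s\<bar> \<le> 2 ^ N)"

lemma abs_le_bit_length: "\<bar>k\<bar> \<le> 2 ^ bit_length k"
proof -
  have "nat \<bar>k\<bar> < 2 ^ floorlog 2 (nat \<bar>k\<bar>)"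
    using floorlog_bounds[of "nat \<bar>k\<bar>" 2] by (cases "k = 0") (auto simp: floorlog_def)
  also have "(2::nat) ^ floorlog 2 (nat \<bar>k\<bar>) \<le> 2 ^ bit_length k"
    by (rule power_increasing) (auto simp: bit_length_def)
  finally have "nat \<bar>k\<bar> \<le> 2 ^ bit_length k" by simp
  then show ?thesis by (simp add: nat_le_iff)
qed

lemma bit_length_le:
  assumes "\<bar>k\<bar> \<le> 2 ^ E"
  shows "bit_length k \<le> E + 2"
proof -
  have "nat \<bar>k\<bar> \<le> 2 ^ E" using assms by (simp add: nat_le_iff)
  then have "nat \<bar>k\<bar> < 2 ^ (E + 1)" by (rule le_less_trans) simp
  then have "floorlog 2 (nat \<bar>k\<bar>) \<le> E + 1" by (intro floorlog_leI) auto
  then show ?thesis by (simp add: bit_length_def)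
qed

lemma bit_length_pos: "1 \<le> bit_length k"
  by (simp add: bit_length_def)

text \<open>
  A sum is at most one bit longer than its summands, and a product with a factor of at most \<open>N\<close> bits
  at most \<open>N\<close> bits longer than the other factor.
\<close>
lemma abs_aval_le:
  assumes "bounded_memory B s" "small_factors N e s"
  shows "\<bar>aval e s\<bar> \<le> 2 ^ (B + asize e * (N + 1))"
proof -
  have sum_le: "\<bar>x\<bar> + \<bar>y\<bar> \<le> 2 ^ (B + Suc (i + j) * (N + 1))"
    if "\<bar>x\<bar> \<le> 2 ^ (B + i * (N + 1))" "\<bar>y\<bar> \<le> 2 ^ (B + j * (N + 1))" for x y :: int and i j
  proof -
    let ?E = "B + (i + j) * (N + 1)"
    have "\<bar>x\<bar> + \<bar>y\<bar> \<le> 2 ^ ?E + 2 ^ ?E"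
      by (rule order_trans[OF add_mono[OF that]])
        (intro add_mono power_increasing mult_le_mono1; simp)
    also have "\<dots> = 2 ^ (?E + 1)" by simp
    also have "\<dots> \<le> 2 ^ (B + Suc (i + j) * (N + 1))" by (rule power_increasing) auto
    finally show ?thesis .
  qed
  show ?thesis
    using assms(2)
  proof (induction e)
    case (Const c)
    have "\<bar>c\<bar> \<le> 2 ^ bit_length c" by (rule abs_le_bit_length)
    also have "\<dots> \<le> 2 ^ (B + bit_length c * (N + 1))" by (rule power_increasing) auto
    finally show ?case by simp
  next
    case (Load a)
    have "\<bar>s (aval a s)\<bar> \<le> 2 ^ B" using assms(1) by (simp add: bounded_memory_def)
    also have "\<dots> \<le> 2 ^ (B + asize (Load a) * (N + 1))" by (rule power_increasing) auto
    finally show ?case by simp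
  next
    case (Add a b)
    then show ?case using sum_le[of "aval a s" "asize a" "aval b s" "asize b"]
        abs_triangle_ineq[of "aval a s" "aval b s"]
      by (simp del: power_Suc mult_Suc)
  next
    case (Sub a b)
    then show ?case using sum_le[of "aval a s" "asize a" "aval b s" "asize b"]
        abs_triangle_ineq4[of "aval a s" "aval b s"]
      by (simp del: power_Suc mult_Suc)
  next
    case (Mul a b)
    have "\<bar>aval a s\<bar> * \<bar>aval b s\<bar> \<le> 2 ^ (B + asize a * (N + 1)) * 2 ^ N"
      using Mul by (intro mult_mono) auto
    also have "\<dots> = 2 ^ (B + asize a * (N + 1) + N)" by (simp add: power_add)
    also have "\<dots> \<le> 2 ^ (B + asize (Mul a b) * (N + 1))"
      by (rule power_increasing) (simp_all add: add_mult_distrib)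
    finally show ?case by (simp add: abs_mult)
  qed
qed

lemma cost_le:
  assumes "bounded_memory B s" "small_factors N e s" "asize e \<le> A"
  shows "cost e s \<le> asize e * (B + A * (N + 1) + 2)"
proof -
  have bl: "bit_length (aval e s) \<le> B + A * (N + 1) + 2" if "small_factors N e s" "asize e \<le> A" for e
  proof -
    have "\<bar>aval e s\<bar> \<le> 2 ^ (B + asize e * (N + 1))" by (rule abs_aval_le[OF assms(1) that(1)])
    then have "bit_length (aval e s) \<le> B + asize e * (N + 1) + 2" by (rule bit_length_le)
    also have "\<dots> \<le> B + A * (N + 1) + 2" using that(2) by (simp del: mult_Suc_right)
    finally show ?thesis .
  qed
  show ?thesis
    using assms(2,3)
  proof (induction e)
    case (Const c)
    then show ?case by simp
  next
    case (Load a)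
    then show ?case using bl[of "Load a"] by (simp add: algebra_simps)
  next
    case (Add a b)
    then show ?case using bl[of "Add a b"] by (simp add: algebra_simps)
  next
    case (Sub a b)
    then show ?case using bl[of "Sub a b"] by (simp add: algebra_simps)
  next
    case (Mul a b)
    then show ?case using bl[of "Mul a b"] by (simp add: algebra_simps)
  qed
qed

lemma cost_le_square:
  assumes "bounded_memory B s" "small_factors N e s" "asize e + 2 \<le> k"
  shows "cost e s \<le> asize e * (B + k * (N + 1))"
proof -
  have "asize e * (N + 1) + 2 \<le> (asize e + 2) * (N + 1)" by simp
  also have "\<dots> \<le> k * (N + 1)" using assms(3) by (rule mult_le_mono1)
  finally have "B + asize e * (N + 1) + 2 \<le> B + k * (N + 1)" by simp
  then have "asize e * (B + asize e * (N + 1) + 2) \<le> asize e * (B + k * (N + 1))"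
    by (rule mult_le_mono2)
  with cost_le[OF assms(1,2) le_refl] show ?thesis by (rule order_trans)
qed

lemma bounded_memory_mono: "bounded_memory B s \<Longrightarrow> B \<le> B' \<Longrightarrow> bounded_memory B' s"
  unfolding bounded_memory_def using power_increasing[of B B' "2::int"] by (meson one_le_numeral order_trans)

lemma runs_mono:
  assumes "runs N k c s s'" "k \<le> k'"
  shows "runs N k' c s s'"
  unfolding runs_def
proof (intro allI impI)
  fix B assume "bounded_memory B s"
  then obtain t where t: "exec c s t s'" "t \<le> k * (B + k * (N + 1))" "bounded_memory (B + k * (N + 1)) s'"
    using assms(1) unfolding runs_def by blast
  have "k * (B + k * (N + 1)) \<le> k' * (B + k' * (N + 1))"
    by (intro mult_le_mono add_le_mono assms(2)) auto
  moreover have "B + k * (N + 1) \<le> B + k' * (N + 1)" using assms(2) by (simp del: mult_Suc_right)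
  ultimately show "\<exists>t. exec c s t s' \<and> t \<le> k' * (B + k' * (N + 1)) \<and> bounded_memory (B + k' * (N + 1)) s'"
    using t bounded_memory_mono order_trans by blast
qed

lemma runs_Store:
  assumes "small_factors N a s" "small_factors N e s" "asize a + asize e + 2 \<le> k"
  shows "runs N k (Store a e) s (s(aval a s := aval e s))"
  unfolding runs_def
proof (intro allI impI)
  fix B assume B: "bounded_memory B s"
  have "cost a s + cost e s \<le> asize a * (B + k * (N + 1)) + asize e * (B + k * (N + 1))"
    by (intro add_mono cost_le_square B assms(1,2)) (use assms(3) in auto)
  also have "\<dots> = (asize a + asize e) * (B + k * (N + 1))" by (simp only: add_mult_distrib)
  also have "\<dots> \<le> k * (B + k * (N + 1))" by (rule mult_le_mono1) (use assms(3) in simp)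
  finally have c: "cost a s + cost e s \<le> k * (B + k * (N + 1))" .
  have "\<bar>aval e s\<bar> \<le> 2 ^ (B + asize e * (N + 1))" by (rule abs_aval_le[OF B assms(2)])
  also have "\<dots> \<le> 2 ^ (B + k * (N + 1))"
    by (intro power_increasing add_left_mono mult_le_mono1) (use assms(3) in auto)
  finally have "bounded_memory (B + k * (N + 1)) (s(aval a s := aval e s))"
    using bounded_memory_mono[OF B, of "B + k * (N + 1)"] by (simp add: bounded_memory_def)
  then show "\<exists>t. exec (Store a e) s t (s(aval a s := aval e s)) \<and> t \<le> k * (B + k * (N + 1))
      \<and> bounded_memory (B + k * (N + 1)) (s(aval a s := aval e s))"
    using exec.Store c by blast
qed

lemma runs_Seq:
  assumes "runs N k1 c1 s s1" "runs N k2 c2 s1 s2"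
  shows "runs N (k1 + k2) (Seq c1 c2) s s2"
  unfolding runs_def
proof (intro allI impI)
  fix B assume "bounded_memory B s"
  then obtain t1 where t1: "exec c1 s t1 s1" "t1 \<le> k1 * (B + k1 * (N + 1))"
      "bounded_memory (B + k1 * (N + 1)) s1"
    using assms(1) unfolding runs_def by blast
  then obtain t2 where t2: "exec c2 s1 t2 s2" "t2 \<le> k2 * (B + k1 * (N + 1) + k2 * (N + 1))"
      "bounded_memory (B + k1 * (N + 1) + k2 * (N + 1)) s2"
    using assms(2) unfolding runs_def by blast
  have e: "B + k1 * (N + 1) + k2 * (N + 1) = B + (k1 + k2) * (N + 1)" by (simp only: add_mult_distrib add.assoc)
  have "t1 \<le> k1 * (B + (k1 + k2) * (N + 1))"
    using t1(2) by (rule order_trans) (intro mult_le_mono2 add_left_mono mult_le_mono1, simp)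
  then have "t1 + t2 \<le> k1 * (B + (k1 + k2) * (N + 1)) + k2 * (B + (k1 + k2) * (N + 1))"
    using t2(2) unfolding e by (rule add_mono)
  then have "t1 + t2 \<le> (k1 + k2) * (B + (k1 + k2) * (N + 1))" by (simp only: add_mult_distrib)
  then show "\<exists>t. exec (Seq c1 c2) s t s2 \<and> t \<le> (k1 + k2) * (B + (k1 + k2) * (N + 1))
      \<and> bounded_memory (B + (k1 + k2) * (N + 1)) s2"
    using exec.Seq[OF t1(1) t2(1)] t2(3) unfolding e by blast
qed

text \<open>Testing a condition adds its own steps to those of the branch or loop body taken.\<close>

lemma runs_test:
  assumes "small_factors N e s" "runs N k c s s'"
    and "\<And>t. exec c s t s' \<Longrightarrow> exec c' s (cost e s + t) s'"
  shows "runs N (asize e + 2 + k) c' s s'"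
  unfolding runs_def
proof (intro allI impI)
  let ?k = "asize e + 2 + k"
  fix B assume B: "bounded_memory B s"
  then obtain t where t: "exec c s t s'" "t \<le> k * (B + k * (N + 1))" "bounded_memory (B + k * (N + 1)) s'"
    using assms(2) unfolding runs_def by blast
  have "cost e s \<le> asize e * (B + ?k * (N + 1))"
    by (rule cost_le_square[OF B assms(1)]) simp
  moreover have "t \<le> k * (B + ?k * (N + 1))"
    using t(2) by (rule order_trans) (intro mult_le_mono2 add_left_mono mult_le_mono1, simp)
  ultimately have "cost e s + t \<le> asize e * (B + ?k * (N + 1)) + k * (B + ?k * (N + 1))"
    by (rule add_mono)
  also have "\<dots> = (asize e + k) * (B + ?k * (N + 1))" by (simp only: add_mult_distrib)
  also have "\<dots> \<le> ?k * (B + ?k * (N + 1))" by (rule mult_le_mono1) simp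
  finally have "cost e s + t \<le> ?k * (B + ?k * (N + 1))" .
  moreover have "bounded_memory (B + ?k * (N + 1)) s'"
    by (rule bounded_memory_mono[OF t(3)]) (intro add_left_mono mult_le_mono1, simp)
  ultimately show "\<exists>t. exec c' s t s' \<and> t \<le> ?k * (B + ?k * (N + 1)) \<and> bounded_memory (B + ?k * (N + 1)) s'"
    using assms(3)[OF t(1)] by blast
qed

lemma runs_If_pos:
  assumes "small_factors N e s"
    and "aval e s > 0 \<Longrightarrow> runs N k1 c1 s s'" "\<not> aval e s > 0 \<Longrightarrow> runs N k2 c2 s s'"
  shows "runs N (asize e + 2 + (k1 + k2)) (If_pos e c1 c2) s s'"
proof (cases "aval e s > 0")
  case True
  have "runs N (k1 + k2) c1 s s'" by (rule runs_mono[OF assms(2)[OF True]]) simp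
  then show ?thesis by (rule runs_test[OF assms(1)]) (rule exec.If_true[OF True])
next
  case False
  have "runs N (k1 + k2) c2 s s'" by (rule runs_mono[OF assms(3)[OF False]]) simp
  then show ?thesis by (rule runs_test[OF assms(1)]) (rule exec.If_false[OF False])
qed

lemma runs_store_if_nonneg:
  assumes "0 \<le> s (reg_addr i) \<Longrightarrow> small_factors N x s \<and> aval x s = v"
    and "\<not> 0 \<le> s (reg_addr i) \<Longrightarrow> v = 0"
  shows "runs N (asize (Add (get i) (Const 1)) + 2 +
      ((asize (reg r) + asize x + 2) + (asize (reg r) + asize (Const 0) + 2)))
    (store_if_nonneg r i x) s (s(reg_addr r := v))"
proof (rule runs_If_pos)
  assume "aval (Add (get i) (Const 1)) s > 0"
  then have "small_factors N x s" "aval x s = v" using assms(1) by auto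
  then show "runs N (asize (reg r) + asize x + 2) (Store (reg r) x) s (s(reg_addr r := v))"
    using runs_Store[of N "reg r" s x] by simp
next
  assume "\<not> aval (Add (get i) (Const 1)) s > 0"
  then have v: "v = 0" using assms(2) by simp
  show "runs N (asize (reg r) + asize (Const 0) + 2) (Store (reg r) (Const 0)) s (s(reg_addr r := v))"
    unfolding v using runs_Store[of N "reg r" s "Const 0"] by simp
qed simp

text \<open>
  The invariant carries the number of iterations made so far, so that the rule yields both the final
  state and the number of steps.
\<close>
lemma runs_While_pos:
  assumes body: "\<And>i s. i < M \<Longrightarrow> Inv i s \<Longrightarrow>
      aval e s > 0 \<and> small_factors N e s \<and> (\<exists>s'. runs N k c s s' \<and> Inv (Suc i) s')"
    and exit: "\<And>s. Inv M s \<Longrightarrow> \<not> aval e s > 0 \<and> small_factors N e s"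
    and "Inv 0 s"
  shows "\<exists>s'. runs N (M * (asize e + 2 + k) + (asize e + 2)) (While_pos e c) s s' \<and> Inv M s'"
proof -
  have "\<exists>s'. runs N (j * (asize e + 2 + k) + (asize e + 2)) (While_pos e c) s s' \<and> Inv M s'"
    if "Inv i s" "i + j = M" for i j s
    using that
  proof (induction j arbitrary: i s)
    case 0
    then have ex: "\<not> aval e s > 0" "small_factors N e s" using exit by auto
    have "runs N (asize e + 2) (While_pos e c) s s"
      unfolding runs_def
    proof (intro allI impI)
      let ?k = "asize e + 2"
      fix B assume B: "bounded_memory B s"
      have "cost e s \<le> asize e * (B + ?k * (N + 1))" by (rule cost_le_square[OF B ex(2)]) simp
      also have "\<dots> \<le> ?k * (B + ?k * (N + 1))" by (rule mult_le_mono1) simp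
      finally show "\<exists>t. exec (While_pos e c) s t s \<and> t \<le> ?k * (B + ?k * (N + 1))
          \<and> bounded_memory (B + ?k * (N + 1)) s"
        using exec.While_false[OF ex(1)] bounded_memory_mono[OF B, of "B + ?k * (N + 1)"] by auto
    qed
    then show ?case using 0 by auto
  next
    case (Suc j)
    then have "i < M" by simp
    from body[OF this Suc.prems(1)] obtain s1 where
      ex: "aval e s > 0" "small_factors N e s" and s1: "runs N k c s s1" "Inv (Suc i) s1" by blast
    obtain s2 where s2: "runs N (j * (asize e + 2 + k) + (asize e + 2)) (While_pos e c) s1 s2" "Inv M s2"
      using Suc.IH[OF s1(2)] Suc.prems(2) by auto
    let ?K = "k + (j * (asize e + 2 + k) + (asize e + 2))"
    have "runs N ?K (Seq c (While_pos e c)) s s2" by (rule runs_Seq[OF s1(1) s2(1)])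
    then have "runs N (asize e + 2 + ?K) (While_pos e c) s s2"
    proof (rule runs_test[OF ex(2)])
      fix t assume "exec (Seq c (While_pos e c)) s t s2"
      then show "exec (While_pos e c) s (cost e s + t) s2"
        by cases (use exec.While_true[OF ex(1)] in \<open>auto simp: add.assoc\<close>)
    qed
    then show ?case using s2(2) by (auto simp: algebra_simps)
  qed
  then show ?thesis using assms(3) by auto
qed

section \<open>Correctness of the compiler\<close>

definition polynomial_bound :: "(nat \<Rightarrow> nat) \<Rightarrow> bool" where
  "polynomial_bound q \<longleftrightarrow> (\<exists>a d. \<forall>x. q x \<le> a * x ^ d + a)"

lemma polynomial_bound_const: "polynomial_bound (\<lambda>x. c)"
  unfolding polynomial_bound_def by (intro exI[of _ c] exI[of _ 0]) simp

lemma polynomial_bound_id: "polynomial_bound (\<lambda>x. x)"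
  unfolding polynomial_bound_def by (intro exI[of _ 1]) simp

lemma power_le_power_add: "(x :: nat) ^ d \<le> x ^ (d + e) + 1"
proof (cases "x = 0")
  case False
  then have "x ^ d \<le> x ^ (d + e)" by (intro power_increasing) auto
  then show ?thesis by simp
qed (auto simp: power_0_left)

lemma polynomial_bound_add:
  assumes "polynomial_bound p" "polynomial_bound q"
  shows "polynomial_bound (\<lambda>x. p x + q x)"
proof -
  obtain a d b e where p: "\<And>x. p x \<le> a * x ^ d + a" and q: "\<And>x. q x \<le> b * x ^ e + b"
    using assms unfolding polynomial_bound_def by blast
  have "p x + q x \<le> (2 * a + 2 * b) * x ^ (d + e) + (2 * a + 2 * b)" for x
  proof -
    have "a * x ^ d \<le> a * (x ^ (d + e) + 1)" "b * x ^ e \<le> b * (x ^ (d + e) + 1)"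
      using power_le_power_add[of x d e] power_le_power_add[of x e d]
      by (intro mult_le_mono2; simp add: add.commute)+
    then show ?thesis using p[of x] q[of x] by (simp add: algebra_simps)
  qed
  then show ?thesis unfolding polynomial_bound_def by blast
qed

lemma polynomial_bound_mult:
  assumes "polynomial_bound p" "polynomial_bound q"
  shows "polynomial_bound (\<lambda>x. p x * q x)"
proof -
  obtain a d b e where p: "\<And>x. p x \<le> a * x ^ d + a" and q: "\<And>x. q x \<le> b * x ^ e + b"
    using assms unfolding polynomial_bound_def by blast
  have "p x * q x \<le> (3 * (a * b)) * x ^ (d + e) + 3 * (a * b)" for x
  proof -
    have "p x * q x \<le> (a * x ^ d + a) * (b * x ^ e + b)" using p q by (intro mult_le_mono)
    also have "\<dots> = (a * b) * (x ^ (d + e) + x ^ d + x ^ e + 1)" by (simp add: algebra_simps power_add)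
    also have "\<dots> \<le> (a * b) * (3 * x ^ (d + e) + 3)"
      using power_le_power_add[of x d e] power_le_power_add[of x e d]
      by (intro mult_le_mono2) (simp add: add.commute)
    finally show ?thesis by (simp add: algebra_simps)
  qed
  then show ?thesis unfolding polynomial_bound_def by blast
qed

lemmas polynomial_bound_intros =
  polynomial_bound_const polynomial_bound_id polynomial_bound_add polynomial_bound_mult

definition input_bounded :: "nat \<Rightarrow> memory \<Rightarrow> bool" where
  "input_bounded N inp \<longleftrightarrow> (\<forall>a\<ge>0. \<bar>inp a\<bar> \<le> 2 ^ N) \<and> 0 \<le> inp 0 \<and> inp 0 \<le> int N"

definition unchanged_below :: "nat \<Rightarrow> memory \<Rightarrow> memory \<Rightarrow> bool" where
  "unchanged_below r s s' \<longleftrightarrow> (\<forall>a. (\<forall>r'\<ge>r. a \<noteq> reg_addr r') \<longrightarrow> s' a = s a)"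

lemma reg_addr_simps [simp]:
  "reg_addr r = reg_addr r' \<longleftrightarrow> r = r'" "reg_addr r < 0" "\<not> 0 \<le> reg_addr r"
  by (auto simp: reg_addr_def)

lemma unchanged_refl: "unchanged_below r s s"
  by (simp add: unchanged_below_def)

lemma unchanged_trans:
  "unchanged_below r s s' \<Longrightarrow> unchanged_below r' s' s'' \<Longrightarrow> r \<le> r' \<Longrightarrow> unchanged_below r s s''"
  unfolding unchanged_below_def by (metis order_trans)

lemma unchanged_upd: "unchanged_below r s s' \<Longrightarrow> r \<le> r' \<Longrightarrow> unchanged_below r s (s'(reg_addr r' := v))"
  unfolding unchanged_below_def by auto

lemma unchanged_nonneg: "unchanged_below r s s' \<Longrightarrow> 0 \<le> a \<Longrightarrow> s' a = s a"
  unfolding unchanged_below_def by (metis reg_addr_simps(3))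

lemma unchanged_reg: "unchanged_below r s s' \<Longrightarrow> r' < r \<Longrightarrow> s' (reg_addr r') = s (reg_addr r')"
  unfolding unchanged_below_def by (metis reg_addr_simps(1) not_le)

definition represents :: "memory \<Rightarrow> ('v \<Rightarrow> int) \<Rightarrow> ('v \<Rightarrow> nat) \<Rightarrow> nat \<Rightarrow> memory \<Rightarrow> bool" where
  "represents inp env \<rho> r s \<longleftrightarrow> (\<forall>a\<ge>0. s a = inp a) \<and> (\<forall>v. \<rho> v < r \<and> s (reg_addr (\<rho> v)) = env v)"

lemma represents_unchanged:
  "represents inp env \<rho> r s \<Longrightarrow> unchanged_below r s s' \<Longrightarrow> represents inp env \<rho> r s'"
  unfolding represents_def by (metis unchanged_nonneg unchanged_reg)

lemma represents_Suc: "represents inp env \<rho> r s \<Longrightarrow> represents inp env \<rho> (Suc r) s"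
  unfolding represents_def using less_SucI by blast

lemma represents_bind:
  "represents inp env \<rho> r s \<Longrightarrow> represents inp (env(v := s (reg_addr r))) (\<rho>(v := r)) (Suc r) s"
  unfolding represents_def by (auto intro: less_SucI)

definition computes :: "nat \<Rightarrow> nat \<Rightarrow> memory \<Rightarrow> com \<Rightarrow> ('v \<Rightarrow> int) \<Rightarrow> ('v \<Rightarrow> nat) \<Rightarrow> nat \<Rightarrow> int \<Rightarrow> bool" where
  "computes N k inp c env \<rho> r v \<longleftrightarrow> (\<forall>s. represents inp env \<rho> r s \<longrightarrow>
     (\<exists>s'. runs N k c s s' \<and> unchanged_below r s s' \<and> s' (reg_addr r) = v))"

lemma computesD:
  assumes "computes N k inp c env \<rho> r v" "represents inp env \<rho> r s"
  obtains s' where "runs N k c s s'" "unchanged_below r s s'" "s' (reg_addr r) = v"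
    "represents inp env \<rho> r s'"
  using assms represents_unchanged unfolding computes_def by blast

definition poly_computes :: "com \<Rightarrow> 'v ex \<Rightarrow> ('v \<Rightarrow> nat) \<Rightarrow> nat \<Rightarrow> bool" where
  "poly_computes c e \<rho> r \<longleftrightarrow> (\<exists>q. polynomial_bound q \<and>
     (\<forall>N inp env. input_bounded N inp \<longrightarrow> computes N (q N) inp c env \<rho> r (eval_ex inp e env)))"

lemma poly_computesI:
  assumes "polynomial_bound q"
    and "\<And>N inp env s. input_bounded N inp \<Longrightarrow> represents inp env \<rho> r s \<Longrightarrow>
      \<exists>s'. runs N (q N) c s s' \<and> unchanged_below r s s' \<and> s' (reg_addr r) = eval_ex inp e env"
  shows "poly_computes c e \<rho> r"
  using assms unfolding poly_computes_def computes_def by blast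

lemma poly_computesE:
  assumes "poly_computes c e \<rho> r"
  obtains q where "polynomial_bound q"
    "\<forall>N inp env. input_bounded N inp \<longrightarrow> computes N (q N) inp c env \<rho> r (eval_ex inp e env)"
proof -
  obtain q where "polynomial_bound q \<and> (\<forall>N inp env. input_bounded N inp \<longrightarrow>
      computes N (q N) inp c env \<rho> r (eval_ex inp e env))"
    using assms unfolding poly_computes_def by (elim exE)
  then show ?thesis by (intro that[of q]) auto
qed

text \<open>
  The first operand survives the evaluation of the second one, which touches only higher registers.
\<close>
lemma poly_computes_binary:
  assumes a: "poly_computes c1 a \<rho> r" and b: "poly_computes c2 b \<rho> (Suc r)"
    and c: "\<And>N inp env s. input_bounded N inp \<Longrightarrow> \<forall>a\<ge>0. s a = inp a \<Longrightarrow>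
      s (reg_addr r) = eval_ex inp a env \<Longrightarrow> s (reg_addr (Suc r)) = eval_ex inp b env \<Longrightarrow>
      runs N k c s (s(reg_addr r := eval_ex inp e env))"
  shows "poly_computes (Seq c1 (Seq c2 c)) e \<rho> r"
proof -
  obtain q where q: "polynomial_bound q"
    "\<forall>N inp env. input_bounded N inp \<longrightarrow> computes N (q N) inp c1 env \<rho> r (eval_ex inp a env)"
    using a by (rule poly_computesE)
  obtain q' where q': "polynomial_bound q'"
    "\<forall>N inp env. input_bounded N inp \<longrightarrow> computes N (q' N) inp c2 env \<rho> (Suc r) (eval_ex inp b env)"
    using b by (rule poly_computesE)
  show ?thesis
  proof (rule poly_computesI)
    show "polynomial_bound (\<lambda>N. q N + (q' N + k))" by (intro polynomial_bound_intros q(1) q'(1))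
    fix N inp env s assume inp: "input_bounded N inp" and rep: "represents inp env \<rho> r s"
    obtain s1 where s1: "runs N (q N) c1 s s1" "unchanged_below r s s1"
        "s1 (reg_addr r) = eval_ex inp a env" "represents inp env \<rho> r s1"
      by (rule computesD[OF q(2)[rule_format, OF inp] rep])
    obtain s2 where s2: "runs N (q' N) c2 s1 s2" "unchanged_below (Suc r) s1 s2"
        "s2 (reg_addr (Suc r)) = eval_ex inp b env" "represents inp env \<rho> (Suc r) s2"
      by (rule computesD[OF q'(2)[rule_format, OF inp] represents_Suc[OF s1(4)]])
    have "\<forall>a\<ge>0. s2 a = inp a" using s2(4) by (simp add: represents_def)
    moreover have "s2 (reg_addr r) = eval_ex inp a env"
      using unchanged_reg[OF s2(2), of r] s1(3) by simp
    ultimately have "runs N k c s2 (s2(reg_addr r := eval_ex inp e env))" using s2(3) by (intro c inp)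
    from runs_Seq[OF s1(1) runs_Seq[OF s2(1) this]]
    show "\<exists>s'. runs N (q N + (q' N + k)) (Seq c1 (Seq c2 c)) s s'
        \<and> unchanged_below r s s' \<and> s' (reg_addr r) = eval_ex inp e env"
      using unchanged_upd[OF unchanged_trans[OF s1(2) s2(2)], of r] by auto
  qed
qed

text \<open>
  The number of steps is a polynomial in the size \<open>N\<close> of the input alone. In particular it does not
  depend on the values computed, because every loop has at most \<open>N\<close> iterations.
\<close>
theorem compile_correct: "poly_computes (compile e \<rho> r) e \<rho> r"
proof (induction e arbitrary: \<rho> r)
  case (Num c)
  show ?case
  proof (rule poly_computesI)
    fix N inp env s assume "represents inp env \<rho> r s"
    have "runs N (asize (reg r) + asize (Const c) + 2) (Store (reg r) (Const c)) s (s(reg_addr r := c))"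
      using runs_Store[of N "reg r" s "Const c"] by simp
    then show "\<exists>s'. runs N (asize (reg r) + asize (Const c) + 2) (compile (Num c) \<rho> r) s s'
        \<and> unchanged_below r s s' \<and> s' (reg_addr r) = eval_ex inp (Num c) env"
      using unchanged_upd[OF unchanged_refl, of r r s c] by auto
  qed (rule polynomial_bound_const)
next
  case (Var v)
  show ?case
  proof (rule poly_computesI)
    fix N inp env s assume rep: "represents inp env \<rho> r s"
    have "runs N (asize (reg r) + asize (get (\<rho> v)) + 2) (Store (reg r) (get (\<rho> v))) s
        (s(reg_addr r := s (reg_addr (\<rho> v))))"
      using runs_Store[of N "reg r" s "get (\<rho> v)"] by simp
    then show "\<exists>s'. runs N (asize (reg r) + asize (get (\<rho> v)) + 2) (compile (Var v) \<rho> r) s s'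
        \<and> unchanged_below r s s' \<and> s' (reg_addr r) = eval_ex inp (Var v) env"
      using unchanged_upd[OF unchanged_refl, of r r s] rep by (auto simp: represents_def)
  qed (rule polynomial_bound_const)
next
  case (Inp e)
  obtain q where q: "polynomial_bound q"
    "\<forall>N inp env. input_bounded N inp \<longrightarrow> computes N (q N) inp (compile e \<rho> r) env \<rho> r (eval_ex inp e env)"
    using Inp.IH[of \<rho> r] by (rule poly_computesE)
  let ?k = "asize (Add (get r) (Const 1)) + 2 +
    ((asize (reg r) + asize (Load (get r)) + 2) + (asize (reg r) + asize (Const 0) + 2))"
  show ?case
  proof (rule poly_computesI)
    show "polynomial_bound (\<lambda>N. q N + ?k)" by (intro polynomial_bound_intros q(1))
    fix N inp env s assume inp: "input_bounded N inp" and rep: "represents inp env \<rho> r s"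
    obtain s1 where s1: "runs N (q N) (compile e \<rho> r) s s1" "unchanged_below r s s1"
        "s1 (reg_addr r) = eval_ex inp e env" "represents inp env \<rho> r s1"
      by (rule computesD[OF q(2)[rule_format, OF inp] rep])
    let ?v = "eval_ex inp (Inp e) env"
    have "runs N ?k (store_if_nonneg r r (Load (get r))) s1 (s1(reg_addr r := ?v))"
      by (rule runs_store_if_nonneg) (use s1 in \<open>auto simp: input_at_def represents_def\<close>)
    from runs_Seq[OF s1(1) this]
    show "\<exists>s'. runs N (q N + ?k) (compile (Inp e) \<rho> r) s s'
        \<and> unchanged_below r s s' \<and> s' (reg_addr r) = eval_ex inp (Inp e) env"
      using unchanged_upd[OF s1(2), of r ?v] by (auto simp del: eval_ex.simps)
  qed
next
  case (Plus a b)
  show ?case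
    unfolding compile.simps
  proof (rule poly_computes_binary[OF Plus.IH])
    fix N inp env s
    assume "s (reg_addr r) = eval_ex inp a env" "s (reg_addr (Suc r)) = eval_ex inp b env"
    then show "runs N (asize (reg r) + asize (Add (get r) (get (Suc r))) + 2)
        (Store (reg r) (Add (get r) (get (Suc r)))) s (s(reg_addr r := eval_ex inp (Plus a b) env))"
      using runs_Store[of N "reg r" s "Add (get r) (get (Suc r))"] by simp
  qed
next
  case (Minus a b)
  show ?case
    unfolding compile.simps
  proof (rule poly_computes_binary[OF Minus.IH])
    fix N inp env s
    assume "s (reg_addr r) = eval_ex inp a env" "s (reg_addr (Suc r)) = eval_ex inp b env"
    then show "runs N (asize (reg r) + asize (Sub (get r) (get (Suc r))) + 2)
        (Store (reg r) (Sub (get r) (get (Suc r)))) s (s(reg_addr r := eval_ex inp (Minus a b) env))"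
      using runs_Store[of N "reg r" s "Sub (get r) (get (Suc r))"] by simp
  qed
next
  case (Scale a b)
  show ?case
    unfolding compile.simps
    by (rule poly_computes_binary[OF Scale.IH], rule runs_store_if_nonneg)
      (auto simp: input_at_def input_bounded_def)
next
  case (Cond c a b)
  obtain q where q: "polynomial_bound q"
    "\<forall>N inp env. input_bounded N inp \<longrightarrow> computes N (q N) inp (compile c \<rho> r) env \<rho> r (eval_ex inp c env)"
    using Cond.IH(1)[of \<rho> r] by (rule poly_computesE)
  obtain q1 where q1: "polynomial_bound q1"
    "\<forall>N inp env. input_bounded N inp \<longrightarrow> computes N (q1 N) inp (compile a \<rho> r) env \<rho> r (eval_ex inp a env)"
    using Cond.IH(2)[of \<rho> r] by (rule poly_computesE)
  obtain q2 where q2: "polynomial_bound q2"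
    "\<forall>N inp env. input_bounded N inp \<longrightarrow> computes N (q2 N) inp (compile b \<rho> r) env \<rho> r (eval_ex inp b env)"
    using Cond.IH(3)[of \<rho> r] by (rule poly_computesE)
  show ?case
  proof (rule poly_computesI)
    show "polynomial_bound (\<lambda>N. q N + (asize (get r) + 2 + (q1 N + q2 N)))"
      by (intro polynomial_bound_intros q(1) q1(1) q2(1))
    fix N inp env s assume inp: "input_bounded N inp" and rep: "represents inp env \<rho> r s"
    obtain s1 where s1: "runs N (q N) (compile c \<rho> r) s s1" "unchanged_below r s s1"
        "s1 (reg_addr r) = eval_ex inp c env" "represents inp env \<rho> r s1"
      by (rule computesD[OF q(2)[rule_format, OF inp] rep])
    obtain sa where sa: "runs N (q1 N) (compile a \<rho> r) s1 sa" "unchanged_below r s1 sa"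
        "sa (reg_addr r) = eval_ex inp a env"
      by (rule computesD[OF q1(2)[rule_format, OF inp] s1(4)])
    obtain sb where sb: "runs N (q2 N) (compile b \<rho> r) s1 sb" "unchanged_below r s1 sb"
        "sb (reg_addr r) = eval_ex inp b env"
      by (rule computesD[OF q2(2)[rule_format, OF inp] s1(4)])
    let ?s = "if eval_ex inp c env > 0 then sa else sb"
    have "runs N (asize (get r) + 2 + (q1 N + q2 N)) (If_pos (get r) (compile a \<rho> r) (compile b \<rho> r)) s1 ?s"
      by (rule runs_If_pos) (use s1(3) sa(1) sb(1) in auto)
    from runs_Seq[OF s1(1) this]
    show "\<exists>s'. runs N (q N + (asize (get r) + 2 + (q1 N + q2 N))) (compile (Cond c a b) \<rho> r) s s'
        \<and> unchanged_below r s s' \<and> s' (reg_addr r) = eval_ex inp (Cond c a b) env"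
      using unchanged_trans[OF s1(2) sa(2)] unchanged_trans[OF s1(2) sb(2)] sa(3) sb(3)
      by (intro exI[of _ ?s]) auto
  qed
next
  case (Bind v a b)
  obtain q where q: "polynomial_bound q"
    "\<forall>N inp env. input_bounded N inp \<longrightarrow> computes N (q N) inp (compile a \<rho> r) env \<rho> r (eval_ex inp a env)"
    using Bind.IH(1)[of \<rho> r] by (rule poly_computesE)
  let ?\<rho> = "\<rho>(v := r)"
  obtain q' where q': "polynomial_bound q'"
    "\<forall>N inp env. input_bounded N inp \<longrightarrow> computes N (q' N) inp (compile b ?\<rho> (Suc r)) env ?\<rho> (Suc r) (eval_ex inp b env)"
    using Bind.IH(2)[of ?\<rho> "Suc r"] by (rule poly_computesE)
  let ?k = "asize (reg r) + asize (get (Suc r)) + 2"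
  show ?case
  proof (rule poly_computesI)
    show "polynomial_bound (\<lambda>N. q N + (q' N + ?k))" by (intro polynomial_bound_intros q(1) q'(1))
    fix N inp env s assume inp: "input_bounded N inp" and rep: "represents inp env \<rho> r s"
    obtain s1 where s1: "runs N (q N) (compile a \<rho> r) s s1" "unchanged_below r s s1"
        "s1 (reg_addr r) = eval_ex inp a env" "represents inp env \<rho> r s1"
      by (rule computesD[OF q(2)[rule_format, OF inp] rep])
    have "represents inp (env(v := eval_ex inp a env)) ?\<rho> (Suc r) s1"
      using represents_bind[OF s1(4), of v] s1(3) by simp
    from computesD[OF q'(2)[rule_format, OF inp] this] obtain s2 where
      s2: "runs N (q' N) (compile b ?\<rho> (Suc r)) s1 s2" "unchanged_below (Suc r) s1 s2"
        "s2 (reg_addr (Suc r)) = eval_ex inp (Bind v a b) env" by auto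
    have "runs N ?k (Store (reg r) (get (Suc r))) s2 (s2(reg_addr r := eval_ex inp (Bind v a b) env))"
      using runs_Store[of N "reg r" s2 "get (Suc r)"] s2(3) by simp
    from runs_Seq[OF s1(1) runs_Seq[OF s2(1) this]]
    show "\<exists>s'. runs N (q N + (q' N + ?k)) (compile (Bind v a b) \<rho> r) s s'
        \<and> unchanged_below r s s' \<and> s' (reg_addr r) = eval_ex inp (Bind v a b) env"
      using unchanged_upd[OF unchanged_trans[OF s1(2) s2(2)], of r] by (auto simp del: eval_ex.simps)
  qed
next
  case (Fold i a z f)
  obtain q where q: "polynomial_bound q"
    "\<forall>N inp env. input_bounded N inp \<longrightarrow> computes N (q N) inp (compile z \<rho> r) env \<rho> r (eval_ex inp z env)"
    using Fold.IH(1)[of \<rho> r] by (rule poly_computesE)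
  let ?\<rho> = "\<rho>(i := Suc r, a := r)"
  let ?R = "Suc (Suc r)"
  obtain q' where q': "polynomial_bound q'"
    "\<forall>N inp env. input_bounded N inp \<longrightarrow> computes N (q' N) inp (compile f ?\<rho> ?R) env ?\<rho> ?R (eval_ex inp f env)"
    using Fold.IH(2)[of ?\<rho> ?R] by (rule poly_computesE)
  let ?k0 = "asize (reg (Suc r)) + asize (Const 0) + 2"
  let ?t = "Sub (Load (Const 0)) (get (Suc r))"
  let ?k1 = "asize (reg r) + asize (get ?R) + 2"
  let ?k2 = "asize (reg (Suc r)) + asize (Add (get (Suc r)) (Const 1)) + 2"
  let ?body = "Seq (compile f ?\<rho> ?R) (Seq (Store (reg r) (get ?R))
    (Store (reg (Suc r)) (Add (get (Suc r)) (Const 1))))"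
  let ?kw = "\<lambda>N. N * (asize ?t + 2 + (q' N + (?k1 + ?k2))) + (asize ?t + 2)"
  show ?case
  proof (rule poly_computesI)
    show "polynomial_bound (\<lambda>N. q N + (?k0 + ?kw N))"
      by (intro polynomial_bound_intros q(1) q'(1))
    fix N inp env s assume inp: "input_bounded N inp" and rep: "represents inp env \<rho> r s"
    obtain s1 where s1: "runs N (q N) (compile z \<rho> r) s s1" "unchanged_below r s s1"
        "s1 (reg_addr r) = eval_ex inp z env" "represents inp env \<rho> r s1"
      by (rule computesD[OF q(2)[rule_format, OF inp] rep])
    let ?s2 = "s1(reg_addr (Suc r) := 0)"
    have s2: "runs N ?k0 (Store (reg (Suc r)) (Const 0)) s1 ?s2"
      using runs_Store[of N "reg (Suc r)" s1 "Const 0"] by simp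
    let ?it = "iterate (\<lambda>k acc. eval_ex inp f (env(i := int k, a := acc))) (eval_ex inp z env)"
    let ?M = "nat (inp 0)"
    define Inv where "Inv = (\<lambda>k s'. unchanged_below r s s' \<and> s' (reg_addr r) = ?it k
      \<and> s' (reg_addr (Suc r)) = int k)"
    have Inv0: "Inv 0 ?s2"
      using unchanged_upd[OF s1(2), of "Suc r" 0] s1(3) by (simp add: Inv_def)
    have test: "aval ?t s' = inp 0 - int k" if "Inv k s'" for k s'
      using that unchanged_nonneg[of r s s' 0] rep by (simp add: Inv_def represents_def)
    have M: "int ?M = inp 0" "?M \<le> N" using inp by (auto simp: input_bounded_def)
    have "\<exists>s'. runs N (?M * (asize ?t + 2 + (q' N + (?k1 + ?k2))) + (asize ?t + 2)) (While_pos ?t ?body) ?s2 s' \<and> Inv ?M s'"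
    proof (rule runs_While_pos[where Inv = Inv, OF _ _ Inv0])
      fix s' assume "Inv ?M s'"
      then show "\<not> aval ?t s' > 0 \<and> small_factors N ?t s'" using test[of ?M s'] M by simp
    next
      fix k s3 assume k: "k < ?M" and I: "Inv k s3"
      have "represents inp env \<rho> r s3" using represents_unchanged[OF rep] I by (simp add: Inv_def)
      then have "represents inp (env(i := int k, a := ?it k)) ?\<rho> ?R s3"
        using I by (auto simp: represents_def Inv_def intro: less_SucI)
      from computesD[OF q'(2)[rule_format, OF inp] this] obtain s4 where
        s4: "runs N (q' N) (compile f ?\<rho> ?R) s3 s4" "unchanged_below ?R s3 s4"
          "s4 (reg_addr ?R) = ?it (Suc k)" by auto
      let ?s5 = "s4(reg_addr r := ?it (Suc k))"
      have s5: "runs N ?k1 (Store (reg r) (get ?R)) s4 ?s5"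
        using runs_Store[of N "reg r" s4 "get ?R"] s4(3) by simp
      let ?s6 = "?s5(reg_addr (Suc r) := int (Suc k))"
      have cnt: "?s5 (reg_addr (Suc r)) = int k"
        using unchanged_reg[OF s4(2), of "Suc r"] I by (simp add: Inv_def)
      have s6: "runs N ?k2 (Store (reg (Suc r)) (Add (get (Suc r)) (Const 1))) ?s5 ?s6"
        using runs_Store[of N "reg (Suc r)" ?s5 "Add (get (Suc r)) (Const 1)"] cnt
        by (simp add: add.commute)
      have "unchanged_below r s s4" using unchanged_trans[OF _ s4(2)] I by (simp add: Inv_def)
      then have "Inv (Suc k) ?s6"
        by (simp add: Inv_def unchanged_upd del: iterate.simps)
      moreover have "aval ?t s3 > 0" using test[OF I] k M by linarith
      ultimately show "aval ?t s3 > 0 \<and> small_factors N ?t s3 \<and>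
          (\<exists>s'. runs N (q' N + (?k1 + ?k2)) ?body s3 s' \<and> Inv (Suc k) s')"
        using runs_Seq[OF s4(1) runs_Seq[OF s5 s6]] by auto
    qed
    then obtain s' where s': "runs N (?M * (asize ?t + 2 + (q' N + (?k1 + ?k2))) + (asize ?t + 2)) (While_pos ?t ?body) ?s2 s'"
        "Inv ?M s'" by blast
    have "runs N (?kw N) (While_pos ?t ?body) ?s2 s'"
      by (rule runs_mono[OF s'(1)]) (intro add_mono mult_le_mono1 M(2) le_refl)
    from runs_Seq[OF s1(1) runs_Seq[OF s2 this]]
    show "\<exists>s'. runs N (q N + (?k0 + ?kw N)) (compile (Fold i a z f) \<rho> r) s s'
        \<and> unchanged_below r s s' \<and> s' (reg_addr r) = eval_ex inp (Fold i a z f) env"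
      using s'(2) by (auto simp: Inv_def)
  qed
qed

section \<open>Producing the output\<close>

text \<open>
  The output replaces the input in memory, but the computation needs the input until the end.
  Therefore all output cells are first computed into a buffer and then moved.
\<close>
definition buffer_addr :: "nat \<Rightarrow> int" where
  "buffer_addr k = - (2 * int k + 2)"

lemma buffer_addr_simps [simp]:
  "buffer_addr k = buffer_addr k' \<longleftrightarrow> k = k'" "buffer_addr k \<noteq> reg_addr r" "reg_addr r \<noteq> buffer_addr k"
  "buffer_addr k < 0" "\<not> 0 \<le> buffer_addr k"
  by (auto simp: buffer_addr_def reg_addr_def) presburger+

lemma unchanged_buffer: "unchanged_below r s s' \<Longrightarrow> s' (buffer_addr k) = s (buffer_addr k)"
  unfolding unchanged_below_def by simp

definition buffer_at :: "nat \<Rightarrow> aexp" where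
  "buffer_at r = Sub (Const (-2)) (Add (get r) (get r))"

definition increment :: "nat \<Rightarrow> com" where
  "increment r = Store (reg r) (Add (get r) (Const 1))"

lemma runs_increment: "runs N (2 * asize (reg r) + 6) (increment r) s (s(reg_addr r := s (reg_addr r) + 1))"
  unfolding increment_def using runs_Store[of N "reg r" s "Add (get r) (Const 1)"]
  by (simp add: bit_length_def floorlog_def)

text \<open>
  Register \<open>1\<close> is the counter and the register of the variable \<open>v\<close>; register \<open>0\<close> is never written and
  provides the initial value \<open>0\<close> for all other variables.
\<close>
definition fill_buffer :: "'v \<Rightarrow> 'v ex \<Rightarrow> com" where
  "fill_buffer v e = While_pos (Sub (Load (Const 0)) (get 1))
     (Seq (compile e ((\<lambda>_. 0)(v := 1)) 2) (Seq (Store (buffer_at 1) (get 2)) (increment 1)))"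

text \<open>
  The length of the input is saved in register \<open>3\<close> first, since cell \<open>0\<close> is the first to be overwritten.
\<close>
definition copy_buffer :: com where
  "copy_buffer = Seq (Store (reg 3) (Load (Const 0))) (Seq (Store (reg 1) (Const 0))
     (While_pos (Sub (get 3) (get 1))
       (Seq (Store (get 1) (Load (buffer_at 1))) (increment 1))))"

lemma fill_buffer_runs:
  obtains q where "polynomial_bound q"
    "\<forall>N inp s. input_bounded N inp \<and> (\<forall>a\<ge>0. s a = inp a) \<and> s (reg_addr 0) = 0 \<and> s (reg_addr 1) = 0 \<longrightarrow>
      (\<exists>s'. runs N (q N) (fill_buffer v e) s s' \<and> (\<forall>a\<ge>0. s' a = inp a) \<and>
        (\<forall>k. int k < inp 0 \<longrightarrow> s' (buffer_addr k) = eval_ex inp e ((\<lambda>_. 0)(v := int k))))"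
proof -
  let ?\<rho> = "(\<lambda>_. 0 :: nat)(v := 1)"
  obtain q where q: "polynomial_bound q"
    "\<forall>N inp env. input_bounded N inp \<longrightarrow> computes N (q N) inp (compile e ?\<rho> 2) env ?\<rho> 2 (eval_ex inp e env)"
    using compile_correct by (rule poly_computesE)
  let ?t = "Sub (Load (Const 0)) (get 1)"
  let ?k1 = "asize (buffer_at 1) + asize (get 2) + 2"
  let ?k2 = "2 * asize (reg 1) + 6"
  let ?kb = "\<lambda>N. q N + (?k1 + ?k2)"
  let ?kw = "\<lambda>N. N * (asize ?t + 2 + ?kb N) + (asize ?t + 2)"
  let ?body = "Seq (compile e ?\<rho> 2) (Seq (Store (buffer_at 1) (get 2)) (increment 1))"
  show ?thesis
  proof (rule that[of ?kw], intro polynomial_bound_intros q(1), intro allI impI, elim conjE)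
    fix N inp s
    assume inp: "input_bounded N inp" and s: "\<forall>a\<ge>0. s a = inp a" "s (reg_addr 0) = 0" "s (reg_addr 1) = 0"
    let ?v = "\<lambda>k. eval_ex inp e ((\<lambda>_. 0)(v := int k))"
    let ?M = "nat (inp 0)"
    have M: "int ?M = inp 0" "?M \<le> N" using inp by (auto simp: input_bounded_def)
    define Inv where "Inv = (\<lambda>k s. (\<forall>a\<ge>0. s a = inp a) \<and> s (reg_addr 0) = 0 \<and> s (reg_addr 1) = int k
      \<and> (\<forall>k'<k. s (buffer_addr k') = ?v k'))"
    have Inv0: "Inv 0 s" using s by (simp add: Inv_def)
    have test: "aval ?t s' = inp 0 - int k" if "Inv k s'" for k s'
      using that by (simp add: Inv_def)
    have "\<exists>s'. runs N (?M * (asize ?t + 2 + ?kb N) + (asize ?t + 2)) (While_pos ?t ?body) s s' \<and> Inv ?M s'"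
    proof (rule runs_While_pos[where Inv = Inv, OF _ _ Inv0])
      fix s' assume "Inv ?M s'"
      then show "\<not> aval ?t s' > 0 \<and> small_factors N ?t s'" using test[of ?M s'] M by simp
    next
      fix k s3 assume k: "k < ?M" and I: "Inv k s3"
      have "represents inp ((\<lambda>_. 0)(v := int k)) ?\<rho> 2 s3"
        using I by (auto simp: represents_def Inv_def)
      from computesD[OF q(2)[rule_format, OF inp] this] obtain s4 where
        s4: "runs N (q N) (compile e ?\<rho> 2) s3 s4" "unchanged_below 2 s3 s4" "s4 (reg_addr 2) = ?v k"
        by auto
      have keep: "\<forall>a\<ge>0. s4 a = inp a" "s4 (reg_addr 0) = 0" "s4 (reg_addr 1) = int k"
          "\<forall>k'<k. s4 (buffer_addr k') = ?v k'"
        using I unchanged_nonneg[OF s4(2)] unchanged_reg[OF s4(2)] unchanged_buffer[OF s4(2)]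
        by (auto simp: Inv_def)
      let ?s5 = "s4(buffer_addr k := ?v k)"
      have "aval (buffer_at 1) s4 = buffer_addr k" using keep by (simp add: buffer_at_def buffer_addr_def)
      then have s5: "runs N ?k1 (Store (buffer_at 1) (get 2)) s4 ?s5"
        using runs_Store[of N "buffer_at 1" s4 "get 2" ?k1] s4(3) by (simp add: buffer_at_def)
      let ?s6 = "?s5(reg_addr 1 := ?s5 (reg_addr 1) + 1)"
      have "Inv (Suc k) ?s6" using keep by (auto simp: Inv_def less_Suc_eq)
      moreover have "aval ?t s3 > 0" using test[OF I] k M by linarith
      ultimately show "aval ?t s3 > 0 \<and> small_factors N ?t s3 \<and>
          (\<exists>s'. runs N (?kb N) ?body s3 s' \<and> Inv (Suc k) s')"
        using runs_Seq[OF s4(1) runs_Seq[OF s5 runs_increment[of N 1 ?s5]]] by auto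
    qed
    then obtain s' where s': "runs N (?M * (asize ?t + 2 + ?kb N) + (asize ?t + 2)) (While_pos ?t ?body) s s'"
        "Inv ?M s'" by blast
    have "runs N (?kw N) (fill_buffer v e) s s'"
      unfolding fill_buffer_def
      by (rule runs_mono[OF s'(1)]) (intro add_mono mult_le_mono1 M(2) le_refl)
    then show "\<exists>s'. runs N (?kw N) (fill_buffer v e) s s' \<and> (\<forall>a\<ge>0. s' a = inp a) \<and>
        (\<forall>k. int k < inp 0 \<longrightarrow> s' (buffer_addr k) = ?v k)"
      using s'(2) M by (auto simp: Inv_def intro!: exI[of _ s'])
  qed
qed

lemma copy_buffer_runs:
  obtains q where "polynomial_bound q"
    "\<forall>N s. 0 \<le> s 0 \<and> s 0 \<le> int N \<longrightarrow>
      (\<exists>s'. runs N (q N) copy_buffer s s' \<and> (\<forall>k. int k < s 0 \<longrightarrow> s' (int k) = s (buffer_addr k)))"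
proof -
  let ?t = "Sub (get 3) (get 1)"
  let ?k0 = "asize (reg 3) + asize (Load (Const 0)) + 2"
  let ?k1 = "asize (reg 1) + asize (Const 0) + 2"
  let ?k2 = "asize (get 1) + asize (Load (buffer_at 1)) + 2"
  let ?kb = "?k2 + (2 * asize (reg 1) + 6)"
  let ?kw = "\<lambda>N. N * (asize ?t + 2 + ?kb) + (asize ?t + 2)"
  let ?body = "Seq (Store (get 1) (Load (buffer_at 1))) (increment 1)"
  show ?thesis
  proof (rule that[of "\<lambda>N. ?k0 + (?k1 + ?kw N)"], intro polynomial_bound_intros, intro allI impI, elim conjE)
    fix N :: nat and s :: memory
    assume s: "0 \<le> s 0" "s 0 \<le> int N"
    let ?M = "nat (s 0)"
    have M: "int ?M = s 0" "?M \<le> N" using s by auto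
    let ?s1 = "s(reg_addr 3 := s 0)"
    have s1: "runs N ?k0 (Store (reg 3) (Load (Const 0))) s ?s1"
      using runs_Store[of N "reg 3" s "Load (Const 0)"] by simp
    let ?s2 = "?s1(reg_addr 1 := 0)"
    have s2: "runs N ?k1 (Store (reg 1) (Const 0)) ?s1 ?s2"
      using runs_Store[of N "reg 1" ?s1 "Const 0"] by simp
    define Inv where "Inv = (\<lambda>k s'. s' (reg_addr 3) = s 0 \<and> s' (reg_addr 1) = int k
      \<and> (\<forall>k'. s' (buffer_addr k') = s (buffer_addr k')) \<and> (\<forall>k'<k. s' (int k') = s (buffer_addr k')))"
    have Inv0: "Inv 0 ?s2" by (simp add: Inv_def)
    have test: "aval ?t s' = s 0 - int k" if "Inv k s'" for k s'
      using that by (simp add: Inv_def)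
    have nonneg: "int k \<noteq> reg_addr r" "int k \<noteq> buffer_addr r" for k r
      by (metis of_nat_0_le_iff reg_addr_simps(3)) (metis of_nat_0_le_iff buffer_addr_simps(5))
    have "\<exists>s'. runs N (?M * (asize ?t + 2 + ?kb) + (asize ?t + 2)) (While_pos ?t ?body) ?s2 s' \<and> Inv ?M s'"
    proof (rule runs_While_pos[where Inv = Inv, OF _ _ Inv0])
      fix s' assume "Inv ?M s'"
      then show "\<not> aval ?t s' > 0 \<and> small_factors N ?t s'" using test[of ?M s'] M by simp
    next
      fix k s3 assume k: "k < ?M" and I: "Inv k s3"
      let ?s4 = "s3(int k := s (buffer_addr k))"
      have "aval (buffer_at 1) s3 = buffer_addr k" using I by (simp add: buffer_at_def buffer_addr_def Inv_def)
      then have s4: "runs N ?k2 (Store (get 1) (Load (buffer_at 1))) s3 ?s4"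
        using runs_Store[of N "get 1" s3 "Load (buffer_at 1)" ?k2] I by (simp add: buffer_at_def Inv_def)
      let ?s5 = "?s4(reg_addr 1 := ?s4 (reg_addr 1) + 1)"
      have "Inv (Suc k) ?s5"
        using I nonneg nonneg[symmetric] by (auto simp: Inv_def less_Suc_eq)
      moreover have "aval ?t s3 > 0" using test[OF I] k M by linarith
      ultimately show "aval ?t s3 > 0 \<and> small_factors N ?t s3 \<and> (\<exists>s'. runs N ?kb ?body s3 s' \<and> Inv (Suc k) s')"
        using runs_Seq[OF s4 runs_increment[of N 1 ?s4]] by auto
    qed
    then obtain s' where s': "runs N (?M * (asize ?t + 2 + ?kb) + (asize ?t + 2)) (While_pos ?t ?body) ?s2 s'"
        "Inv ?M s'" by blast
    have "runs N (?kw N) (While_pos ?t ?body) ?s2 s'"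
      by (rule runs_mono[OF s'(1)]) (intro add_mono mult_le_mono1 M(2) le_refl)
    from runs_Seq[OF s1 runs_Seq[OF s2 this]]
    show "\<exists>s'. runs N (?k0 + (?k1 + ?kw N)) copy_buffer s s' \<and> (\<forall>k. int k < s 0 \<longrightarrow> s' (int k) = s (buffer_addr k))"
      unfolding copy_buffer_def using s'(2) M by (auto simp: Inv_def intro!: exI[of _ s'])
  qed
qed

lemma length_le_encoding_size: "length xs \<le> encoding_size xs"
proof (induction xs)
  case (Cons x xs)
  then show ?case using bit_length_pos[of x] by (simp add: encoding_size_def)
qed (simp add: encoding_size_def)

lemma bit_length_le_encoding_size: "x \<in> set xs \<Longrightarrow> bit_length x \<le> encoding_size xs"
  unfolding encoding_size_def by (rule member_le_sum_list) auto

lemma encoding_size_le: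
  "(\<And>c. c \<in> set ys \<Longrightarrow> bit_length c \<le> W) \<Longrightarrow> encoding_size ys \<le> length ys * W"
proof (induction ys)
  case (Cons y ys)
  then have "bit_length y \<le> W" "encoding_size ys \<le> length ys * W" by auto
  then show ?case by (simp add: encoding_size_def)
qed (simp add: encoding_size_def)

lemma initial_memory_bounded: "bounded_memory (encoding_size xs) (initial_memory xs)"
  unfolding bounded_memory_def
proof
  fix a
  have "length xs \<le> 2 ^ encoding_size xs"
    using length_le_encoding_size[of xs] less_exp[of "encoding_size xs"] by linarith
  then have len: "\<bar>int (length xs)\<bar> \<le> 2 ^ encoding_size xs"
    by (metis abs_of_nat of_nat_le_iff of_nat_numeral of_nat_power)
  have el: "\<bar>x\<bar> \<le> 2 ^ encoding_size xs" if "x \<in> set xs" for x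
    by (rule order_trans[OF abs_le_bit_length power_increasing[OF bit_length_le_encoding_size[OF that]]]) simp
  show "\<bar>initial_memory xs a\<bar> \<le> 2 ^ encoding_size xs"
    using len el[of "xs ! nat (a - 1)"] by (auto simp: initial_memory_def)
qed

lemma initial_memory_input_bounded: "input_bounded (encoding_size xs) (initial_memory xs)"
  using initial_memory_bounded[of xs] length_le_encoding_size[of xs]
  by (simp add: input_bounded_def bounded_memory_def) (simp add: initial_memory_def)

text \<open>
  The interface to the separation problem: it suffices to give one expression whose value at
  \<open>v = k\<close> is the content of output cell \<open>k\<close>. The output has to be shorter than the input because only
  as many cells as the input has are filled.
\<close>
theorem poly_time_search_by_expression:
  fixes e :: "'v ex" and v :: 'v
  assumes ex: "\<And>x. x \<in> D \<Longrightarrow> \<exists>y. R x y \<and> length (encode_out y) < length (encode_in x) \<and>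
      (\<forall>k\<le>length (encode_out y). eval_ex (initial_memory (encode_in x)) e ((\<lambda>_. 0)(v := int k))
        = (int (length (encode_out y)) # encode_out y) ! k)"
  shows "poly_time_search encode_in encode_out D R"
proof -
  obtain q1 where q1: "polynomial_bound q1"
    "\<forall>N inp s. input_bounded N inp \<and> (\<forall>a\<ge>0. s a = inp a) \<and> s (reg_addr 0) = 0 \<and> s (reg_addr 1) = 0 \<longrightarrow>
      (\<exists>s'. runs N (q1 N) (fill_buffer v e) s s' \<and> (\<forall>a\<ge>0. s' a = inp a) \<and>
        (\<forall>k. int k < inp 0 \<longrightarrow> s' (buffer_addr k) = eval_ex inp e ((\<lambda>_. 0)(v := int k))))"
    by (rule fill_buffer_runs)
  obtain q2 where q2: "polynomial_bound q2"
    "\<forall>N s. 0 \<le> s 0 \<and> s 0 \<le> int N \<longrightarrow>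
      (\<exists>s'. runs N (q2 N) copy_buffer s s' \<and> (\<forall>k. int k < s 0 \<longrightarrow> s' (int k) = s (buffer_addr k)))"
    by (rule copy_buffer_runs)
  let ?q = "\<lambda>N. q1 N + q2 N"
  let ?prog = "Seq (fill_buffer v e) copy_buffer"
  let ?b = "\<lambda>N. N + ?q N * (N + 1)"
  have "polynomial_bound (\<lambda>N. ?q N * ?b N + N * (?b N + 2))"
    by (intro polynomial_bound_intros q1(1) q2(1))
  then obtain a d where poly: "\<And>N. ?q N * ?b N + N * (?b N + 2) \<le> a * N ^ d + a"
    unfolding polynomial_bound_def by blast
  have "\<exists>t s y. exec ?prog (initial_memory (encode_in x)) t s \<and> holds_list s (encode_out y) \<and> R x y \<and>
      t + encoding_size (encode_out y) \<le> a * encoding_size (encode_in x) ^ d + a" if x: "x \<in> D" for x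
  proof -
    let ?inp = "initial_memory (encode_in x)" and ?N = "encoding_size (encode_in x)"
    obtain y where y: "R x y" "length (encode_out y) < length (encode_in x)"
      "\<And>k. k \<le> length (encode_out y) \<Longrightarrow> eval_ex ?inp e ((\<lambda>_. 0)(v := int k))
        = (int (length (encode_out y)) # encode_out y) ! k"
      using ex[OF x] by blast
    \<comment> \<open>Registers \<open>0\<close> and \<open>1\<close> start with \<open>0\<close>, as \<open>fill_buffer\<close> requires.\<close>
    have neg: "?inp (reg_addr r) = 0" for r
      by (simp add: initial_memory_def reg_addr_def)
    obtain s1 where s1: "runs ?N (q1 ?N) (fill_buffer v e) ?inp s1" "\<forall>a\<ge>0. s1 a = ?inp a"
        "\<And>k. int k < ?inp 0 \<Longrightarrow> s1 (buffer_addr k) = eval_ex ?inp e ((\<lambda>_. 0)(v := int k))"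
      using q1(2) initial_memory_input_bounded[of "encode_in x"] neg by blast
    have len: "s1 0 = int (length (encode_in x))" using s1(2) by (simp add: initial_memory_def)
    have "0 \<le> s1 0 \<and> s1 0 \<le> int ?N" using len length_le_encoding_size[of "encode_in x"] by simp
    then obtain s2 where s2: "runs ?N (q2 ?N) copy_buffer s1 s2"
        "\<And>k. int k < s1 0 \<Longrightarrow> s2 (int k) = s1 (buffer_addr k)"
      using q2(2) by blast
    have cell: "s2 (int k) = (int (length (encode_out y)) # encode_out y) ! k" if "k \<le> length (encode_out y)" for k
      using that s1(3)[of k] s2(2)[of k] len y(2) y(3)[OF that] s1(2) by simp
    have holds: "holds_list s2 (encode_out y)"
      unfolding holds_list_def
    proof (intro conjI allI impI)
      show "s2 0 = int (length (encode_out y))" using cell[of 0] by simp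
      fix i assume "i < length (encode_out y)"
      then show "s2 (int i + 1) = encode_out y ! i" using cell[of "Suc i"] by (simp add: add.commute)
    qed
    obtain t where t: "exec ?prog ?inp t s2" "t \<le> ?q ?N * ?b ?N" "bounded_memory (?b ?N) s2"
      using runs_Seq[OF s1(1) s2(1)] initial_memory_bounded[of "encode_in x"] unfolding runs_def by blast
    have "encoding_size (encode_out y) \<le> length (encode_out y) * (?b ?N + 2)"
    proof -
      have "bit_length c \<le> ?b ?N + 2" if c: "c \<in> set (encode_out y)" for c
      proof -
        obtain i where "i < length (encode_out y)" "c = encode_out y ! i" using c by (auto simp: in_set_conv_nth)
        then have "c = s2 (int i + 1)" using holds by (simp add: holds_list_def)
        then show ?thesis using t(3) by (intro bit_length_le) (simp add: bounded_memory_def)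
      qed
      then show ?thesis by (rule encoding_size_le)
    qed
    also have "\<dots> \<le> ?N * (?b ?N + 2)"
      using y(2) length_le_encoding_size[of "encode_in x"] by (intro mult_le_mono1) simp
    finally have "t + encoding_size (encode_out y) \<le> a * ?N ^ d + a"
      using t(2) poly[of ?N] by linarith
    then show ?thesis using t(1) holds y(1) by blast
  qed
  then show ?thesis unfolding poly_time_search_def by blast
qed

section \<open>Exhaustive search\<close>

text \<open>
  \<open>Pos\<close> is the output position, \<open>Code\<close> the kind of an inequality in the numbering of \<open>encode_ineq\<close>, and
  \<open>Pv\<close>, \<open>A0\<close>, \<open>A1\<close>, \<open>A2\<close> are the parameters of a candidate. The remaining variables are local to
  the constructions below.
\<close>
datatype var = Pos | Code | Pv | A0 | A1 | A2 | Acc | Best | Ent | EntK | LevJ | LevI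
  | RankJ | RankI | SumJ | ElJ | ElI

primrec free_vars :: "'v ex \<Rightarrow> 'v set" where
  "free_vars (Num c) = {}"
| "free_vars (Var v) = {v}"
| "free_vars (Inp e) = free_vars e"
| "free_vars (Plus a b) = free_vars a \<union> free_vars b"
| "free_vars (Minus a b) = free_vars a \<union> free_vars b"
| "free_vars (Scale a b) = free_vars a \<union> free_vars b"
| "free_vars (Cond c a b) = free_vars c \<union> free_vars a \<union> free_vars b"
| "free_vars (Bind v a b) = free_vars a \<union> (free_vars b - {v})"
| "free_vars (Fold i a z f) = free_vars z \<union> (free_vars f - {i, a})"

lemma eval_ex_cong:
  "(\<And>y. y \<in> free_vars e \<Longrightarrow> env y = env' y) \<Longrightarrow> eval_ex inp e env = eval_ex inp e env'"
proof (induction e arbitrary: env env')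
  case (Bind v a b)
  have a: "eval_ex inp a env = eval_ex inp a env'"
    by (rule Bind.IH(1)) (use Bind.prems in auto)
  show ?case
    unfolding eval_ex.simps a by (rule Bind.IH(2)) (use Bind.prems in auto)
next
  case (Fold i a z f)
  have z: "eval_ex inp z env = eval_ex inp z env'"
    by (rule Fold.IH(1)) (use Fold.prems in auto)
  have "eval_ex inp f (env(i := int k, a := acc)) = eval_ex inp f (env'(i := int k, a := acc))" for k acc
    by (rule Fold.IH(2)) (use Fold.prems in auto)
  then show ?case by (simp only: eval_ex.simps z)
next
  case (Cond c a b)
  have "eval_ex inp c env = eval_ex inp c env'" "eval_ex inp a env = eval_ex inp a env'"
    "eval_ex inp b env = eval_ex inp b env'"
    by (rule Cond.IH; use Cond.prems in simp)+
  then show ?case by simp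
next
  case (Inp e)
  have "eval_ex inp e env = eval_ex inp e env'" by (rule Inp.IH) (use Inp.prems in simp)
  then show ?case by simp
next
  case (Plus a b)
  have "eval_ex inp a env = eval_ex inp a env'" "eval_ex inp b env = eval_ex inp b env'"
    by (rule Plus.IH; use Plus.prems in simp)+
  then show ?case by simp
next
  case (Minus a b)
  have "eval_ex inp a env = eval_ex inp a env'" "eval_ex inp b env = eval_ex inp b env'"
    by (rule Minus.IH; use Minus.prems in simp)+
  then show ?case by simp
next
  case (Scale a b)
  have "eval_ex inp a env = eval_ex inp a env'" "eval_ex inp b env = eval_ex inp b env'"
    by (rule Scale.IH; use Scale.prems in simp)+
  then show ?case by simp
qed simp_all

text \<open>
  The accumulator \<open>Best\<close> holds the best index so far, and \<open>M\<close> is evaluated there by rebinding \<open>x\<close>.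
\<close>
definition argmax :: "var \<Rightarrow> var ex \<Rightarrow> var ex" where
  "argmax x M = Fold x Best (Num 0) (Cond (Minus M (Bind x (Var Best) M)) (Var x) (Var Best))"

text \<open>
  Chooses values for the variables one after the other such that \<open>M\<close> becomes maximal, and evaluates
  \<open>e\<close> there. A value is assessed by what the search over the remaining variables makes of it.
\<close>
primrec search :: "var list \<Rightarrow> var ex \<Rightarrow> var ex \<Rightarrow> var ex" where
  "search [] M e = e"
| "search (x # xs) M e = Bind x (argmax x (search xs M M)) (search xs M e)"

lemma free_vars_search: "free_vars (search xs M e) \<subseteq> free_vars M \<union> free_vars e"
  by (induction xs arbitrary: e) (auto simp: argmax_def; blast)+

lemma argmax_correct:
  assumes x: "x \<noteq> Best" and len: "0 < inp 0"
    and free: "Best \<notin> free_vars M"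
  shows "\<exists>k. eval_ex inp (argmax x M) env = k \<and> 0 \<le> k \<and> k < inp 0 \<and>
    (\<forall>k'. 0 \<le> k' \<and> k' < inp 0 \<longrightarrow> eval_ex inp M (env(x := k')) \<le> eval_ex inp M (env(x := k)))"
proof -
  have M: "eval_ex inp M (env(Best := w)) = eval_ex inp M env" for env w
    by (rule eval_ex_cong) (use free in auto)
  define F where "F k = eval_ex inp M (env(x := k))" for k
  let ?step = "\<lambda>k acc. if F (int k) - F acc > 0 then int k else acc"
  have it: "eval_ex inp (argmax x M) env = iterate ?step 0 (nat (inp 0))"
  proof -
    have "eval_ex inp M (env(x := k, Best := w)) = F k" for k w
      unfolding F_def by (rule M)
    moreover have "eval_ex inp M (env(x := k, Best := w, x := w)) = F w" for k w
      using M[of "env(x := w)" w] x by (simp add: F_def fun_upd_twist)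
    ultimately show ?thesis using x by (simp add: argmax_def cong: if_cong)
  qed
  have inv: "0 \<le> iterate ?step 0 K \<and> (iterate ?step 0 K < int K \<or> iterate ?step 0 K = 0) \<and>
      (\<forall>k'. 0 \<le> k' \<and> k' < int K \<longrightarrow> F k' \<le> F (iterate ?step 0 K))" for K
  proof (induction K)
    case (Suc K)
    let ?a = "iterate ?step 0 K" and ?b = "iterate ?step 0 (Suc K)"
    have b: "?b = (if F (int K) - F ?a > 0 then int K else ?a)" by simp
    then have le: "F (int K) \<le> F ?b" "F ?a \<le> F ?b" by simp_all
    have "F k' \<le> F ?b" if "0 \<le> k'" "k' < int (Suc K)" for k'
    proof (cases "k' = int K")
      case False
      then have "k' < int K" using that by simp
      then have "F k' \<le> F ?a" using conjunct2[OF conjunct2[OF Suc]] that(1) by blast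
      then show ?thesis using le(2) by (rule order_trans)
    qed (use le in simp)
    moreover have "0 \<le> ?b \<and> (?b < int (Suc K) \<or> ?b = 0)" using Suc unfolding b by auto
    ultimately show ?case by blast
  qed simp
  show ?thesis
    unfolding it using inv[of "nat (inp 0)"] len by (auto simp flip: F_def)
qed

text \<open>
  The assignment found by the search. It is a function of the environment, and by \<open>solution_upd\<close> the
  same for all output positions; this matters because the search is repeated for every output cell
  and maximisers need not be unique.
\<close>
primrec solution :: "memory \<Rightarrow> var list \<Rightarrow> var ex \<Rightarrow> (var \<Rightarrow> int) \<Rightarrow> var \<Rightarrow> int" where
  "solution inp [] M env = env"
| "solution inp (x # xs) M env =
     solution inp xs M (env(x := eval_ex inp (argmax x (search xs M M)) env))"

lemma eval_search: "eval_ex inp (search xs M e) env = eval_ex inp e (solution inp xs M env)"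
  by (induction xs arbitrary: env) auto

lemma solution_outside: "y \<notin> set xs \<Longrightarrow> solution inp xs M env y = env y"
  by (induction xs arbitrary: env) auto

lemma solution_upd:
  "y \<notin> set xs \<Longrightarrow> y \<notin> free_vars M \<Longrightarrow>
    solution inp xs M (env(y := w)) = (solution inp xs M env)(y := w)"
proof (induction xs arbitrary: env)
  case (Cons x xs)
  have "y \<notin> free_vars (argmax x (search xs M M))"
    using Cons.prems free_vars_search[of xs M M] by (auto simp: argmax_def)
  then have "eval_ex inp (argmax x (search xs M M)) (env(y := w)) = eval_ex inp (argmax x (search xs M M)) env"
    by (intro eval_ex_cong) auto
  moreover have "env(y := w, x := k) = env(x := k, y := w)" for k
    using Cons.prems by (intro fun_upd_twist) auto
  ultimately show ?case using Cons by (simp only: solution.simps set_simps insert_iff de_Morgan_disj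
      not_False_eq_True)
qed simp

lemma solution_correct:
  assumes "Best \<notin> set xs" "Best \<notin> free_vars M" "0 < inp 0"
  shows "(\<forall>x\<in>set xs. 0 \<le> solution inp xs M env x \<and> solution inp xs M env x < inp 0)
    \<and> (\<forall>env'. (\<forall>y. y \<notin> set xs \<longrightarrow> env' y = env y) \<and> (\<forall>x\<in>set xs. 0 \<le> env' x \<and> env' x < inp 0)
        \<longrightarrow> eval_ex inp M env' \<le> eval_ex inp M (solution inp xs M env))"
  using assms(1)
proof (induction xs arbitrary: env)
  case Nil
  have "env' = env" if "\<forall>y. y \<notin> set [] \<longrightarrow> env' y = env y" for env' :: "var \<Rightarrow> int"
    using that by auto
  then show ?case by auto
next
  case (Cons x xs)
  let ?M = "search xs M M"
  have xs: "Best \<notin> set xs" and x: "x \<noteq> Best" using Cons.prems by auto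
  have free: "Best \<notin> free_vars ?M" using free_vars_search[of xs M M] assms(2) by auto
  define k where "k = eval_ex inp (argmax x ?M) env"
  have k: "0 \<le> k" "k < inp 0"
      "\<And>k'. 0 \<le> k' \<Longrightarrow> k' < inp 0 \<Longrightarrow> eval_ex inp ?M (env(x := k')) \<le> eval_ex inp ?M (env(x := k))"
    using argmax_correct[where inp = inp and M = ?M and env = env, OF x assms(3) free]
    unfolding k_def[symmetric] by auto
  let ?sol = "solution inp xs M (env(x := k))"
  have sol: "solution inp (x # xs) M env = ?sol" by (simp add: k_def)
  have max: "eval_ex inp M env' \<le> eval_ex inp M ?sol"
    if e: "\<forall>y. y \<notin> set (x # xs) \<longrightarrow> env' y = env y" "\<forall>x\<in>set (x # xs). 0 \<le> env' x \<and> env' x < inp 0"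
    for env'
  proof -
    have "eval_ex inp M env' \<le> eval_ex inp M (solution inp xs M (env(x := env' x)))"
      by (rule Cons.IH[OF xs, THEN conjunct2, rule_format]) (use e in auto)
    also have "\<dots> = eval_ex inp ?M (env(x := env' x))" by (rule eval_search[symmetric])
    also have "\<dots> \<le> eval_ex inp ?M (env(x := k))" using e by (intro k(3)) auto
    also have "\<dots> = eval_ex inp M ?sol" by (rule eval_search)
    finally show ?thesis .
  qed
  have range: "0 \<le> ?sol y \<and> ?sol y < inp 0" if "y \<in> set (x # xs)" for y
  proof (cases "y \<in> set xs")
    case True
    then show ?thesis by (rule Cons.IH[OF xs, THEN conjunct1, rule_format])
  next
    case False
    then show ?thesis using that k solution_outside[OF False] by simp
  qed
  show ?case
    unfolding sol by (intro conjI ballI allI impI; (elim conjE)?; rule range[THEN conjunct1]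
      range[THEN conjunct2] max; assumption)
qed

section \<open>The algorithm as an expression\<close>

text \<open>As in the machine, a number is taken as true if it is positive.\<close>
abbreviation "nE \<equiv> Inp (Num 1)"
abbreviation "mE \<equiv> Inp (Num 2)"
abbreviation "lE \<equiv> Inp (Num 3)"
abbreviation "uE \<equiv> Inp (Num 4)"

definition "Lt a b = Minus b a"
definition "Le a b = Minus (Plus b (Num 1)) a"
definition "And a b = Cond a b (Num 0)"
definition "Or a b = Cond a (Num 1) b"
definition "Neg a = Cond a (Num 0) (Num 1)"
definition "Eq a b = And (Le a b) (Le b a)"

lemma pos_eval [simp]:
  "0 < eval_ex inp (Lt a b) env \<longleftrightarrow> eval_ex inp a env < eval_ex inp b env"
  "0 < eval_ex inp (Le a b) env \<longleftrightarrow> eval_ex inp a env \<le> eval_ex inp b env"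
  "0 < eval_ex inp (And a b) env \<longleftrightarrow> 0 < eval_ex inp a env \<and> 0 < eval_ex inp b env"
  "0 < eval_ex inp (Or a b) env \<longleftrightarrow> 0 < eval_ex inp a env \<or> 0 < eval_ex inp b env"
  "0 < eval_ex inp (Neg a) env \<longleftrightarrow> \<not> 0 < eval_ex inp a env"
  "0 < eval_ex inp (Eq a b) env \<longleftrightarrow> eval_ex inp a env = eval_ex inp b env"
  by (auto simp: Lt_def Le_def And_def Or_def Neg_def Eq_def)

lemma free_vars_logic [simp]:
  "free_vars (Lt a b) = free_vars a \<union> free_vars b" "free_vars (Le a b) = free_vars a \<union> free_vars b"
  "free_vars (And a b) = free_vars a \<union> free_vars b" "free_vars (Or a b) = free_vars a \<union> free_vars b"
  "free_vars (Neg a) = free_vars a" "free_vars (Eq a b) = free_vars a \<union> free_vars b"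
  by (auto simp: Lt_def Le_def And_def Or_def Neg_def Eq_def)

definition sum_to :: "var \<Rightarrow> var ex \<Rightarrow> var ex \<Rightarrow> var ex \<Rightarrow> var ex" where
  "sum_to v hi c e = Fold v Acc (Num 0)
     (Cond (And (Lt (Num 0) (Var v)) (And (Le (Var v) hi) c)) (Plus e (Var Acc)) (Var Acc))"

lemma iterate_sum:
  assumes "\<And>k a. k < K \<Longrightarrow> f k a = (if 1 \<le> k \<and> k \<le> N \<and> P k then F k + a else a)"
  shows "iterate f 0 K = (\<Sum>j\<in>{j \<in> {1..N}. P j \<and> j < K}. F j)"
  using assms
proof (induction K)
  case (Suc K)
  have "{j \<in> {1..N}. P j \<and> j < Suc K} = (if 1 \<le> K \<and> K \<le> N \<and> P K
      then insert K {j \<in> {1..N}. P j \<and> j < K} else {j \<in> {1..N}. P j \<and> j < K})"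
    by (auto simp: less_Suc_eq)
  then show ?case using Suc by simp
qed simp

lemma iterate_prod:
  assumes "\<And>k a. k < K \<Longrightarrow> f k a = (if P k then a * F k else a)"
  shows "iterate f x K = x * (\<Prod>k\<in>{k. k < K \<and> P k}. F k)"
  using assms
proof (induction K)
  case (Suc K)
  have "{k. k < Suc K \<and> P k} = (if P K then insert K {k. k < K \<and> P k} else {k. k < K \<and> P k})"
    by (auto simp: less_Suc_eq)
  then show ?case using Suc by (simp add: algebra_simps)
qed simp

lemma eval_sum_to:
  assumes N: "eval_ex inp (Inp (Num h)) env = int N" "int N < inp 0" and v: "v \<noteq> Acc"
    and P: "\<And>j a. 1 \<le> j \<Longrightarrow> j \<le> N \<Longrightarrow> 0 < eval_ex inp c (env(v := int j, Acc := a)) \<longleftrightarrow> P j"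
    and F: "\<And>j a. 1 \<le> j \<Longrightarrow> j \<le> N \<Longrightarrow> P j \<Longrightarrow> eval_ex inp e (env(v := int j, Acc := a)) = F j"
  shows "eval_ex inp (sum_to v (Inp (Num h)) c e) env = (\<Sum>j\<in>{j \<in> {1..N}. P j}. F j)"
proof -
  have "eval_ex inp (sum_to v (Inp (Num h)) c e) env = (\<Sum>j\<in>{j \<in> {1..N}. P j \<and> j < nat (inp 0)}. F j)"
    unfolding sum_to_def eval_ex.simps
    by (rule iterate_sum) (use N(1) v P F in auto)
  also have "{j \<in> {1..N}. P j \<and> j < nat (inp 0)} = {j \<in> {1..N}. P j}" using N(2) by auto
  finally show ?thesis .
qed

text \<open>
  The incidence vector of \<open>S i\<close> starts in cell \<open>5 + (i - 1) n\<close>. The case \<open>i = 0\<close> is treated separately,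
  as \<open>S 0\<close> is empty and not part of the input.
\<close>
definition in_S :: "var ex \<Rightarrow> var ex \<Rightarrow> var ex" where
  "in_S i j = And (Lt (Num 0) i) (Inp (Plus (Num 4) (Plus (Scale (Minus i (Num 1)) (Num 1)) j)))"

definition numer_addr :: "var ex \<Rightarrow> var ex" where
  "numer_addr k = Plus (Plus (Num 5) (Scale nE (Num 2))) (Plus k k)"

definition denom_addr :: "var ex \<Rightarrow> var ex" where
  "denom_addr k = Plus (Plus (Num 6) (Scale nE (Num 2))) (Plus k k)"

definition common_denom :: "var ex" where
  "common_denom = Fold EntK Acc (Num 1)
     (Cond (Lt (Var EntK) (Plus nE mE)) (Scale (Var Acc) (denom_addr (Var EntK))) (Var Acc))"

text \<open>
  The \<open>k\<close>-th coordinate of \<open>(z, \<delta>)\<close> times the product of all denominators, computed without division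
  as its numerator times the other denominators.
\<close>
definition scaled_entry :: "var ex \<Rightarrow> var ex" where
  "scaled_entry k = Bind Ent k (Fold EntK Acc (Inp (numer_addr (Var Ent)))
     (Cond (And (Lt (Var EntK) (Plus nE mE)) (Neg (Eq (Var EntK) (Var Ent))))
       (Scale (Var Acc) (denom_addr (Var EntK))) (Var Acc)))"

definition zE :: "var ex \<Rightarrow> var ex" where
  "zE j = scaled_entry (Minus j (Num 1))"

definition dE :: "var ex \<Rightarrow> var ex" where
  "dE i = scaled_entry (Plus nE (Minus i (Num 1)))"

text \<open>The scaled value of \<open>\<delta>\<close> at the level of \<open>j\<close>; the sum has at most one term.\<close>
definition level_dE :: "var ex \<Rightarrow> var ex" where
  "level_dE j = Bind LevJ j (sum_to LevI mE
     (And (in_S (Var LevI) (Var LevJ)) (Neg (in_S (Minus (Var LevI) (Num 1)) (Var LevJ)))) (dE (Var LevI)))"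

definition excessE :: "var ex \<Rightarrow> var ex" where
  "excessE j = Cond (in_S (Var Pv) j) (Num 0) (Minus (level_dE j) (dE (Var Pv)))"

text \<open>
  What the violation gains from putting \<open>j\<close> into \<open>S'\<close>: the two families have opposite signs.
\<close>
definition gainE :: "var ex \<Rightarrow> var ex" where
  "gainE j = Cond (Eq (Var Code) (Num 9)) (Plus (zE j) (excessE j))
     (Minus (Num 0) (Plus (zE j) (excessE j)))"

text \<open>
  The three classes of elements for a given \<open>p\<close>: those of \<open>S (p - 1)\<close>, those of level \<open>p\<close>, and the rest.
\<close>
definition by_class :: "var ex \<Rightarrow> var ex \<Rightarrow> var ex \<Rightarrow> var ex \<Rightarrow> var ex" where
  "by_class j x y w = Cond (in_S (Minus (Var Pv) (Num 1)) j) x (Cond (in_S (Var Pv) j) y w)"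

definition classE :: "var ex \<Rightarrow> var ex" where
  "classE j = by_class j (Num 0) (Num 1) (Num 2)"

definition rankE :: "var ex \<Rightarrow> var ex" where
  "rankE j = Bind RankJ j (sum_to RankI nE
     (And (Eq (classE (Var RankI)) (classE (Var RankJ)))
       (Or (Lt (gainE (Var RankJ)) (gainE (Var RankI)))
         (And (Eq (gainE (Var RankI)) (gainE (Var RankJ))) (Lt (Var RankI) (Var RankJ))))) (Num 1))"

text \<open>
  Membership in the candidate for \<open>S'\<close>, which consists of the best \<open>A0\<close>, \<open>A1\<close> and \<open>A2\<close> elements of
  the three classes. Comparing ranks makes sorting superfluous.
\<close>
definition chosenE :: "var ex \<Rightarrow> var ex" where
  "chosenE j = Lt (rankE j) (by_class j (Var A0) (Var A1) (Var A2))"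

definition sumJ :: "var ex \<Rightarrow> var ex \<Rightarrow> var ex" where
  "sumJ c e = sum_to SumJ nE c e"

abbreviation "J' \<equiv> Var SumJ"

primrec by_code :: "int \<Rightarrow> var ex list \<Rightarrow> var ex" where
  "by_code k [] = Num 0"
| "by_code k (e # es) = Cond (Lt (Var Code) (Num (k + 1))) e (by_code (k + 1) es)"

definition guard :: "var ex \<Rightarrow> var ex \<Rightarrow> var ex" where
  "guard c e = Cond c e (Num 0)"

definition between :: "int \<Rightarrow> var ex \<Rightarrow> var ex \<Rightarrow> var ex" where
  "between a e hi = And (Le (Num a) e) (Le e hi)"

text \<open>
  The scaled violation of the candidate, listed by code; parameters that do not describe an inequality
  of the system get the value \<open>0\<close>, which can never win because some violation is positive.
\<close>
definition value_cases :: "var ex list" where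
  "value_cases =
    [Minus (Scale common_denom (Num 3)) (sumJ (Num 1) (zE J')),
     Minus (sumJ (Num 1) (zE J')) (Scale common_denom (Num 4)),
     guard (And (between 1 (Var Pv) mE) (And (between 1 (Var A0) nE) (in_S (Var Pv) (Var A0))))
       (Minus (Plus (zE (Var A0)) (dE (Var Pv))) common_denom),
     Minus (Minus common_denom (dE (Num 1))) (sumJ (in_S (Num 1) J') (zE J')),
     guard (between 1 (Var Pv) (Minus mE (Num 1))) (Minus (dE (Plus (Var Pv) (Num 1))) (dE (Var Pv))),
     guard (between 1 (Var Pv) (Minus mE (Num 1)))
       (Minus (Minus (dE (Var Pv)) (dE (Plus (Var Pv) (Num 1))))
         (sumJ (And (in_S (Plus (Var Pv) (Num 1)) J') (Neg (in_S (Var Pv) J'))) (zE J'))),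
     Minus (Num 0) (dE mE),
     guard (between 1 (Var Pv) nE) (Minus (Num 0) (zE (Var Pv))),
     guard (And (between 1 (Var Pv) nE) (Neg (in_S mE (Var Pv)))) (Minus (zE (Var Pv)) common_denom),
     guard (And (between 1 (Var Pv) mE)
         (Lt (sumJ (And (chosenE J') (Neg (in_S (Var Pv) J'))) (Num 1)) uE))
       (Plus (Scale (Minus (dE (Var Pv)) common_denom) (Num 4)) (sumJ (chosenE J') (gainE J'))),
     guard (And (between 1 (Var Pv) mE)
         (And (Le (sumJ (Or (chosenE J') (in_S (Minus (Var Pv) (Num 1)) J')) (Num 1)) (Minus nE lE))
           (Lt (Minus nE lE) (sumJ (Or (chosenE J') (in_S (Var Pv) J')) (Num 1)))))
       (Plus (Plus (Scale (dE (Var Pv)) (Num 3)) (sumJ (Num 1) (excessE J'))) (sumJ (chosenE J') (gainE J')))]"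

definition valueE :: "var ex" where
  "valueE = by_code 0 value_cases"

definition header_length :: "var ex" where
  "header_length = by_code 0 [Num 1, Num 1, Num 3, Num 1, Num 2, Num 2, Num 1, Num 2, Num 2, Num 2, Num 2]"

text \<open>
  The elements of \<open>S'\<close> are written from position \<open>3\<close> on in increasing order: the element at position
  \<open>q + 3\<close> is the one with exactly \<open>q\<close> smaller ones.
\<close>
definition elementE :: "var ex" where
  "elementE = sum_to ElJ nE
     (And (chosenE (Var ElJ))
       (Eq (sum_to ElI nE (And (chosenE (Var ElI)) (Lt (Var ElI) (Var ElJ))) (Num 1)) (Minus (Var Pos) (Num 3))))
     (Var ElJ)"

definition outputE :: "var ex" where
  "outputE = Cond (Var Pos)
     (Cond (Lt (Num 1) (Var Pos))
       (Cond (Lt (Num 2) (Var Pos)) (Cond (Lt (Var Code) (Num 3)) (Var A0) elementE) (Var Pv))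
       (Var Code))
     (Plus header_length (Cond (Lt (Num 8) (Var Code)) (sumJ (chosenE J') (Num 1)) (Num 0)))"

definition separationE :: "var ex" where
  "separationE = search [Code, Pv, A0, A1, A2] valueE outputE"

lemma free_vars_valueE:
  assumes "y \<notin> {Code, Pv, A0, A1, A2, Acc, Ent, EntK, LevJ, LevI, RankJ, RankI, SumJ}"
  shows "y \<notin> free_vars valueE"
proof -
  from assms have y: "y \<noteq> Code" "y \<noteq> Pv" "y \<noteq> A0" "y \<noteq> A1" "y \<noteq> A2" "y \<noteq> Acc" "y \<noteq> Ent"
    "y \<noteq> EntK" "y \<noteq> LevJ" "y \<noteq> LevI" "y \<noteq> RankJ" "y \<noteq> RankI" "y \<noteq> SumJ" by auto
  have in_S: "y \<notin> free_vars (in_S i j)" if "y \<notin> free_vars i" "y \<notin> free_vars j" for i j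
    using that y by (simp add: y in_S_def)
  have sum_to: "y \<notin> free_vars (sum_to v h c e)"
    if "y \<notin> free_vars h" "y \<notin> free_vars c" "y \<notin> free_vars e" for v h c e
    using that y by (simp add: y sum_to_def)
  have cd: "y \<notin> free_vars common_denom" using y by (simp add: y common_denom_def denom_addr_def)
  have sc: "y \<notin> free_vars (scaled_entry k)" if "y \<notin> free_vars k" for k
    using that y by (simp add: y scaled_entry_def denom_addr_def numer_addr_def)
  have z: "y \<notin> free_vars (zE j)" and d: "y \<notin> free_vars (dE j)" if "y \<notin> free_vars j" for j
    using that y by (simp_all add: zE_def dE_def sc)
  have lv: "y \<notin> free_vars (level_dE j)" if "y \<notin> free_vars j" for j
    using that y by (simp add: y level_dE_def sum_to in_S d)
  have ex: "y \<notin> free_vars (excessE j)" if "y \<notin> free_vars j" for j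
    using that y by (simp add: y excessE_def in_S d lv)
  have g: "y \<notin> free_vars (gainE j)" if "y \<notin> free_vars j" for j
    using that y by (simp add: y gainE_def z ex)
  have ch: "y \<notin> free_vars (chosenE j)" if "y \<notin> free_vars j" for j
    using that y by (simp add: y chosenE_def rankE_def sum_to g classE_def by_class_def in_S)
  show ?thesis
    using y by (simp add: y valueE_def value_cases_def sumJ_def guard_def between_def in_S sum_to cd z d ex g ch)
qed

lemma nth_concat_const:
  assumes "\<And>x. x \<in> set xs \<Longrightarrow> length (f x) = c" "i < length xs" "j < c"
  shows "concat (map f xs) ! (i * c + j) = f (xs ! i) ! j"
  using assms
proof (induction xs arbitrary: i)
  case (Cons x xs)
  then show ?case by (cases i) (simp_all add: nth_append add.assoc)
qed simp

lemma length_concat_const: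
  "(\<And>x. x \<in> set xs \<Longrightarrow> length (f x) = c) \<Longrightarrow> length (concat (map f xs)) = length xs * c"
  by (induction xs) auto

section \<open>Values of the expressions on an instance\<close>

text \<open>
  Outside the intersection, the top set and \<open>A\<close> have equally many elements, and each one of the former is
  at least as good as each one of the latter.
\<close>
lemma top_set_sum_le:
  fixes g :: "nat \<Rightarrow> int"
  assumes G: "finite G" and A: "A \<subseteq> G"
  shows "(\<Sum>j\<in>A. g j) \<le> (\<Sum>j\<in>top_set G g (card A). g j)"
proof -
  let ?T = "top_set G g (card A)"
  have fin: "finite A" "finite ?T" using A G top_set_subset finite_subset by metis+
  have cT: "card ?T = card A" using card_top_set[OF G, of g "card A"] card_mono[OF G A] by simp
  have diff: "card (A - ?T) = card (?T - A)"
    using card_Diff_subset_Int[of A ?T] card_Diff_subset_Int[of ?T A] fin cT by (simp add: Int_commute)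
  have "(\<Sum>j\<in>A - ?T. g j) \<le> (\<Sum>j\<in>?T - A. g j)"
  proof (cases "A - ?T = {}")
    case True
    then have "card (?T - A) = 0" using diff by (simp only: card.empty)
    then have "?T - A = {}" using fin by (simp only: card_0_eq finite_Diff)
    then show ?thesis using True by simp
  next
    case False
    define M where "M = Max (g ` (A - ?T))"
    have "M \<in> g ` (A - ?T)" unfolding M_def using False fin by (intro Max_in) auto
    then obtain j where j: "j \<in> A - ?T" "g j = M" by auto
    have "(\<Sum>j\<in>A - ?T. g j) \<le> of_nat (card (A - ?T)) * M"
      by (rule sum_bounded_above) (use fin in \<open>auto simp: M_def intro: Max_ge\<close>)
    also have "\<dots> = of_nat (card (?T - A)) * M" by (simp add: diff)
    also have "\<dots> \<le> (\<Sum>j\<in>?T - A. g j)"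
    proof (rule sum_bounded_below)
      fix i assume "i \<in> ?T - A"
      then show "M \<le> g i" using top_set_ge[OF G, of i g "card A" j] j A by auto
    qed
    finally show ?thesis .
  qed
  moreover have "(\<Sum>j\<in>A. g j) = (\<Sum>j\<in>A \<inter> ?T. g j) + (\<Sum>j\<in>A - ?T. g j)"
    "(\<Sum>j\<in>?T. g j) = (\<Sum>j\<in>?T \<inter> A. g j) + (\<Sum>j\<in>?T - A. g j)"
    using fin by (simp_all flip: sum.Int_Diff)
  ultimately show ?thesis by (simp add: Int_commute)
qed

lemma eval_by_code:
  "env Code = int (k + i) \<Longrightarrow>
    eval_ex inp (by_code (int k) es) env = (if i < length es then eval_ex inp (es ! i) env else 0)"
proof (induction es arbitrary: k i)
  case (Cons e es)
  show ?case
  proof (cases i)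
    case 0
    then show ?thesis using Cons.prems by simp
  next
    case (Suc i')
    then have "eval_ex inp (by_code (int (Suc k)) es) env = (if i' < length es then eval_ex inp (es ! i') env else 0)"
      using Cons.prems by (intro Cons.IH) simp
    then show ?thesis using Suc Cons.prems by (simp add: add.commute)
  qed
qed simp

locale separation_instance = nested_system +
  fixes z d :: "nat \<Rightarrow> rat"
  assumes z_vec: "z \<in> vecs n" and d_vec: "d \<in> vecs m"
begin

definition encoding :: "int list" where
  "encoding = encode_input (n, m, l, u, S, z, d)"

definition inp :: memory where
  "inp = initial_memory encoding"

definition entry :: "nat \<Rightarrow> rat" where
  "entry k = (if k < n then z (Suc k) else d (Suc (k - n)))"

definition nume :: "nat \<Rightarrow> int" where
  "nume k = fst (quotient_of (entry k))"

definition deno :: "nat \<Rightarrow> int" where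
  "deno k = snd (quotient_of (entry k))"

lemma encoding_eq: "encoding = [int n, int m, int l, int u]
    @ concat (map (\<lambda>i. map (\<lambda>j. if j \<in> S i then 1 else 0) [1..<n + 1]) [1..<m + 1])
    @ concat (map (\<lambda>k. [nume k, deno k]) [0..<n + m])"
proof -
  have "concat (map (\<lambda>j. encode_rat (z j)) [1..<n + 1])
      = concat (map (\<lambda>k. [nume k, deno k]) [0..<n])"
  proof -
    have "map (\<lambda>j. encode_rat (z j)) [1..<n + 1] = map (\<lambda>k. [nume k, deno k]) [0..<n]"
      by (rule nth_equalityI) (auto simp: encode_rat_def nume_def deno_def entry_def simp del: upt_Suc)
    then show ?thesis by simp
  qed
  moreover have "concat (map (\<lambda>i. encode_rat (d i)) [1..<m + 1])
      = concat (map (\<lambda>k. [nume k, deno k]) [n..<n + m])"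
  proof -
    have "map (\<lambda>i. encode_rat (d i)) [1..<m + 1] = map (\<lambda>k. [nume k, deno k]) [n..<n + m]"
      by (rule nth_equalityI) (auto simp: encode_rat_def nume_def deno_def entry_def simp del: upt_Suc)
    then show ?thesis by simp
  qed
  ultimately show ?thesis
    by (simp add: encoding_def upt_add_eq_append[of 0 n m] del: upt_Suc)
qed

lemma length_encoding: "length encoding = 4 + m * n + (n + m) * 2"
proof -
  have "length (concat (map (\<lambda>i. map (\<lambda>j. if j \<in> S i then 1 else 0 :: int) [1..<n + 1]) [1..<m + 1]))
      = length [1..<m + 1] * n"
    by (rule length_concat_const) simp
  moreover have "length (concat (map (\<lambda>k. [nume k, deno k]) [0..<n + m])) = length [0..<n + m] * 2"
    by (rule length_concat_const) simp
  ultimately show ?thesis by (simp add: encoding_eq del: upt_Suc)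
qed

lemma n_ge: "3 \<le> n"
proof -
  have "card (S 1) \<le> card (S m)" using m_pos by (intro card_mono finite_S S_mono) auto
  moreover have "card (S m) < card J" using SmJ by (intro psubset_card_mono) auto
  ultimately show ?thesis using cardS1 by simp
qed

text \<open>
  The loops run over the indices below the length of the input. These bounds say that they reach all
  elements, sets, codes and output positions.
\<close>
lemma sizes: "n < length encoding" "m < length encoding" "n + m < length encoding" "11 \<le> length encoding"
    "n + 2 < length encoding"
  using n_ge m_pos by (simp_all add: length_encoding)

lemma inp_0: "inp 0 = int (length encoding)"
  by (simp add: inp_def initial_memory_def)

lemma inp_at: "k < length encoding \<Longrightarrow> inp (int k + 1) = encoding ! k"
  by (simp add: inp_def initial_memory_def)

lemma inp_header: "inp 1 = int n" "inp 2 = int m" "inp 3 = int l" "inp 4 = int u"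
  using inp_at[of 0] inp_at[of 1] inp_at[of 2] inp_at[of 3] sizes
  by (simp_all add: encoding_eq)

lemma inp_incidence:
  assumes i: "i \<in> {1..m}" and j: "j \<in> {1..n}"
  shows "inp (4 + (int i - 1) * int n + int j) = (if j \<in> S i then 1 else 0)"
proof -
  let ?k = "(i - 1) * n + (j - 1)"
  let ?rows = "concat (map (\<lambda>i. map (\<lambda>j. if j \<in> S i then 1 else 0 :: int) [1..<n + 1]) [1..<m + 1])"
  have len: "length ?rows = m * n"
    using length_concat_const[of "[1..<m + 1]" "\<lambda>i. map (\<lambda>j. if j \<in> S i then 1 else 0 :: int) [1..<n + 1]" n]
    by (simp del: upt_Suc)
  have "(i - 1) * n + (j - 1) < (i - 1) * n + n" using j by auto
  also have "\<dots> = i * n" using i by (cases i) auto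
  also have "\<dots> \<le> m * n" using i by (intro mult_le_mono1) auto
  finally have k: "?k < m * n" .
  then have "inp (int (4 + ?k) + 1) = encoding ! (4 + ?k)"
    by (intro inp_at) (simp add: length_encoding)
  also have "encoding ! (4 + ?k) = ?rows ! ?k"
    using k len by (simp add: encoding_eq nth_append del: upt_Suc)
  also have "\<dots> = (map (\<lambda>j. if j \<in> S ([1..<m + 1] ! (i - 1)) then 1 else 0) [1..<n + 1]) ! (j - 1)"
    by (rule nth_concat_const) (use i j in auto)
  also have "\<dots> = (if j \<in> S i then 1 else 0)"
  proof -
    have "i - 1 < length [1..<m + 1]" "j - 1 < length [1..<n + 1]" using i j by auto
    then have "[1..<m + 1] ! (i - 1) = i" "[1..<n + 1] ! (j - 1) = j" using i j by (auto simp del: upt_Suc)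
    with \<open>j - 1 < length [1..<n + 1]\<close> show ?thesis by (simp only: nth_map)
  qed
  also have "int (4 + ?k) + 1 = 4 + (int i - 1) * int n + int j"
    using i j by (simp add: of_nat_diff)
  finally show ?thesis .
qed

lemma inp_entry:
  assumes k: "k < n + m"
  shows "inp (5 + int n * int m + (int k + int k)) = nume k"
    and "inp (6 + int n * int m + (int k + int k)) = deno k"
proof -
  let ?rows = "concat (map (\<lambda>i. map (\<lambda>j. if j \<in> S i then 1 else 0 :: int) [1..<n + 1]) [1..<m + 1])"
  have len: "length ?rows = m * n"
    using length_concat_const[of "[1..<m + 1]" "\<lambda>i. map (\<lambda>j. if j \<in> S i then 1 else 0 :: int) [1..<n + 1]" n]
    by (simp del: upt_Suc)
  have *: "inp (int (4 + m * n + (k * 2 + r)) + 1) = [nume k, deno k] ! r" if r: "r < 2" for r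
  proof -
    have "k * 2 + r < (n + m) * 2" using k r by presburger
    then have "inp (int (4 + m * n + (k * 2 + r)) + 1) = encoding ! (4 + m * n + (k * 2 + r))"
      by (intro inp_at) (simp add: length_encoding)
    also have "\<dots> = concat (map (\<lambda>k. [nume k, deno k]) [0..<n + m]) ! (k * 2 + r)"
      using len by (simp add: encoding_eq nth_append add.assoc del: upt_Suc)
    also have "\<dots> = [nume ([0..<n + m] ! k), deno ([0..<n + m] ! k)] ! r"
      by (rule nth_concat_const) (use k r in auto)
    finally show ?thesis using k by simp
  qed
  have addr: "int (4 + m * n + (k * 2 + 0)) + 1 = 5 + int n * int m + (int k + int k)"
    "int (4 + m * n + (k * 2 + 1)) + 1 = 6 + int n * int m + (int k + int k)" by simp_all
  show "inp (5 + int n * int m + (int k + int k)) = nume k"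
    "inp (6 + int n * int m + (int k + int k)) = deno k"
    using *[of 0, unfolded addr] *[of 1, unfolded addr] by simp_all
qed

abbreviation ev :: "var ex \<Rightarrow> (var \<Rightarrow> int) \<Rightarrow> int" where
  "ev e env \<equiv> eval_ex inp e env"

lemma input_at_nonneg: "0 \<le> a \<Longrightarrow> input_at inp a = inp a"
  by (simp add: input_at_def)

lemma ev_header [simp]: "input_at inp 1 = int n" "input_at inp 2 = int m"
    "input_at inp 3 = int l" "input_at inp 4 = int u"
  by (simp_all add: input_at_def inp_header)

lemma ev_in_S:
  assumes "0 \<le> ev i env" "ev i env \<le> int m" "1 \<le> ev j env" "ev j env \<le> int n"
  shows "0 < ev (in_S i j) env \<longleftrightarrow> nat (ev j env) \<in> S (nat (ev i env))"
proof (cases "ev i env = 0")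
  case True
  then show ?thesis by (simp add: in_S_def S0)
next
  case False
  let ?i = "nat (ev i env)" and ?j = "nat (ev j env)"
  have ij: "?i \<in> {1..m}" "?j \<in> {1..n}" "ev i env = int ?i" "ev j env = int ?j"
    using assms False by auto
  have "0 \<le> (int ?i - 1) * int n" by (intro mult_nonneg_nonneg) (use assms False in auto)
  then have "input_at inp (4 + ((int ?i - 1) * int n + int ?j)) = (if ?j \<in> S ?i then 1 else 0)"
    using inp_incidence[OF ij(1,2)] by (simp add: input_at_nonneg add.assoc)
  then show ?thesis using False assms by (simp add: in_S_def)
qed

definition Q :: int where
  "Q = (\<Prod>k\<in>{..<n + m}. deno k)"

definition scaled :: "nat \<Rightarrow> int" where
  "scaled k = nume k * (\<Prod>k'\<in>{..<n + m} - {k}. deno k')"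

lemma deno_pos: "0 < deno k"
  unfolding deno_def by (rule quotient_of_denom_pos')

lemma Q_pos: "0 < Q"
  unfolding Q_def by (intro prod_pos ballI deno_pos)

lemma scaled_eq:
  assumes "k < n + m"
  shows "real_of_int (scaled k) = real_of_int Q * of_rat (entry k)"
proof -
  have "entry k = of_int (nume k) / of_int (deno k)"
    unfolding nume_def deno_def by (rule quotient_of_div) (simp add: prod_eq_iff)
  then have "(of_rat (entry k) :: real) = of_int (nume k) / of_int (deno k)" by (simp add: of_rat_divide)
  moreover have "Q = deno k * (\<Prod>k'\<in>{..<n + m} - {k}. deno k')"
    unfolding Q_def using assms by (intro prod.remove) auto
  moreover have "real_of_int (deno k) \<noteq> 0" using deno_pos[of k] by simp
  ultimately show ?thesis by (simp add: scaled_def)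
qed

lemma ev_denom_addr:
  assumes "ev k env = int k'" "k' < n + m"
  shows "input_at inp (ev (denom_addr k) env) = deno k'"
  using inp_entry(2)[OF assms(2)] assms(1) by (simp add: denom_addr_def input_at_nonneg)

lemma ev_common_denom: "ev common_denom env = Q"
proof -
  have "ev common_denom env = 1 * (\<Prod>k\<in>{k. k < nat (inp 0) \<and> k < n + m}. deno k)"
    unfolding common_denom_def eval_ex.simps
    by (rule iterate_prod) (auto simp: ev_denom_addr)
  also have "{k. k < nat (inp 0) \<and> k < n + m} = {..<n + m}" using sizes(3) by (auto simp: inp_0)
  finally show ?thesis by (simp add: Q_def)
qed

lemma ev_scaled_entry:
  assumes "0 \<le> ev k env" "ev k env < int (n + m)"
  shows "ev (scaled_entry k) env = scaled (nat (ev k env))"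
proof -
  let ?k = "nat (ev k env)"
  have k: "ev k env = int ?k" "?k < n + m" using assms by auto
  have "ev (scaled_entry k) env = nume ?k * (\<Prod>k\<in>{k'. k' < nat (inp 0) \<and> (k' < n + m \<and> k' \<noteq> ?k)}. deno k)"
    unfolding scaled_entry_def eval_ex.simps
  proof (subst iterate_prod[where P = "\<lambda>k'. k' < n + m \<and> k' \<noteq> ?k" and F = deno])
    show "input_at inp (ev (numer_addr (Var Ent)) (env(Ent := ev k env)))
        * prod deno {k'. k' < nat (inp 0) \<and> (k' < n + m \<and> k' \<noteq> ?k)}
      = nume ?k * prod deno {k'. k' < nat (inp 0) \<and> (k' < n + m \<and> k' \<noteq> ?k)}"
      using inp_entry(1)[OF k(2)] assms by (simp add: numer_addr_def input_at_nonneg)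
  qed (use k in \<open>auto simp: ev_denom_addr\<close>)
  also have "{k'. k' < nat (inp 0) \<and> (k' < n + m \<and> k' \<noteq> ?k)} = {..<n + m} - {?k}"
    using sizes(3) by (auto simp: inp_0)
  finally show ?thesis by (simp add: scaled_def)
qed

definition zi :: "nat \<Rightarrow> int" where "zi j = scaled (j - 1)"
definition di :: "nat \<Rightarrow> int" where "di i = scaled (n + i - 1)"

abbreviation zr :: "nat \<Rightarrow> real" where "zr \<equiv> \<lambda>j. of_rat (z j)"
abbreviation dr :: "nat \<Rightarrow> real" where "dr \<equiv> \<lambda>i. of_rat (d i)"

lemma real_zi: "j \<in> J \<Longrightarrow> real_of_int (zi j) = real_of_int Q * zr j"
  unfolding zi_def by (subst scaled_eq) (auto simp: entry_def)

lemma real_di: "i \<in> {1..m} \<Longrightarrow> real_of_int (di i) = real_of_int Q * dr i"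
  unfolding di_def by (subst scaled_eq) (auto simp: entry_def)

lemma ev_zE: "1 \<le> ev j env \<Longrightarrow> ev j env \<le> int n \<Longrightarrow> ev (zE j) env = zi (nat (ev j env))"
  by (simp add: zE_def ev_scaled_entry zi_def nat_diff_distrib')

lemma ev_dE: "1 \<le> ev i env \<Longrightarrow> ev i env \<le> int m \<Longrightarrow> ev (dE i) env = di (nat (ev i env))"
proof -
  assume i: "1 \<le> ev i env" "ev i env \<le> int m"
  then have "nat (int n + (ev i env - 1)) = n + nat (ev i env) - 1" by linarith
  then show ?thesis using i by (simp add: dE_def ev_scaled_entry di_def)
qed

definition level_d :: "nat \<Rightarrow> int" where
  "level_d j = (if lev j \<le> m then di (lev j) else 0)"

lemma real_level_d: "real_of_int (level_d j) = real_of_int Q * dr (lev j)"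
proof (cases "lev j \<le> m")
  case True
  then show ?thesis using lev_pos[of j] by (simp add: level_d_def real_di)
next
  case False
  then have "d (lev j) = 0" using d_vec by (auto simp: vecs_def)
  then show ?thesis using False by (simp add: level_d_def)
qed

lemma n_m_less_inp: "int n < inp 0" "int m < inp 0"
  using sizes by (simp_all add: inp_0)

lemma ev_level_dE:
  assumes "1 \<le> ev j env" "ev j env \<le> int n"
  shows "ev (level_dE j) env = level_d (nat (ev j env))"
proof -
  let ?j = "nat (ev j env)"
  have "ev (level_dE j) env = (\<Sum>i\<in>{i \<in> {1..m}. ?j \<in> S i \<and> ?j \<notin> S (i - 1)}. di i)"
    unfolding level_dE_def eval_ex.simps(8)
    by (rule eval_sum_to[where inp = inp and N = m, OF _ n_m_less_inp(2)])
      (use assms in \<open>auto simp: ev_in_S ev_dE nat_diff_distrib'\<close>)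
  also have "{i \<in> {1..m}. ?j \<in> S i \<and> ?j \<notin> S (i - 1)} = (if lev ?j \<le> m then {lev ?j} else {})"
    using lev_pos[of ?j] by (auto simp: mem_S_iff)
  finally show ?thesis by (simp add: level_d_def)
qed

definition excess :: "nat \<Rightarrow> nat \<Rightarrow> int" where
  "excess p j = (if j \<in> S p then 0 else level_d j - di p)"

lemma real_excess: "p \<in> {1..m} \<Longrightarrow>
    real_of_int (excess p j) = real_of_int Q * (if p < lev j then dr (lev j) - dr p else 0)"
  by (auto simp: excess_def real_level_d real_di mem_S_iff right_diff_distrib)

lemma ev_excessE:
  assumes "1 \<le> env Pv" "env Pv \<le> int m" "1 \<le> ev j env" "ev j env \<le> int n"
  shows "ev (excessE j) env = excess (nat (env Pv)) (nat (ev j env))"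
  using assms by (simp add: excessE_def excess_def ev_in_S ev_level_dE ev_dE)

definition gain :: "bool \<Rightarrow> nat \<Rightarrow> nat \<Rightarrow> int" where
  "gain up p j = (if up then zi j + excess p j else - (zi j + excess p j))"

lemma ev_gainE:
  assumes "1 \<le> env Pv" "env Pv \<le> int m" "1 \<le> ev j env" "ev j env \<le> int n"
  shows "ev (gainE j) env = gain (env Code = 9) (nat (env Pv)) (nat (ev j env))"
  using assms by (simp add: gainE_def gain_def ev_excessE ev_zE)

definition classify :: "nat \<Rightarrow> nat \<Rightarrow> 'b \<Rightarrow> 'b \<Rightarrow> 'b \<Rightarrow> 'b" where
  "classify p j x y w = (if j \<in> S (p - 1) then x else if j \<in> S p then y else w)"

lemma ev_by_class:
  assumes "1 \<le> env Pv" "env Pv \<le> int m" "1 \<le> ev j env" "ev j env \<le> int n"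
  shows "ev (by_class j x y w) env
    = classify (nat (env Pv)) (nat (ev j env)) (ev x env) (ev y env) (ev w env)"
  using assms by (simp add: by_class_def classify_def ev_in_S nat_diff_distrib')

definition same_class :: "nat \<Rightarrow> nat \<Rightarrow> nat set" where
  "same_class p j = {i \<in> J. classify p i (0::int) 1 2 = classify p j 0 1 2}"

lemma ev_rankE:
  assumes P: "1 \<le> env Pv" "env Pv \<le> int m" and j: "1 \<le> ev j env" "ev j env \<le> int n"
  shows "ev (rankE j) env = int (rank_in (same_class (nat (env Pv)) (nat (ev j env)))
    (gain (env Code = 9) (nat (env Pv))) (nat (ev j env)))"
proof -
  let ?p = "nat (env Pv)" and ?j = "nat (ev j env)"
  let ?g = "gain (env Code = 9) ?p"
  let ?R = "\<lambda>i. classify ?p i (0::int) 1 2 = classify ?p ?j 0 1 2 \<and> (?g ?j < ?g i \<or> ?g i = ?g ?j \<and> i < ?j)"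
  have "ev (rankE j) env = (\<Sum>i\<in>{i \<in> {1..n}. ?R i}. 1)"
    unfolding rankE_def eval_ex.simps(8)
    by (rule eval_sum_to[where inp = inp and N = n, OF _ n_m_less_inp(1)])
      (use assms in \<open>auto simp: classE_def ev_by_class ev_gainE\<close>)
  also have "\<dots> = int (card {i \<in> {1..n}. ?R i})" by simp
  also have "{i \<in> {1..n}. ?R i} = {i \<in> same_class ?p ?j. ?g ?j < ?g i \<or> ?g i = ?g ?j \<and> i < ?j}"
    unfolding same_class_def by blast
  finally show ?thesis by (simp add: rank_in_def)
qed

definition chosen :: "bool \<Rightarrow> nat \<Rightarrow> nat \<Rightarrow> nat \<Rightarrow> nat \<Rightarrow> nat set" where
  "chosen up p a b e = {j \<in> J. rank_in (same_class p j) (gain up p) j < classify p j a b e}"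

lemma ev_chosenE:
  assumes P: "1 \<le> env Pv" "env Pv \<le> int m" and j: "1 \<le> ev j env" "ev j env \<le> int n"
    and "env A0 = int a" "env A1 = int b" "env A2 = int e"
  shows "0 < ev (chosenE j) env \<longleftrightarrow> nat (ev j env) \<in> chosen (env Code = 9) (nat (env Pv)) a b e"
  using assms by (auto simp: chosenE_def ev_rankE ev_by_class chosen_def classify_def)

end

section \<open>Candidates and their optimality\<close>

lemma position_unique:
  fixes T :: "nat set"
  assumes fin: "finite T" and q: "q < card T"
  shows "{j \<in> T. card {i \<in> T. i < j} = q} = {sorted_list_of_set T ! q}"
proof -
  let ?xs = "sorted_list_of_set T"
  have xs: "sorted_wrt (<) ?xs" "set ?xs = T" "length ?xs = card T" "distinct ?xs"
    using fin by (simp_all add: strict_sorted_list_of_set)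
  have less: "?xs ! i < ?xs ! r \<longleftrightarrow> i < r" if "i < card T" "r < card T" for i r
    using that sorted_wrt_nth_less[OF xs(1), of i r] sorted_wrt_nth_less[OF xs(1), of r i] xs(3)
    by (metis less_asym linorder_neqE_nat)
  have pos: "card {i \<in> T. i < ?xs ! r} = r" if r: "r < card T" for r
  proof -
    have "{i \<in> T. i < ?xs ! r} = (!) ?xs ` {..<r}"
    proof (intro set_eqI iffI)
      fix j assume "j \<in> {i \<in> T. i < ?xs ! r}"
      then obtain i where "i < card T" "j = ?xs ! i" "j < ?xs ! r" using xs(2,3) by (metis (no_types, lifting) in_set_conv_nth mem_Collect_eq)
      then show "j \<in> (!) ?xs ` {..<r}" using less[OF _ r] by auto
    next
      fix j assume "j \<in> (!) ?xs ` {..<r}"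
      then obtain i where i: "i < r" "j = ?xs ! i" by auto
      then have "j \<in> set ?xs" using r xs(3) by (auto intro!: nth_mem simp del: xs(2))
      then show "j \<in> {i \<in> T. i < ?xs ! r}" using i r less[of i r] xs(2) by auto
    qed
    moreover have "inj_on ((!) ?xs) {..<r}" using xs(3,4) r by (auto intro!: inj_on_nth)
    ultimately show ?thesis by (simp add: card_image)
  qed
  show ?thesis
  proof (intro set_eqI iffI)
    fix j assume j: "j \<in> {j \<in> T. card {i \<in> T. i < j} = q}"
    then obtain r where "r < card T" "j = ?xs ! r" using xs(2,3) by (metis (no_types, lifting) in_set_conv_nth mem_Collect_eq)
    then show "j \<in> {?xs ! q}" using pos[of r] j by auto
  next
    fix j assume j: "j \<in> {?xs ! q}"
    moreover have "?xs ! q \<in> set ?xs" by (rule nth_mem) (simp only: q xs(3))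
    ultimately show "j \<in> {j \<in> T. card {i \<in> T. i < j} = q}"
      using pos[OF q] xs(2) by simp
  qed
qed

context separation_instance
begin

lemma cells:
  assumes p: "p \<in> {1..m}"
  shows "S (p - 1) \<subseteq> S p" "S p \<subseteq> J" "S (p - 1) \<subseteq> J" "finite (S p)" "finite (S (p - 1))"
  using p S_mono[of "p - 1" p] S_subset[of p] S_subset[of "p - 1"] finite_S[of p] finite_S[of "p - 1"] by auto

lemma same_class_cell:
  assumes p: "p \<in> {1..m}"
  shows "j \<in> S (p - 1) \<Longrightarrow> same_class p j = S (p - 1)"
    and "j \<in> S p - S (p - 1) \<Longrightarrow> same_class p j = S p - S (p - 1)"
    and "j \<in> J - S p \<Longrightarrow> same_class p j = J - S p"
  using cells[OF p] by (auto simp: same_class_def classify_def split: if_splits)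

lemma chosen_subset: "chosen up p a b e \<subseteq> J"
  by (auto simp: chosen_def)

lemma chosen_cells:
  assumes p: "p \<in> {1..m}"
  shows "chosen up p a b e \<inter> S (p - 1) = top_set (S (p - 1)) (gain up p) a"
    and "chosen up p a b e \<inter> (S p - S (p - 1)) = top_set (S p - S (p - 1)) (gain up p) b"
    and "chosen up p a b e - S p = top_set (J - S p) (gain up p) e"
proof -
  note c = cells[OF p] and k = same_class_cell[OF p]
  show "chosen up p a b e \<inter> S (p - 1) = top_set (S (p - 1)) (gain up p) a"
    using c by (auto simp: chosen_def top_set_def k classify_def)
  show "chosen up p a b e \<inter> (S p - S (p - 1)) = top_set (S p - S (p - 1)) (gain up p) b"
    using c by (auto simp: chosen_def top_set_def k classify_def)
  show "chosen up p a b e - S p = top_set (J - S p) (gain up p) e"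
    using c by (auto simp: chosen_def top_set_def k classify_def)
qed

lemma split_cells:
  assumes p: "p \<in> {1..m}" and A: "A \<subseteq> J"
  shows "(\<Sum>j\<in>A. f j) = (\<Sum>j\<in>A \<inter> S (p - 1). f j) + (\<Sum>j\<in>A \<inter> (S p - S (p - 1)). f j) + (\<Sum>j\<in>A - S p. f j)"
    (is ?sum)
    and "card (A \<union> S p) = card (S p) + card (A - S p)"
    and "card (A \<union> S (p - 1)) = card (S (p - 1)) + card (A \<inter> (S p - S (p - 1))) + card (A - S p)"
proof -
  note c = cells[OF p]
  have fin: "finite A" using A finite_subset by blast
  have "A = (A \<inter> S (p - 1) \<union> A \<inter> (S p - S (p - 1))) \<union> (A - S p)" using c by auto
  then have "sum f A = sum f ((A \<inter> S (p - 1) \<union> A \<inter> (S p - S (p - 1))) \<union> (A - S p))" by simp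
  also have "\<dots> = sum f (A \<inter> S (p - 1) \<union> A \<inter> (S p - S (p - 1))) + sum f (A - S p)"
    by (rule sum.union_disjoint) (use fin c in auto)
  also have "sum f (A \<inter> S (p - 1) \<union> A \<inter> (S p - S (p - 1)))
      = sum f (A \<inter> S (p - 1)) + sum f (A \<inter> (S p - S (p - 1)))"
    by (rule sum.union_disjoint) (use fin in auto)
  finally show ?sum .
  have "A \<union> S p = S p \<union> (A - S p)" by auto
  then show "card (A \<union> S p) = card (S p) + card (A - S p)"
    using card_Un_disjoint[of "S p" "A - S p"] fin c by auto
  have "A \<union> S (p - 1) = (S (p - 1) \<union> A \<inter> (S p - S (p - 1))) \<union> (A - S p)" using c by auto
  then have "card (A \<union> S (p - 1)) = card ((S (p - 1) \<union> A \<inter> (S p - S (p - 1))) \<union> (A - S p))" by simp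
  also have "\<dots> = card (S (p - 1) \<union> A \<inter> (S p - S (p - 1))) + card (A - S p)"
    by (rule card_Un_disjoint) (use fin c in auto)
  also have "card (S (p - 1) \<union> A \<inter> (S p - S (p - 1))) = card (S (p - 1)) + card (A \<inter> (S p - S (p - 1)))"
    by (rule card_Un_disjoint) (use fin c in auto)
  finally show "card (A \<union> S (p - 1)) = card (S (p - 1)) + card (A \<inter> (S p - S (p - 1))) + card (A - S p)" .
qed

text \<open>
  The side conditions of the lifted inequalities involve only the number of elements in each class.
  The set made up of the best elements has the same numbers as \<open>A\<close>, hence remains admissible.
\<close>
lemma chosen_dominates:
  fixes up :: bool
  assumes p: "p \<in> {1..m}" and A: "A \<subseteq> J"
  defines "T \<equiv> chosen up p (card (A \<inter> S (p - 1))) (card (A \<inter> (S p - S (p - 1)))) (card (A - S p))"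
  shows "card (T - S p) = card (A - S p)" "card (T \<union> S p) = card (A \<union> S p)"
    "card (T \<union> S (p - 1)) = card (A \<union> S (p - 1))"
    "(\<Sum>j\<in>A. gain up p j) \<le> (\<Sum>j\<in>T. gain up p j)"
proof -
  note c = cells[OF p]
  have TJ: "T \<subseteq> J" unfolding T_def by (rule chosen_subset)
  have T: "T \<inter> S (p - 1) = top_set (S (p - 1)) (gain up p) (card (A \<inter> S (p - 1)))"
    "T \<inter> (S p - S (p - 1)) = top_set (S p - S (p - 1)) (gain up p) (card (A \<inter> (S p - S (p - 1))))"
    "T - S p = top_set (J - S p) (gain up p) (card (A - S p))"
    unfolding T_def by (rule chosen_cells[OF p])+
  have c3: "card (T - S p) = card (A - S p)"
  proof -
    have "card (A - S p) \<le> card (J - S p)" by (rule card_mono) (use A in auto)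
    then show ?thesis unfolding T using c by (simp add: card_top_set)
  qed
  have c2: "card (T \<inter> (S p - S (p - 1))) = card (A \<inter> (S p - S (p - 1)))"
  proof -
    have "card (A \<inter> (S p - S (p - 1))) \<le> card (S p - S (p - 1))" by (rule card_mono) (use c in auto)
    then show ?thesis unfolding T using c by (simp add: card_top_set)
  qed
  show "card (T - S p) = card (A - S p)" by (rule c3)
  show "card (T \<union> S p) = card (A \<union> S p)"
    unfolding split_cells(2)[OF p TJ] split_cells(2)[OF p A] c3 ..
  show "card (T \<union> S (p - 1)) = card (A \<union> S (p - 1))"
    unfolding split_cells(3)[OF p TJ] split_cells(3)[OF p A] c2 c3 ..
  show "(\<Sum>j\<in>A. gain up p j) \<le> (\<Sum>j\<in>T. gain up p j)"
    unfolding split_cells(1)[OF p TJ] split_cells(1)[OF p A] T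
    by (intro add_mono top_set_sum_le) (use c A in auto)
qed

lemma l_le_n: "l \<le> n"
  using l_le by simp

lemma dr_Suc_m: "dr (m + 1) = 0"
  using d_vec by (simp add: vecs_def)

text \<open>
  After scaling, the violation is an integer that depends on \<open>A\<close> through a sum of gains only. For the
  second family, the elements outside \<open>A\<close> contribute; they are complemented within \<open>J\<close>, which turns
  their contribution into a constant minus one of the elements of \<open>A\<close>.
\<close>
lemma scaled_Upper_lift:
  assumes p: "p \<in> {1..m}" and A: "A \<subseteq> J"
  shows "real_of_int Q * violation n m l u S (zr, dr) (Upper_lift p A)
    = real_of_int ((di p - Q) * int u + (\<Sum>j\<in>A. gain True p j))"
proof -
  have fin: "finite A" using A finite_subset by blast
  have "(\<Sum>j\<in>{j \<in> A. p < lev j}. dr (lev j) - dr p) = (\<Sum>j\<in>A. if p < lev j then dr (lev j) - dr p else 0)"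
    by (rule sum.inter_filter[OF fin])
  moreover have "real_of_int (\<Sum>j\<in>A. gain True p j)
      = real_of_int Q * ((\<Sum>j\<in>A. zr j) + (\<Sum>j\<in>A. if p < lev j then dr (lev j) - dr p else 0))"
    unfolding sum.distrib[symmetric] sum_distrib_left of_int_sum
    by (intro sum.cong refl) (use A p in \<open>simp add: gain_def real_zi real_excess subset_iff distrib_left\<close>)
  ultimately show ?thesis
    unfolding violation_Upper_lift[where d = dr, OF p A dr_Suc_m]
    using real_di[OF p] by (simp add: algebra_simps)
qed

lemma scaled_Lower_lift:
  assumes p: "p \<in> {1..m}" and A: "A \<subseteq> J"
  shows "real_of_int Q * violation n m l u S (zr, dr) (Lower_lift p A)
    = real_of_int (di p * int l + (\<Sum>j\<in>J. excess p j) + (\<Sum>j\<in>A. gain False p j))"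
proof -
  have fin: "finite A" using A finite_subset by blast
  let ?x = "\<lambda>j. if p < lev j then dr (lev j) - dr p else 0"
  have "(\<Sum>j\<in>{j \<in> J - A. p < lev j}. dr (lev j) - dr p) = (\<Sum>j\<in>J - A. ?x j)"
    by (rule sum.inter_filter) simp
  moreover have "(\<Sum>j\<in>J. ?x j) = (\<Sum>j\<in>J - A. ?x j) + (\<Sum>j\<in>A. ?x j)"
    using A by (intro sum.subset_diff) auto
  moreover have "real_of_int (\<Sum>j\<in>A. gain False p j) = - (real_of_int Q * ((\<Sum>j\<in>A. zr j) + (\<Sum>j\<in>A. ?x j)))"
    unfolding sum.distrib[symmetric] sum_distrib_left of_int_sum sum_negf[symmetric]
    by (intro sum.cong refl) (use A p in \<open>simp add: gain_def real_zi real_excess subset_iff distrib_left\<close>)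
  moreover have "real_of_int (\<Sum>j\<in>J. excess p j) = real_of_int Q * (\<Sum>j\<in>J. ?x j)"
    unfolding sum_distrib_left of_int_sum
    by (intro sum.cong refl) (use p in \<open>simp add: real_excess\<close>)
  ultimately show ?thesis
    unfolding violation_Lower_lift[where d = dr, OF p A dr_Suc_m]
    using real_di[OF p] by (simp add: algebra_simps)
qed

text \<open>The order is that of the codes of \<open>encode_ineq\<close>.\<close>
definition candidates :: "nat \<Rightarrow> nat \<Rightarrow> nat \<Rightarrow> nat \<Rightarrow> ineq list" where
  "candidates p a b e = [Card_ge, Card_le, Pair_le p a, Cover_first, Mono p, Cover_step p, Last_nonneg,
     Nonneg p, Le_one p, Upper_lift p (chosen True p a b e), Lower_lift p (chosen False p a b e)]"

lemma ev_sumJ: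
  assumes "\<And>j a. 1 \<le> j \<Longrightarrow> j \<le> n \<Longrightarrow> 0 < ev c (env(SumJ := int j, Acc := a)) \<longleftrightarrow> P j"
    and "\<And>j a. 1 \<le> j \<Longrightarrow> j \<le> n \<Longrightarrow> P j \<Longrightarrow> ev e (env(SumJ := int j, Acc := a)) = F j"
  shows "ev (sumJ c e) env = (\<Sum>j\<in>{j \<in> J. P j}. F j)"
  unfolding sumJ_def
  by (rule eval_sum_to[where inp = inp and N = n, OF _ n_m_less_inp(1)]) (use assms in auto)

lemma real_sum_zi: "A \<subseteq> J \<Longrightarrow> real_of_int (\<Sum>j\<in>A. zi j) = real_of_int Q * (\<Sum>j\<in>A. zr j)"
  unfolding of_int_sum sum_distrib_left by (intro sum.cong refl) (auto simp: real_zi)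

text \<open>
  Properness of \<open>S'\<close> follows from the cardinality conditions: for \<open>S' = J\<close> both cardinalities are \<open>n\<close>,
  and \<open>n \<le> n - l < n\<close> is impossible.
\<close>
lemma Lower_lift_mem:
  assumes "T \<subseteq> J"
  shows "Lower_lift p T \<in> ineqs n m l u S \<longleftrightarrow>
    p \<in> {1..m} \<and> card (T \<union> S (p - 1)) \<le> n - l \<and> n - l < card (T \<union> S p)" (is "_ \<longleftrightarrow> ?R")
proof
  assume R: ?R
  have "T \<noteq> J"
  proof
    assume T: "T = J"
    have "T \<union> S (p - 1) = J" "T \<union> S p = J" using T cells[of p] R by auto
    then have "n \<le> n - l \<and> n - l < n" using R by simp
    then show False by linarith
  qed
  then show "Lower_lift p T \<in> ineqs n m l u S" using R assms by (auto simp: ineqs_def)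
qed (auto simp: ineqs_def)

lemma Upper_lift_mem:
  assumes "T \<subseteq> J"
  shows "Upper_lift p T \<in> ineqs n m l u S \<longleftrightarrow> p \<in> {1..m} \<and> card (T - S p) < u"
  using assms u2 by (auto simp: ineqs_def)

lemma ev_valueE:
  assumes env: "env Code = int c" "env Pv = int p" "env A0 = int a" "env A1 = int b" "env A2 = int e"
    and c: "c < 11"
  shows "real_of_int (ev valueE env) = (if candidates p a b e ! c \<in> ineqs n m l u S
    then real_of_int Q * violation n m l u S (zr, dr) (candidates p a b e ! c) else 0)"
proof -
  have sumZ: "real_of_int (ev (sumJ cnd (zE J')) env) = real_of_int Q * (\<Sum>j\<in>{j \<in> J. P j}. zr j)"
    if "\<And>j a. 1 \<le> j \<Longrightarrow> j \<le> n \<Longrightarrow> 0 < ev cnd (env(SumJ := int j, Acc := a)) \<longleftrightarrow> P j" for cnd P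
  proof -
    have "ev (sumJ cnd (zE J')) env = (\<Sum>j\<in>{j \<in> J. P j}. zi j)"
      by (rule ev_sumJ) (use that in \<open>auto simp: ev_zE\<close>)
    moreover have "{j \<in> J. P j} \<subseteq> J" by blast
    ultimately show ?thesis by (simp only: real_sum_zi)
  qed
  have count: "ev (sumJ cnd (Num 1)) env = int (card {j \<in> J. P j})"
    if "\<And>j a. 1 \<le> j \<Longrightarrow> j \<le> n \<Longrightarrow> 0 < ev cnd (env(SumJ := int j, Acc := a)) \<longleftrightarrow> P j" for cnd P
  proof -
    have "ev (sumJ cnd (Num 1)) env = (\<Sum>j\<in>{j \<in> J. P j}. 1)"
      by (rule ev_sumJ) (use that in auto)
    then show ?thesis by simp
  qed
  have allJ: "{j \<in> J. True} = J" by auto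
  have bt: "0 < ev (between 1 x y) env \<longleftrightarrow> 1 \<le> ev x env \<and> ev x env \<le> ev y env" for x y
    by (simp add: between_def)
  have val: "ev valueE env = ev (value_cases ! c) env"
    unfolding valueE_def using eval_by_code[of env 0 c inp value_cases] env(1) c
    by (simp add: value_cases_def)
  have di1: "real_of_int (ev (dE x) env) = real_of_int Q * dr (nat (ev x env))"
    if "1 \<le> ev x env" "ev x env \<le> int m" for x
  proof -
    have "nat (ev x env) \<in> {1..m}" using that by auto
    then show ?thesis using ev_dE[OF that] real_di by simp
  qed
  have zi1: "real_of_int (ev (zE x) env) = real_of_int Q * zr (nat (ev x env))"
    if "1 \<le> ev x env" "ev x env \<le> int n" for x
  proof -
    have "nat (ev x env) \<in> {1..n}" using that by auto
    then show ?thesis using ev_zE[OF that] real_zi by simp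
  qed
  consider "c = 0" | "c = 1" | "c = 2" | "c = 3" | "c = 4" | "c = 5" | "c = 6" | "c = 7" | "c = 8" | "c = 9" | "c = 10"
  proof -
    have "c = 0 \<or> c = 1 \<or> c = 2 \<or> c = 3 \<or> c = 4 \<or> c = 5 \<or> c = 6 \<or> c = 7 \<or> c = 8 \<or> c = 9 \<or> c = 10"
      using c by presburger
    then show thesis using that by blast
  qed
  then show ?thesis
  proof cases
    case 1
    have "real_of_int (ev (sumJ (Num 1) (zE J')) env) = real_of_int Q * (\<Sum>j\<in>{j \<in> J. True}. zr j)"
      by (rule sumZ) simp
    then show ?thesis unfolding val allJ using 1
      by (simp add: value_cases_def candidates_def ineqs_def ev_common_denom algebra_simps)
  next
    case 2
    have "real_of_int (ev (sumJ (Num 1) (zE J')) env) = real_of_int Q * (\<Sum>j\<in>{j \<in> J. True}. zr j)"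
      by (rule sumZ) simp
    then show ?thesis unfolding val allJ using 2
      by (simp add: value_cases_def candidates_def ineqs_def ev_common_denom algebra_simps)
  next
    case 3
    show ?thesis
    proof (cases "p \<in> {1..m} \<and> a \<in> S p")
      case True
      then have "a \<in> J" using cells[of p] by auto
      then show ?thesis unfolding val using 3 True env
        by (simp add: value_cases_def candidates_def ineqs_def guard_def bt ev_in_S zi1 di1 ev_common_denom algebra_simps)
    next
      case False
      then have "Pair_le p a \<notin> ineqs n m l u S" by (auto simp: ineqs_def)
      then show ?thesis unfolding val using 3 False env
        by (auto simp: value_cases_def candidates_def guard_def bt ev_in_S)
    qed
  next
    case 4
    have "real_of_int (ev (sumJ (in_S (Num 1) J') (zE J')) env) = real_of_int Q * (\<Sum>j\<in>{j \<in> J. j \<in> S 1}. zr j)"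
      by (rule sumZ) (use m_pos in \<open>auto simp: ev_in_S\<close>)
    moreover have "{j \<in> J. j \<in> S 1} = S 1" using S_subset[of 1] m_pos by auto
    ultimately show ?thesis unfolding val using 4 m_pos
      by (simp add: value_cases_def candidates_def ineqs_def ev_common_denom di1 algebra_simps)
  next
    case 5
    show ?thesis
    proof (cases "p \<in> {1..m - 1}")
      case True
      then have "p < m" by auto
      with True show ?thesis unfolding val using 5 env
        by (simp add: value_cases_def candidates_def ineqs_def guard_def bt di1 nat_add_distrib algebra_simps)
    next
      case False
      then have "Mono p \<notin> ineqs n m l u S" by (auto simp: ineqs_def)
      then show ?thesis unfolding val using 5 False env by (auto simp: value_cases_def candidates_def guard_def bt)
    qed
  next
    case 6
    show ?thesis
    proof (cases "p \<in> {1..m - 1}")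
      case True
      then have p: "p \<in> {1..m}" "p + 1 \<in> {1..m}" "p < m" by auto
      have "real_of_int (ev (sumJ (And (in_S (Plus (Var Pv) (Num 1)) J') (Neg (in_S (Var Pv) J'))) (zE J')) env)
          = real_of_int Q * (\<Sum>j\<in>{j \<in> J. j \<in> S (p + 1) \<and> j \<notin> S p}. zr j)"
        by (rule sumZ) (use p env in \<open>auto simp: ev_in_S nat_add_distrib\<close>)
      moreover have "{j \<in> J. j \<in> S (p + 1) \<and> j \<notin> S p} = S (p + 1) - S p" using cells[OF p(2)] by auto
      ultimately show ?thesis unfolding val using 6 env True p
        by (simp add: value_cases_def candidates_def ineqs_def guard_def bt di1 nat_add_distrib algebra_simps)
    next
      case False
      then have "Cover_step p \<notin> ineqs n m l u S" by (auto simp: ineqs_def)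
      then show ?thesis unfolding val using 6 False env by (auto simp: value_cases_def candidates_def guard_def bt)
    qed
  next
    case 7
    then show ?thesis unfolding val using m_pos by (simp add: value_cases_def candidates_def ineqs_def di1)
  next
    case 8
    then show ?thesis unfolding val using env by (auto simp: value_cases_def candidates_def ineqs_def guard_def bt zi1)
  next
    case 9
    then show ?thesis unfolding val using env
      by (auto simp: value_cases_def candidates_def ineqs_def guard_def bt zi1 ev_in_S ev_common_denom algebra_simps)
  next
    case 10
    let ?T = "chosen True p a b e"
    show ?thesis
    proof (cases "p \<in> {1..m}")
      case p: True
      have mem: "0 < ev (chosenE J') (env(SumJ := int j, Acc := x)) \<longleftrightarrow> j \<in> ?T" if "1 \<le> j" "j \<le> n" for j x
        by (subst ev_chosenE[where a = a and b = b and e = e]) (use env p that 10 in auto)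
      have "ev (sumJ (chosenE J') (gainE J')) env = (\<Sum>j\<in>{j \<in> J. j \<in> ?T}. gain True p j)"
        by (rule ev_sumJ) (use mem p env 10 in \<open>auto simp: ev_gainE\<close>)
      moreover have "{j \<in> J. j \<in> ?T} = ?T" using chosen_subset by blast
      ultimately have sum: "ev (sumJ (chosenE J') (gainE J')) env = (\<Sum>j\<in>?T. gain True p j)" by simp
      have "ev (sumJ (And (chosenE J') (Neg (in_S (Var Pv) J'))) (Num 1)) env = int (card {j \<in> J. j \<in> ?T \<and> j \<notin> S p})"
        by (rule count) (use mem p env in \<open>auto simp: ev_in_S\<close>)
      moreover have "{j \<in> J. j \<in> ?T \<and> j \<notin> S p} = ?T - S p" using chosen_subset by blast
      ultimately have card: "ev (sumJ (And (chosenE J') (Neg (in_S (Var Pv) J'))) (Num 1)) env = int (card (?T - S p))"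
        by simp
      show ?thesis unfolding val using 10 p env sum card
        by (simp add: value_cases_def candidates_def guard_def bt Upper_lift_mem[OF chosen_subset]
            scaled_Upper_lift[OF p chosen_subset] ev_dE ev_common_denom del: violation.simps)
    next
      case False
      then have "Upper_lift p ?T \<notin> ineqs n m l u S" by (auto simp: ineqs_def)
      then show ?thesis unfolding val using 10 False env by (auto simp: value_cases_def candidates_def guard_def bt)
    qed
  next
    case 11
    let ?T = "chosen False p a b e"
    show ?thesis
    proof (cases "p \<in> {1..m}")
      case p: True
      have mem: "0 < ev (chosenE J') (env(SumJ := int j, Acc := x)) \<longleftrightarrow> j \<in> ?T" if "1 \<le> j" "j \<le> n" for j x
        by (subst ev_chosenE[where a = a and b = b and e = e]) (use env p that 11 in auto)
      have "ev (sumJ (chosenE J') (gainE J')) env = (\<Sum>j\<in>{j \<in> J. j \<in> ?T}. gain False p j)"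
        by (rule ev_sumJ) (use mem p env 11 in \<open>auto simp: ev_gainE\<close>)
      moreover have "{j \<in> J. j \<in> ?T} = ?T" using chosen_subset by blast
      ultimately have sum: "ev (sumJ (chosenE J') (gainE J')) env = (\<Sum>j\<in>?T. gain False p j)" by simp
      have "ev (sumJ (Num 1) (excessE J')) env = (\<Sum>j\<in>{j \<in> J. True}. excess p j)"
        by (rule ev_sumJ) (use p env in \<open>auto simp: ev_excessE\<close>)
      then have exc: "ev (sumJ (Num 1) (excessE J')) env = (\<Sum>j\<in>J. excess p j)"
        unfolding allJ .
      have "ev (sumJ (Or (chosenE J') (in_S (Var Pv) J')) (Num 1)) env = int (card {j \<in> J. j \<in> ?T \<or> j \<in> S p})"
        by (rule count) (use mem p env in \<open>auto simp: ev_in_S\<close>)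
      moreover have "{j \<in> J. j \<in> ?T \<or> j \<in> S p} = ?T \<union> S p"
        using chosen_subset[of False p a b e] cells[OF p] by auto
      ultimately have card1: "ev (sumJ (Or (chosenE J') (in_S (Var Pv) J')) (Num 1)) env = int (card (?T \<union> S p))"
        by simp
      have "ev (sumJ (Or (chosenE J') (in_S (Minus (Var Pv) (Num 1)) J')) (Num 1)) env
          = int (card {j \<in> J. j \<in> ?T \<or> j \<in> S (p - 1)})"
        by (rule count) (use mem p env in \<open>auto simp: ev_in_S nat_diff_distrib'\<close>)
      moreover have "{j \<in> J. j \<in> ?T \<or> j \<in> S (p - 1)} = ?T \<union> S (p - 1)"
        using chosen_subset[of False p a b e] cells[OF p] by auto
      ultimately have card2: "ev (sumJ (Or (chosenE J') (in_S (Minus (Var Pv) (Num 1)) J')) (Num 1)) env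
          = int (card (?T \<union> S (p - 1)))"
        by simp
      have nl: "int n - int l = int (n - l)" using l_le_n by simp
      show ?thesis unfolding val using 11 p env sum exc card1 card2
        by (simp add: value_cases_def candidates_def guard_def bt Lower_lift_mem[OF chosen_subset]
            scaled_Lower_lift[OF p chosen_subset] ev_dE nl del: violation.simps)
    next
      case False
      then have "Lower_lift p ?T \<notin> ineqs n m l u S" by (auto simp: ineqs_def)
      then show ?thesis unfolding val using 11 False env by (auto simp: value_cases_def candidates_def guard_def bt)
    qed
  qed
qed

lemma ev_valueE_large:
  "env Code = int c \<Longrightarrow> 11 \<le> c \<Longrightarrow> ev valueE env = 0"
  unfolding valueE_def using eval_by_code[of env 0 c inp value_cases] by (simp add: value_cases_def)

lemma candidates_complete:
  assumes x: "x \<in> ineqs n m l u S"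
  shows "\<exists>c<11. \<exists>p\<le>n + m. \<exists>a\<le>n. \<exists>b\<le>n. \<exists>e\<le>n. candidates p a b e ! c \<in> ineqs n m l u S \<and>
    violation n m l u S (zr, dr) x \<le> violation n m l u S (zr, dr) (candidates p a b e ! c)"
proof -
  have witness: ?thesis if "c < 11" "p \<le> n + m" "a \<le> n" "b \<le> n" "e \<le> n"
      "candidates p a b e ! c \<in> ineqs n m l u S \<and>
       violation n m l u S (zr, dr) x \<le> violation n m l u S (zr, dr) (candidates p a b e ! c)" for c p a b e
    using that by blast
  have simple: ?thesis if "c < 11" "p \<le> n + m" "a \<le> n" "candidates p a 0 0 ! c = x" for c p a
    by (rule witness[of c p a 0 0]) (use that x in auto)
  show ?thesis
  proof (cases x)
    case Card_ge
    then show ?thesis by (intro simple[of 0 0 0]) (auto simp: candidates_def)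
  next
    case Card_le
    then show ?thesis by (intro simple[of 1 0 0]) (auto simp: candidates_def)
  next
    case (Pair_le i j)
    then have "i \<in> {1..m}" "j \<in> S i" using x by (auto simp: ineqs_def)
    then have "i \<le> m" "j \<le> n" using S_subset[of i] by auto
    then show ?thesis using Pair_le by (intro simple[of 2 i j]) (auto simp: candidates_def)
  next
    case Cover_first
    then show ?thesis by (intro simple[of 3 0 0]) (auto simp: candidates_def)
  next
    case (Mono i)
    then show ?thesis using x by (intro simple[of 4 i 0]) (auto simp: candidates_def ineqs_def)
  next
    case (Cover_step i)
    then show ?thesis using x by (intro simple[of 5 i 0]) (auto simp: candidates_def ineqs_def)
  next
    case Last_nonneg
    then show ?thesis by (intro simple[of 6 0 0]) (auto simp: candidates_def)
  next
    case (Nonneg j)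
    then show ?thesis using x by (intro simple[of 7 j 0]) (auto simp: candidates_def ineqs_def)
  next
    case (Le_one j)
    then show ?thesis using x by (intro simple[of 8 j 0]) (auto simp: candidates_def ineqs_def)
  next
    case (Upper_lift p A)
    then have A: "p \<in> {1..m}" "A \<subseteq> J" using x by (auto simp: ineqs_def)
    let ?a = "card (A \<inter> S (p - 1))" and ?b = "card (A \<inter> (S p - S (p - 1)))" and ?e = "card (A - S p)"
    let ?T = "chosen True p ?a ?b ?e"
    note dom = chosen_dominates[OF A, of True]
    have le: "?a \<le> n" "?b \<le> n" "?e \<le> n"
      using A(2) card_mono[of J "A \<inter> S (p - 1)"] card_mono[of J "A \<inter> (S p - S (p - 1))"] card_mono[of J "A - S p"]
      by auto
    have "Upper_lift p ?T \<in> ineqs n m l u S"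
      using x unfolding Upper_lift Upper_lift_mem[OF A(2)] Upper_lift_mem[OF chosen_subset] dom(1) .
    moreover have "real_of_int Q * violation n m l u S (zr, dr) x
        \<le> real_of_int Q * violation n m l u S (zr, dr) (Upper_lift p ?T)"
      unfolding Upper_lift scaled_Upper_lift[OF A] scaled_Upper_lift[OF A(1) chosen_subset] of_int_le_iff
      using dom(4) by (intro add_left_mono)
    then have "violation n m l u S (zr, dr) x \<le> violation n m l u S (zr, dr) (Upper_lift p ?T)"
      using Q_pos by (simp only: mult_le_cancel_left_pos of_int_0_less_iff)
    ultimately have "candidates p ?a ?b ?e ! 9 \<in> ineqs n m l u S \<and>
        violation n m l u S (zr, dr) x \<le> violation n m l u S (zr, dr) (candidates p ?a ?b ?e ! 9)"
      by (simp add: candidates_def del: violation.simps)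
    then show ?thesis by (rule witness[rotated 5]) (use le A(1) in auto)
  next
    case (Lower_lift p A)
    then have A: "p \<in> {1..m}" "A \<subseteq> J" using x by (auto simp: ineqs_def)
    let ?a = "card (A \<inter> S (p - 1))" and ?b = "card (A \<inter> (S p - S (p - 1)))" and ?e = "card (A - S p)"
    let ?T = "chosen False p ?a ?b ?e"
    note dom = chosen_dominates[OF A, of False]
    have le: "?a \<le> n" "?b \<le> n" "?e \<le> n"
      using A(2) card_mono[of J "A \<inter> S (p - 1)"] card_mono[of J "A \<inter> (S p - S (p - 1))"] card_mono[of J "A - S p"]
      by auto
    have "Lower_lift p ?T \<in> ineqs n m l u S"
      using x unfolding Lower_lift Lower_lift_mem[OF A(2)] Lower_lift_mem[OF chosen_subset] dom(2,3) .
    moreover have "real_of_int Q * violation n m l u S (zr, dr) x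
        \<le> real_of_int Q * violation n m l u S (zr, dr) (Lower_lift p ?T)"
      unfolding Lower_lift scaled_Lower_lift[OF A] scaled_Lower_lift[OF A(1) chosen_subset] of_int_le_iff
      using dom(4) by (intro add_left_mono)
    then have "violation n m l u S (zr, dr) x \<le> violation n m l u S (zr, dr) (Lower_lift p ?T)"
      using Q_pos by (simp only: mult_le_cancel_left_pos of_int_0_less_iff)
    ultimately have "candidates p ?a ?b ?e ! 10 \<in> ineqs n m l u S \<and>
        violation n m l u S (zr, dr) x \<le> violation n m l u S (zr, dr) (candidates p ?a ?b ?e ! 10)"
      by (simp add: candidates_def del: violation.simps)
    then show ?thesis by (rule witness[rotated 5]) (use le A(1) in auto)
  qed
qed

lemma ev_header_length:
  assumes "env Code = int c"
  shows "ev header_length env = (if c < 11 then [1, 1, 3, 1, 2, 2, 1, 2, 2, 2, 2] ! c else 0)"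
proof -
  let ?ns = "[1, 1, 3, 1, 2, 2, 1, 2, 2, 2, 2] :: int list"
  have "header_length = by_code (int 0) (map Num ?ns)" by (simp add: header_length_def)
  then have "ev header_length env = (if c < length ?ns then ev (map Num ?ns ! c) env else 0)"
    using eval_by_code[of env 0 c inp "map Num ?ns"] assms by simp
  then show ?thesis by (simp add: nth_map[of c ?ns] del: nth_Cons_numeral list.map)
qed

lemma ev_chosen_facts:
  assumes env: "env Code = int c" "env Pv = int p" "env A0 = int a" "env A1 = int b" "env A2 = int e"
    and p: "p \<in> {1..m}"
  defines "T \<equiv> chosen (c = 9) p a b e"
  shows "ev (sumJ (chosenE J') (Num 1)) env = int (card T)"
    and "env Pos = int q + 3 \<Longrightarrow> q < card T \<Longrightarrow> ev elementE env = int (sorted_list_of_set T ! q)"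
proof -
  have TJ: "T \<subseteq> J" unfolding T_def by (rule chosen_subset)
  have mem: "0 < ev (chosenE j) env' \<longleftrightarrow> nat (ev j env') \<in> T"
    if "env' Code = int c" "env' Pv = int p" "env' A0 = int a" "env' A1 = int b" "env' A2 = int e"
      "1 \<le> ev j env'" "ev j env' \<le> int n" for env' j
    unfolding T_def by (subst ev_chosenE[where a = a and b = b and e = e]) (use that p in auto)
  have "ev (sumJ (chosenE J') (Num 1)) env = (\<Sum>j\<in>{j \<in> J. j \<in> T}. 1)"
    by (rule ev_sumJ) (use env in \<open>auto simp: mem\<close>)
  moreover have "{j \<in> J. j \<in> T} = T" using TJ by blast
  ultimately show "ev (sumJ (chosenE J') (Num 1)) env = int (card T)" by simp
  assume q: "env Pos = int q + 3" "q < card T"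
  have count: "ev (sum_to ElI nE (And (chosenE (Var ElI)) (Lt (Var ElI) (Var ElJ))) (Num 1)) (env(ElJ := int j, Acc := x))
      = int (card {i \<in> T. i < j})" for j x
  proof -
    have "ev (sum_to ElI nE (And (chosenE (Var ElI)) (Lt (Var ElI) (Var ElJ))) (Num 1)) (env(ElJ := int j, Acc := x))
        = (\<Sum>i\<in>{i \<in> J. i \<in> T \<and> i < j}. 1)"
      by (rule eval_sum_to[where inp = inp and N = n, OF _ n_m_less_inp(1)]) (use env in \<open>auto simp: mem\<close>)
    moreover have "{i \<in> J. i \<in> T \<and> i < j} = {i \<in> T. i < j}" using TJ by blast
    ultimately show ?thesis by simp
  qed
  have "ev elementE env = (\<Sum>j\<in>{j \<in> J. j \<in> T \<and> card {i \<in> T. i < j} = q}. int j)"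
    unfolding elementE_def
    by (rule eval_sum_to[where inp = inp and N = n, OF _ n_m_less_inp(1)]) (use env q(1) count in \<open>auto simp: mem\<close>)
  also have "{j \<in> J. j \<in> T \<and> card {i \<in> T. i < j} = q} = {j \<in> T. card {i \<in> T. i < j} = q}" using TJ by blast
  also have "\<dots> = {sorted_list_of_set T ! q}"
    by (rule position_unique) (use TJ finite_subset q(2) in auto)
  finally show "ev elementE env = int (sorted_list_of_set T ! q)" by simp
qed

lemma ev_outputE:
  assumes env: "env Code = int c" "env Pv = int p" "env A0 = int a" "env A1 = int b" "env A2 = int e"
    and c: "c < 11" and mem: "candidates p a b e ! c \<in> ineqs n m l u S"
    and k: "env Pos = int k" "k \<le> length (encode_ineq (candidates p a b e ! c))"
  shows "ev outputE env = (int (length (encode_ineq (candidates p a b e ! c)))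
    # encode_ineq (candidates p a b e ! c)) ! k"
proof (cases "c < 9")
  case True
  then consider "c = 0" | "c = 1" | "c = 2" | "c = 3" | "c = 4" | "c = 5" | "c = 6" | "c = 7" | "c = 8"
    by linarith
  then show ?thesis
  proof cases
    case 3
    then have "k = 0 \<or> k = 1 \<or> k = 2 \<or> k = 3" using k(2) by (auto simp: candidates_def)
    then show ?thesis using 3 env k by (auto simp: outputE_def candidates_def ev_header_length)
  qed (use env k in \<open>auto simp: outputE_def candidates_def ev_header_length nth_Cons' le_Suc_eq\<close>)
next
  case False
  let ?T = "chosen (c = 9) p a b e"
  have c': "c = 9 \<or> c = 10" using False c by auto
  then have p: "p \<in> {1..m}" using mem by (auto simp: candidates_def ineqs_def)
  have enc: "encode_ineq (candidates p a b e ! c) = [int c, int p] @ map int (sorted_list_of_set ?T)"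
    using c' by (auto simp: candidates_def)
  have fin: "finite ?T" by (rule finite_subset[OF chosen_subset]) simp
  have len: "length (encode_ineq (candidates p a b e ! c)) = 2 + card ?T" unfolding enc by simp
  have hl: "ev header_length env = 2" using c' env(1) by (auto simp: ev_header_length)
  note facts = ev_chosen_facts[OF env p]
  consider "k = 0" | "k = 1" | "k = 2" | q where "k = q + 3" "q < card ?T"
  proof -
    assume a: "k = 0 \<Longrightarrow> thesis" "k = 1 \<Longrightarrow> thesis" "k = 2 \<Longrightarrow> thesis"
      "\<And>q. k = q + 3 \<Longrightarrow> q < card ?T \<Longrightarrow> thesis"
    show thesis
    proof (cases "k < 3")
      case True
      then have "k = 0 \<or> k = 1 \<or> k = 2" by auto
      then show thesis using a by blast
    next
      case False
      then have "k = (k - 3) + 3" "k - 3 < card ?T" using k(2) len by auto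
      then show thesis by (rule a(4))
    qed
  qed
  then show ?thesis
  proof cases
    case 1
    then show ?thesis using k(1) c' env(1) hl facts(1) len by (auto simp: outputE_def)
  next
    case 2
    then show ?thesis unfolding enc using k(1) env by (simp add: outputE_def)
  next
    case 3
    then show ?thesis unfolding enc using k(1) env by (simp add: outputE_def)
  next
    case (4 q)
    then have "ev elementE env = int (sorted_list_of_set ?T ! q)"
      using k(1) by (intro facts(2)) auto
    then show ?thesis unfolding enc using 4 k(1) env False by (simp add: outputE_def numeral_3_eq_3)
  qed
qed

section \<open>Convex hull and separation\<close>

lemma separation_output:
  assumes out: "(zr, dr) \<notin> convex hull (X n m l u S)"
  shows "\<exists>y. most_violated n m l u S (zr, dr) y \<and> length (encode_ineq y) < length encoding \<and>
    (\<forall>k\<le>length (encode_ineq y). ev separationE ((\<lambda>_. 0)(Pos := int k))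
      = (int (length (encode_ineq y)) # encode_ineq y) ! k)"
proof -
  let ?xs = "[Code, Pv, A0, A1, A2]"
  define sol where "sol = solution inp ?xs valueE (\<lambda>_. 0)"
  have "Best \<notin> set ?xs" "Best \<notin> free_vars valueE" "0 < inp 0"
    using free_vars_valueE[of Best] n_m_less_inp(1) by auto
  note best = solution_correct[where inp = inp and env = "\<lambda>_. 0", OF this, folded sol_def]
  have "\<forall>x\<in>set ?xs. 0 \<le> sol x" using best by blast
  then obtain c p a b e where sol: "sol Code = int c" "sol Pv = int p" "sol A0 = int a" "sol A1 = int b" "sol A2 = int e"
    by (simp add: zero_le_imp_eq_int) (metis zero_le_imp_eq_int)
  have max: "ev valueE env \<le> ev valueE sol"
    if "\<And>y. y \<notin> set ?xs \<Longrightarrow> env y = 0" "\<And>x. x \<in> set ?xs \<Longrightarrow> 0 \<le> env x \<and> env x < inp 0" for env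
    by (rule best[THEN conjunct2, rule_format]) (use that in blast)
  let ?viol = "violation n m l u S (zr, dr)"
  have dominated: "real_of_int Q * ?viol x \<le> real_of_int (ev valueE sol)" if x: "x \<in> ineqs n m l u S" for x
  proof -
    obtain c' p' a' b' e' where y: "c' < 11" "p' \<le> n + m" "a' \<le> n" "b' \<le> n" "e' \<le> n"
        "candidates p' a' b' e' ! c' \<in> ineqs n m l u S" "?viol x \<le> ?viol (candidates p' a' b' e' ! c')"
      using candidates_complete[OF x] by blast
    define env where "env = (\<lambda>_. 0)(Code := int c', Pv := int p', A0 := int a', A1 := int b', A2 := int e')"
    have "real_of_int Q * ?viol x \<le> real_of_int Q * ?viol (candidates p' a' b' e' ! c')"
      using y(7) Q_pos by (intro mult_left_mono) auto
    also have "\<dots> = real_of_int (ev valueE env)"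
      using ev_valueE[of env c' p' a' b' e'] y(1,6) by (simp add: env_def)
    also have "\<dots> \<le> real_of_int (ev valueE sol)"
      unfolding of_int_le_iff by (rule max) (use y sizes in \<open>auto simp: env_def inp_0\<close>)
    finally show ?thesis .
  qed
  \<comment> \<open>Some violation is positive, which rules out the value \<open>0\<close> of the invalid parameters.\<close>
  have "\<not> satisfies zr dr" using out convex_hull_X by auto
  moreover have "zr \<in> vecs n" "dr \<in> vecs m" using z_vec d_vec by (auto simp: vecs_def)
  ultimately obtain x0 where x0: "x0 \<in> ineqs n m l u S" "0 < ?viol x0"
    by (auto simp: satisfies_def not_le)
  then have "0 < real_of_int Q * ?viol x0" using Q_pos by simp
  then have pos: "0 < real_of_int (ev valueE sol)" using dominated[OF x0(1)] by linarith
  then have c: "c < 11" using ev_valueE_large[of sol c, OF sol(1)] by (cases "c < 11") auto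
  let ?y = "candidates p a b e ! c"
  have y: "?y \<in> ineqs n m l u S" "real_of_int (ev valueE sol) = real_of_int Q * ?viol ?y"
    using ev_valueE[OF sol c] pos by (auto split: if_splits)
  have "most_violated n m l u S (zr, dr) ?y"
    unfolding most_violated_def
  proof (intro conjI ballI)
    show "?y \<in> ineqs n m l u S" by (rule y(1))
    have Qr: "0 < real_of_int Q" using Q_pos by simp
    show "0 < ?viol ?y" using pos Qr unfolding y(2) by (simp only: zero_less_mult_pos)
    fix x assume "x \<in> ineqs n m l u S"
    then show "?viol x \<le> ?viol ?y" using dominated Qr unfolding y(2) by (simp only: mult_le_cancel_left_pos)
  qed
  moreover have "length (encode_ineq ?y) < length encoding"
  proof -
    have "card (chosen up p a b e) \<le> n" for up using card_mono[OF _ chosen_subset[of up p a b e]] by simp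
    then have "length (encode_ineq (candidates p a b e ! i)) \<le> max 3 (n + 2)" if "i < 11" for i
    proof -
      have "\<forall>y\<in>set (candidates p a b e). length (encode_ineq y) \<le> max 3 (n + 2)"
        using \<open>\<And>up. card (chosen up p a b e) \<le> n\<close> by (simp add: candidates_def le_max_iff_disj)
      moreover have "candidates p a b e ! i \<in> set (candidates p a b e)"
        by (rule nth_mem) (use that in \<open>simp add: candidates_def\<close>)
      ultimately show ?thesis by blast
    qed
    from this[OF c] show ?thesis using sizes by linarith
  qed
  moreover have "ev separationE ((\<lambda>_. 0)(Pos := int k)) = (int (length (encode_ineq ?y)) # encode_ineq ?y) ! k"
    if "k \<le> length (encode_ineq ?y)" for k
  proof -
    have "solution inp ?xs valueE ((\<lambda>_. 0)(Pos := int k)) = sol(Pos := int k)"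
      unfolding sol_def by (rule solution_upd) (use free_vars_valueE[of Pos] in auto)
    then have "ev separationE ((\<lambda>_. 0)(Pos := int k)) = ev outputE (sol(Pos := int k))"
      unfolding separationE_def eval_search by simp
    also have "\<dots> = (int (length (encode_ineq ?y)) # encode_ineq ?y) ! k"
      by (rule ev_outputE) (use sol c y(1) that in simp_all)
    finally show ?thesis .
  qed
  ultimately show ?thesis by blast
qed

end

theorem theorem12:
  shows "(\<forall>n m l u S. nested_family n m l u S \<longrightarrow>
           convex hull (X n m l u S) =
             {(z, d). z \<in> vecs n \<and> d \<in> vecs m \<and>
                (\<forall>c\<in>ineqs n m l u S. violation n m l u S (z, d) c \<le> 0)})
       \<and> poly_time_search encode_input encode_ineq separation_inputs separates"
proof (intro conjI allI impI)
  fix n m l u S assume "nested_family n m l u S"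
  then interpret nested_system n m l u S by unfold_locales
  show "convex hull (X n m l u S) = {(z, d). z \<in> vecs n \<and> d \<in> vecs m \<and>
      (\<forall>c\<in>ineqs n m l u S. violation n m l u S (z, d) c \<le> 0)}"
    unfolding convex_hull_X satisfies_def ..
next
  show "poly_time_search encode_input encode_ineq separation_inputs separates"
  proof (rule poly_time_search_by_expression[where e = separationE and v = Pos])
    fix x assume "x \<in> separation_inputs"
    then obtain n m l u S z d where x: "x = (n, m, l, u, S, z, d)" and fam: "nested_family n m l u S"
        and zd: "z \<in> vecs n" "d \<in> vecs m" and out: "real_point z d \<notin> convex hull (X n m l u S)"
      by (auto simp: separation_inputs_def)
    interpret separation_instance n m l u S z d
      using fam zd by unfold_locales
    show "\<exists>y. separates x y \<and> length (encode_ineq y) < length (encode_input x) \<and>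
        (\<forall>k\<le>length (encode_ineq y). eval_ex (initial_memory (encode_input x)) separationE ((\<lambda>_. 0)(Pos := int k))
          = (int (length (encode_ineq y)) # encode_ineq y) ! k)"
      using separation_output out unfolding x separates.simps real_point_def inp_def encoding_def by blast
  qed
qed

end
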